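(* Let $\{T_1,T_2\}$ be a dual pair of symmetric contractions in $\mathfrak H=\mathfrak H_1\oplus\mathfrak H_2$, with blocks $T_{11}=T_{11}^*$, $T_{21}=VD_{T_{11}}$, $T_{12}=D_{T_{11}}U$; let $Q$ be the closure of $Q_0=D_{V^*}^{-1}(I-VU)D_U^{-1}$, $\varphi_1:=\arccos(\|Q_0\|^{-1})>0$, $\varphi\in[\varphi_1,\pi/2]$, $\kappa^+,\kappa^-\in\mathbb Z_+$. For bounded $K\in[\mathcal H_1,\mathcal H_2]$ (not necessarily a contraction) let $T_K=\begin{pmatrix}T_{11}&T_{12}\\ T_{21}&-VT_{11}U+D_{V^*}KD_U\end{pmatrix}$. Then $$T_K\in C_{\mathfrak H}(\varphi;\kappa^\pm)\iff K\sin\varphi\pm iQ\cos\varphi\in C(\pi/2;\kappa^\pm).$$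
   Context: Hilbert spaces are complex and separable; $[\mathfrak H,\mathfrak K]$ denotes bounded operators from $\mathfrak H$ to $\mathfrak K$. For a contraction $X$, $D_X:=(I-X^*X)^{1/2}$. A dual pair of symmetric contractions in $\mathfrak H=\mathfrak H_1\oplus\mathfrak H_2$ is a pair of contractions $T_1,T_2\in[\mathfrak H_1,\mathfrak H]$ with $(T_1f,g)=(f,T_2g)$ and $(T_jf,g)=(f,T_jg)$ for $f,g\in\mathfrak H_1$. Equivalently $T_1=\binom{T_{11}}{T_{21}}$, $T_2=\binom{T_{11}}{T_{12}^*}$ with $T_{11}=T_{11}^*$, $T_{21}=VD_{T_{11}}$, $T_{12}=D_{T_{11}}U$, where $V\in[\mathfrak H_1,\mathfrak H_2]$, $U\in[\mathfrak H_2,\mathfrak H_1]$ are the contractions uniquely determined by additionally requiring $\ker V\supset\ker D_{T_{11}}$ and $\ker U^*\supset\ker D_{T_{11}}$. $\mathcal H_1:=\overline{\mathrm{ran}}\,D_U$, $\mathcal H_2:=\overline{\mathrm{ran}}\,D_{V^*}$. Conventions on $Q_0$: $Q_0$ is called bounded if there is $Q\in[\mathcal H_1,\mathcal H_2]$ with $I-VU=D_{V^*}QD_U$ on $\mathfrak H_2$; then $Q$ is unique, is the closure of $Q_0$, and $\|Q_0\|=\|Q\|$. Otherwise $\|Q_0\|^{-1}:=0$, so $\varphi_1=\pi/2$; for $\varphi=\pi/2$, $Q\cos\varphi$ is read as $0$. If $Q_0$ is bounded and $\mathcal H_1=\{0\}$ or $\mathcal H_2=\{0\}$, then $\varphi_1:=0$.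 For a bounded selfadjoint $A$ with spectral measure $E_A$, $\kappa_-(A):=\dim E_A(-\infty,0)$ (dimension of the range). A bounded operator $X$ between Hilbert spaces is in $C(\pi/2;\kappa)$ if $\kappa_-(I-X^*X)=\kappa$. $T\in C_{\mathfrak H}(\varphi;\kappa^\pm)$ means $T\sin\varphi+i\cos\varphi\, I\in C(\pi/2;\kappa^+)$ and $T\sin\varphi-i\cos\varphi\, I\in C(\pi/2;\kappa^-)$; likewise the right-hand side of the equivalence means that both the relation with upper signs and the relation with lower signs hold. *)

theory Defs
  imports "HOL-Analysis.Analysis"
begin

section \<open>Complex separable Hilbert spaces\<close>

text \<open>The inner product is linear in the first argument. Norm and topology are those of the
  underlying real inner product space, whose inner product is the real part of the complex one.\<close>

class complex_inner = real_inner +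
  fixes scaleC :: "complex \<Rightarrow> 'a \<Rightarrow> 'a"  (infixr "*\<^sub>C" 75)
    and cinner :: "'a \<Rightarrow> 'a \<Rightarrow> complex"
  assumes scaleC_add_right: "a *\<^sub>C (x + y) = a *\<^sub>C x + a *\<^sub>C y"
    and scaleC_add_left: "(a + b) *\<^sub>C x = a *\<^sub>C x + b *\<^sub>C x"
    and scaleC_scaleC: "a *\<^sub>C b *\<^sub>C x = (a * b) *\<^sub>C x"
    and scaleR_scaleC: "r *\<^sub>R x = complex_of_real r *\<^sub>C x"
    and cinner_commute: "cinner x y = cnj (cinner y x)"
    and cinner_add_left: "cinner (x + y) z = cinner x z + cinner y z"
    and cinner_scaleC_left: "cinner (a *\<^sub>C x) y = a * cinner x y"
    and inner_eq_Re_cinner: "inner x y = Re (cinner x y)"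

text \<open>For metric spaces, second countability is the same as separability.\<close>

class separable_hilbert = complex_inner + complete_space + second_countable_topology

lemma scaleC_one: "1 *\<^sub>C (x :: 'a :: complex_inner) = x"
  using scaleR_scaleC[of 1 x] by simp

global_interpretation complex_vector:
  vector_space "scaleC :: complex \<Rightarrow> 'a \<Rightarrow> 'a :: complex_inner"
  by unfold_locales (simp_all add: scaleC_add_right scaleC_add_left scaleC_scaleC scaleC_one)

text \<open>The orthogonal sum of two Hilbert spaces is their product type.\<close>

instantiation prod :: (complex_inner, complex_inner) complex_inner
begin

definition scaleC_prod_def: "a *\<^sub>C p = (a *\<^sub>C fst p, a *\<^sub>C snd p)"

definition cinner_prod_def: "cinner p q = cinner (fst p) (fst q) + cinner (snd p) (snd q)"

instance
proof
  fix a b :: complex and r :: real and x y z :: "'a \<times> 'b"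
  show "a *\<^sub>C (x + y) = a *\<^sub>C x + a *\<^sub>C y"
    by (simp add: scaleC_prod_def scaleC_add_right)
  show "(a + b) *\<^sub>C x = a *\<^sub>C x + b *\<^sub>C x"
    by (simp add: scaleC_prod_def scaleC_add_left)
  show "a *\<^sub>C b *\<^sub>C x = (a * b) *\<^sub>C x"
    by (simp add: scaleC_prod_def scaleC_scaleC)
  show "r *\<^sub>R x = complex_of_real r *\<^sub>C x"
    by (simp add: scaleC_prod_def scaleR_prod_def scaleR_scaleC)
  show "cinner x y = cnj (cinner y x)"
    by (simp add: cinner_prod_def cinner_commute[of "fst x"] cinner_commute[of "snd x"])
  show "cinner (x + y) z = cinner x z + cinner y z"
    by (simp add: cinner_prod_def cinner_add_left)
  show "cinner (a *\<^sub>C x) y = a * cinner x y"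
    by (simp add: cinner_prod_def scaleC_prod_def cinner_scaleC_left distrib_left)
  show "inner x y = Re (cinner x y)"
    by (simp add: cinner_prod_def inner_prod_def inner_eq_Re_cinner)
qed

end

instance prod :: (separable_hilbert, separable_hilbert) separable_hilbert ..

definition ecdim :: "'a :: complex_inner set \<Rightarrow> enat" where
  "ecdim S = (if \<exists>B. finite B \<and> S \<subseteq> complex_vector.span B
              then enat (complex_vector.dim S) else \<infinity>)"

section \<open>Bounded operators between closed subspaces\<close>

text \<open>An operator from a closed subspace \<open>M\<close> to a closed subspace \<open>N\<close> is a function on the ambient
  types of which only the values on \<open>M\<close> matter. A whole Hilbert space is \<open>UNIV\<close>.\<close>

definition bounded_op :: "'a :: complex_inner set \<Rightarrow> 'b :: complex_inner set \<Rightarrow> ('a \<Rightarrow> 'b) \<Rightarrow> bool"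
  where
  "bounded_op M N X \<longleftrightarrow>
     (\<forall>x\<in>M. X x \<in> N) \<and>
     (\<forall>x\<in>M. \<forall>y\<in>M. X (x + y) = X x + X y) \<and>
     (\<forall>a. \<forall>x\<in>M. X (a *\<^sub>C x) = a *\<^sub>C X x) \<and>
     (\<exists>c. \<forall>x\<in>M. norm (X x) \<le> c * norm x)"

definition contraction :: "('a :: complex_inner \<Rightarrow> 'b :: complex_inner) \<Rightarrow> bool" where
  "contraction X \<longleftrightarrow> bounded_op UNIV UNIV X \<and> (\<forall>x. norm (X x) \<le> norm x)"

definition op_norm :: "'a :: complex_inner set \<Rightarrow> ('a \<Rightarrow> 'b :: complex_inner) \<Rightarrow> real" where
  "op_norm M X = Sup {norm (X x) |x. x \<in> M \<and> norm x \<le> 1}"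

text \<open>The adjoint of a bounded operator \<open>X\<close> with domain \<open>M\<close>, given by the Riesz representation
  theorem on \<open>M\<close>; the target space of \<open>X\<close> does not enter.\<close>

definition adj :: "'a :: complex_inner set \<Rightarrow> ('a \<Rightarrow> 'b :: complex_inner) \<Rightarrow> 'b \<Rightarrow> 'a" where
  "adj M X g = (THE h. h \<in> M \<and> (\<forall>f\<in>M. cinner (X f) g = cinner f h))"

definition positive_op :: "('a :: complex_inner \<Rightarrow> 'a) \<Rightarrow> bool" where
  "positive_op S \<longleftrightarrow>
     bounded_op UNIV UNIV S \<and> (\<forall>f. cinner (S f) f \<in> \<real> \<and> 0 \<le> Re (cinner (S f) f))"

definition op_sqrt :: "('a :: complex_inner \<Rightarrow> 'a) \<Rightarrow> 'a \<Rightarrow> 'a" where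
  "op_sqrt A = (THE S. positive_op S \<and> S \<circ> S = A)"

definition defect :: "('a :: complex_inner \<Rightarrow> 'b :: complex_inner) \<Rightarrow> 'a \<Rightarrow> 'a" where
  "defect X = op_sqrt (\<lambda>f. f - adj UNIV X (X f))"

definition defect_space :: "('a :: complex_inner \<Rightarrow> 'b :: complex_inner) \<Rightarrow> 'a set" where
  "defect_space X = closure (range (defect X))"

section \<open>Spectral measures and negative squares\<close>

definition orth_projection :: "'a :: complex_inner set \<Rightarrow> ('a \<Rightarrow> 'a) \<Rightarrow> bool" where
  "orth_projection M P \<longleftrightarrow>
     bounded_op M M P \<and> (\<forall>x\<in>M. P (P x) = P x) \<and>
     (\<forall>x\<in>M. \<forall>y\<in>M. cinner (P x) y = cinner x (P y))"

definition scalar_measure ::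
    "(real set \<Rightarrow> 'a \<Rightarrow> 'a) \<Rightarrow> 'a :: complex_inner \<Rightarrow> real measure" where
  "scalar_measure E x = measure_of UNIV (sets borel) (\<lambda>B. ennreal (Re (cinner (E B x) x)))"

text \<open>\<open>E\<close> is the spectral measure of the bounded selfadjoint operator \<open>A\<close> on \<open>M\<close>: a boundedly
  supported projection-valued Borel measure with \<open>A = \<integral> t dE(t)\<close>, the integral being understood
  through the quadratic forms.\<close>

definition is_spectral_measure ::
    "'a :: complex_inner set \<Rightarrow> ('a \<Rightarrow> 'a) \<Rightarrow> (real set \<Rightarrow> 'a \<Rightarrow> 'a) \<Rightarrow> bool" where
  "is_spectral_measure M A E \<longleftrightarrow>
     (\<forall>B\<in>sets borel. orth_projection M (E B)) \<and>
     (\<forall>x\<in>M. E UNIV x = x) \<and>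
     (\<forall>F :: nat \<Rightarrow> real set. range F \<subseteq> sets borel \<longrightarrow> disjoint_family F \<longrightarrow>
        (\<forall>x\<in>M. (\<lambda>n. E (F n) x) sums E (\<Union>n. F n) x)) \<and>
     (\<exists>r. \<forall>x\<in>M. E {-r..r} x = x) \<and>
     (\<forall>x\<in>M. cinner (A x) x = complex_of_real (\<integral>t. t \<partial>scalar_measure E x))"

text \<open>For bounded selfadjoint \<open>A\<close>, the spectral theorem says that such an \<open>E\<close> exists and that its
  values on Borel sets are unique as operators on \<open>M\<close>.\<close>

definition spectral_measure ::
    "'a :: complex_inner set \<Rightarrow> ('a \<Rightarrow> 'a) \<Rightarrow> real set \<Rightarrow> 'a \<Rightarrow> 'a" where
  "spectral_measure M A = (SOME E. is_spectral_measure M A E)"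

definition kappa_minus :: "'a :: complex_inner set \<Rightarrow> ('a \<Rightarrow> 'a) \<Rightarrow> enat" where
  "kappa_minus M A = ecdim (spectral_measure M A {..<0} ` M)"

text \<open>\<open>X \<in> C(\<pi>/2; \<kappa>)\<close> for a bounded operator \<open>X\<close> from \<open>M\<close> to \<open>N\<close>.\<close>

definition in_C_half_pi ::
    "'a :: complex_inner set \<Rightarrow> 'b :: complex_inner set \<Rightarrow> ('a \<Rightarrow> 'b) \<Rightarrow> nat \<Rightarrow> bool" where
  "in_C_half_pi M N X \<kappa> \<longleftrightarrow>
     bounded_op M N X \<and> kappa_minus M (\<lambda>f. f - adj M X (X f)) = enat \<kappa>"

text \<open>\<open>T \<in> C(\<phi>; \<kappa>\<^sup>\<plusminus>)\<close> for an operator \<open>T\<close> in the whole Hilbert space.\<close>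

definition in_C :: "real \<Rightarrow> nat \<Rightarrow> nat \<Rightarrow> ('a :: complex_inner \<Rightarrow> 'a) \<Rightarrow> bool" where
  "in_C \<phi> \<kappa>p \<kappa>m T \<longleftrightarrow>
     in_C_half_pi UNIV UNIV (\<lambda>f. sin \<phi> *\<^sub>R T f + (\<i> * cos \<phi>) *\<^sub>C f) \<kappa>p \<and>
     in_C_half_pi UNIV UNIV (\<lambda>f. sin \<phi> *\<^sub>R T f - (\<i> * cos \<phi>) *\<^sub>C f) \<kappa>m"

section \<open>Dual pairs of symmetric contractions\<close>

text \<open>The subspace \<open>\<HH>\<^sub>1\<close> of \<open>\<HH>\<^sub>1 \<oplus> \<HH>\<^sub>2\<close> consists of the pairs \<open>(f, 0)\<close>.\<close>

definition dual_pair ::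
    "('a :: complex_inner \<Rightarrow> 'a \<times> 'b :: complex_inner) \<Rightarrow> ('a \<Rightarrow> 'a \<times> 'b) \<Rightarrow> bool" where
  "dual_pair T1 T2 \<longleftrightarrow>
     contraction T1 \<and> contraction T2 \<and>
     (\<forall>f g. cinner (T1 f) (g, 0) = cinner (f, 0) (T2 g)) \<and>
     (\<forall>f g. cinner (T1 f) (g, 0) = cinner (f, 0) (T1 g)) \<and>
     (\<forall>f g. cinner (T2 f) (g, 0) = cinner (f, 0) (T2 g))"

text \<open>\<open>Q\<^sub>0\<close> is the product of the inverse of \<open>defect (adj UNIV V)\<close>, of \<open>I - VU\<close>, and of the inverse of
  \<open>defect U\<close>. It is bounded iff there is a bounded operator \<open>Q\<close> from \<open>defect_space U\<close> to
  \<open>defect_space (adj UNIV V)\<close> with \<open>is_Q V U Q\<close>; such a \<open>Q\<close> is unique on \<open>defect_space U\<close>, is the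
  closure of \<open>Q\<^sub>0\<close> and has the same norm.\<close>

definition is_Q ::
    "('a :: complex_inner \<Rightarrow> 'b :: complex_inner) \<Rightarrow> ('b \<Rightarrow> 'a) \<Rightarrow> ('b \<Rightarrow> 'b) \<Rightarrow> bool" where
  "is_Q V U Q \<longleftrightarrow>
     bounded_op (defect_space U) (defect_space (adj UNIV V)) Q \<and>
     (\<forall>h. h - V (U h) = defect (adj UNIV V) (Q (defect U h)))"

definition Q0_bounded ::
    "('a :: complex_inner \<Rightarrow> 'b :: complex_inner) \<Rightarrow> ('b \<Rightarrow> 'a) \<Rightarrow> bool" where
  "Q0_bounded V U \<longleftrightarrow> (\<exists>Q. is_Q V U Q)"

text \<open>If \<open>Q\<^sub>0\<close> is unbounded, \<open>Q_op V U\<close> is an unspecified function. In that case \<open>phi1 V U = pi/2\<close>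
  below, and \<open>Q_op\<close> is only used multiplied by \<open>cos (pi/2) = 0\<close>.\<close>

definition Q_op ::
    "('a :: complex_inner \<Rightarrow> 'b :: complex_inner) \<Rightarrow> ('b \<Rightarrow> 'a) \<Rightarrow> 'b \<Rightarrow> 'b" where
  "Q_op V U = (SOME Q. is_Q V U Q)"

definition Q0_norm_inverse ::
    "('a :: complex_inner \<Rightarrow> 'b :: complex_inner) \<Rightarrow> ('b \<Rightarrow> 'a) \<Rightarrow> real" where
  "Q0_norm_inverse V U =
     (if Q0_bounded V U then inverse (op_norm (defect_space U) (Q_op V U)) else 0)"

text \<open>If \<open>Q\<^sub>0\<close> is bounded and both defect spaces are nontrivial, its norm is at least \<open>1\<close>, so that
  \<open>arccos\<close> is applied within its domain.\<close>

definition phi1 ::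
    "('a :: complex_inner \<Rightarrow> 'b :: complex_inner) \<Rightarrow> ('b \<Rightarrow> 'a) \<Rightarrow> real" where
  "phi1 V U =
     (if Q0_bounded V U \<and> (defect_space U = {0} \<or> defect_space (adj UNIV V) = {0}) then 0
      else arccos (Q0_norm_inverse V U))"

definition T_ext ::
    "('a :: complex_inner \<Rightarrow> 'a) \<Rightarrow> ('b :: complex_inner \<Rightarrow> 'a) \<Rightarrow> ('a \<Rightarrow> 'b) \<Rightarrow>
     ('a \<Rightarrow> 'b) \<Rightarrow> ('b \<Rightarrow> 'a) \<Rightarrow> ('b \<Rightarrow> 'b) \<Rightarrow> 'a \<times> 'b \<Rightarrow> 'a \<times> 'b" where
  "T_ext T11 T12 T21 V U K = (\<lambda>(f, h).
     (T11 f + T12 h,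
      T21 f + (- V (T11 (U h)) + defect (adj UNIV V) (K (defect U h)))))"

end

theory Submission
  imports Defs
begin

text \<open>Put \<open>X = T\<^sub>K sin \<phi> \<plusminus> i cos \<phi>\<close> and \<open>K' = K sin \<phi> \<plusminus> i Q cos \<phi>\<close>. The block \<open>X\<^sub>1\<^sub>1\<close> is normal
  with defect operator \<open>sin \<phi> D\<close>, \<open>D = D\<^bsub>T11\<^esub>\<close>, so that \<open>X\<close> has the form of a contractive block
  operator with parameter \<open>K'\<close>, and
  \<open>\<parallel>(f, h)\<parallel>\<^sup>2 - \<parallel>X (f, h)\<parallel>\<^sup>2 = \<parallel>D\<^sub>U h\<parallel>\<^sup>2 - \<parallel>K' D\<^sub>U h\<parallel>\<^sup>2 + gap\<close>,
  where the gap is nonnegative because the row \<open>(V, D\<^bsub>V*\<^esub>)\<close> is a coisometry, and for given \<open>h\<close> it can be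
  made arbitrarily small by the choice of \<open>f\<close>, because the kernel conditions on \<open>V\<close> and \<open>U*\<close> put the
  relevant vectors into the closure of the range of \<open>D\<close>. Hence the two forms have the same number of
  negative squares. To identify this number with \<open>\<kappa>\<^sub>-\<close>, the spectral measure is built from the projections
  onto \<open>ker (A - \<lambda>)\<^sup>+\<close>.\<close>

section \<open>Bounded symmetric operators on real Hilbert spaces\<close>

text \<open>The obstacle is that in general no \<open>f\<close> closes the gap exactly: it would
  have to solve \<open>s D f = y\<close> with \<open>y\<close> merely in the closure of the range of
  \<open>D\<close>. Likewise a vector of \<open>defect_space U\<close> need not be a value of
  \<open>defect U\<close>. So a negative subspace of the small form cannot simply be mapped into the
  large space; dimensions are compared through approximating families and a limit. The role of
  \<open>Q\<close> is to absorb the scalar term: \<open>I = V U + Dv Q Du\<close>, with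
  \<open>Dv\<close> and \<open>Du\<close> the defect operators of the adjoint of \<open>V\<close>
  and of \<open>U\<close>, splits a multiple of the identity into a part joining
  \<open>V T11 U\<close> and a part joining \<open>K\<close>. The angle \<open>phi1 V U\<close>
  enters twice: \<open>sin \<phi> > 0\<close> allows division by the factor in front of
  \<open>D\<close>, and \<open>cos \<phi> \<noteq> 0\<close> forces \<open>Q0\<close> to be bounded.
  Since \<open>kappa_minus\<close> refers to a spectral measure picked by \<open>SOME\<close>,
  existence has to be proved, and the count is derived from a property shared by all spectral
  measures (\<open>negative_splitting\<close>). The spectral theory is done over the reals; complex
  linearity comes back because multiplication by \<open>\<i>\<close> commutes with the
  operator.\<close>

definition sym_op :: "('a::real_inner \<Rightarrow> 'a) \<Rightarrow> bool" where
  "sym_op S \<longleftrightarrow> bounded_linear S \<and> (\<forall>x y. inner (S x) y = inner x (S y))"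

definition pos_op :: "('a::real_inner \<Rightarrow> 'a) \<Rightarrow> bool" where
  "pos_op S \<longleftrightarrow> sym_op S \<and> (\<forall>x. 0 \<le> inner (S x) x)"

definition commutes :: "('a \<Rightarrow> 'a) \<Rightarrow> ('a \<Rightarrow> 'a) \<Rightarrow> bool" where
  "commutes T A \<longleftrightarrow> (\<forall>x. T (A x) = A (T x))"

text \<open>The discriminant bound, degenerate case \<open>d = 0\<close> included. It is the common
  source of the Cauchy-Schwarz inequality for semidefinite forms and of the orthogonality at a
  nearest point.\<close>

lemma linear_quadratic_nonneg:
  fixes a b d :: real
  assumes "\<And>t. 0 \<le> a + 2 * t * b + t\<^sup>2 * d"
  shows "b\<^sup>2 \<le> a * d"
proof -
  have a: "0 \<le> a" using assms[of 0] by simp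
  have d: "0 \<le> d"
  proof (rule ccontr)
    assume "\<not> 0 \<le> d"
    then have d: "d < 0" by simp
    \<comment> \<open>Chosen so that \<open>t * (-d)\<close> is at least
      \<open>2 * \<bar>b\<bar> + a + 1\<close>; one more factor \<open>t \<ge> 1\<close> pushes the
      quadratic down to \<open>-1\<close> or less.\<close>
    define t where "t = (2 * \<bar>b\<bar> + a + 1) / (-d) + 1"
    have t1: "t \<ge> 1" using a d by (simp add: t_def divide_nonneg_neg divide_nonpos_neg field_simps)
    have td: "t * (-d) \<ge> 2 * \<bar>b\<bar> + a + 1" using d by (simp add: t_def field_simps)
    have "t\<^sup>2 * (-d) = t * (t * (-d))" by (simp add: power2_eq_square)
    also have "\<dots> \<ge> t * (2 * \<bar>b\<bar> + a + 1)" using td t1 by (intro mult_left_mono) auto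
    finally have "t\<^sup>2 * (-d) \<ge> 2 * (t * \<bar>b\<bar>) + t * (a + 1)" by (simp add: algebra_simps)
    moreover have "t * b \<le> t * \<bar>b\<bar>" using t1 by (intro mult_left_mono) auto
    moreover have "t * (a+1) \<ge> 1 * (a+1)" using t1 a by (intro mult_right_mono) auto
    ultimately show False using assms[of t] by (simp add: algebra_simps)
  qed
  show ?thesis
  proof (cases "d = 0")
    case True
    have "b = 0"
    proof (rule ccontr)
      assume "b \<noteq> 0"
      then have "a + 2 * (-(a+1)/(2*b)) * b = -1" by (simp add: field_simps)
      then show False using assms[of "-(a+1)/(2*b)"] True by simp
    qed
    then show ?thesis using True by simp
  next
    case False
    with d have d: "d > 0" by simp
    have "0 \<le> (a + 2 * (-b/d) * b + (-b/d)\<^sup>2 * d) * d"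
      using assms[of "-b/d"] d by (simp add: zero_le_mult_iff)
    also have "\<dots> = a * d - b\<^sup>2" using d by (simp add: field_simps power2_eq_square)
    finally show ?thesis by simp
  qed
qed

lemma sym_opI: "bounded_linear S \<Longrightarrow> (\<And>x y. inner (S x) y = inner x (S y)) \<Longrightarrow> sym_op S"
  by (simp add: sym_op_def)

lemma sym_op_bl: "sym_op S \<Longrightarrow> bounded_linear S"
  by (simp add: sym_op_def)

lemma sym_op_inner: "sym_op S \<Longrightarrow> inner (S x) y = inner x (S y)"
  by (simp add: sym_op_def)

lemma pos_op_sym: "pos_op S \<Longrightarrow> sym_op S"
  by (simp add: pos_op_def)

lemma pos_op_nonneg: "pos_op S \<Longrightarrow> 0 \<le> inner (S x) x"
  by (simp add: pos_op_def)

lemma pos_op_cauchy_schwarz: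
  assumes "pos_op S"
  shows "(inner (S x) y)\<^sup>2 \<le> inner (S x) x * inner (S y) y"
proof (rule linear_quadratic_nonneg)
  fix t :: real
  interpret S: bounded_linear S using assms by (simp add: pos_op_sym sym_op_bl)
  have "inner (S y) x = inner (S x) y"
    using sym_op_inner[OF pos_op_sym[OF assms], of y x] by (simp add: inner_commute)
  then have "inner (S (x + t *\<^sub>R y)) (x + t *\<^sub>R y)
      = inner (S x) x + 2 * t * inner (S x) y + t\<^sup>2 * inner (S y) y"
    by (simp add: S.add S.scaleR inner_add_left inner_add_right power2_eq_square algebra_simps)
  then show "0 \<le> inner (S x) x + 2 * t * inner (S x) y + t\<^sup>2 * inner (S y) y"
    using pos_op_nonneg[OF assms, of "x + t *\<^sub>R y"] by simp
qed

text \<open>Cauchy-Schwarz for the form of \<open>S\<close>, taken at \<open>x\<close> and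
  \<open>S x\<close>, bounds the fourth power of the norm of \<open>S x\<close> by zero.\<close>

lemma pos_op_kernel:
  assumes "pos_op S" "inner (S x) x \<le> 0" shows "S x = 0"
proof -
  have "inner (S x) x = 0" using assms pos_op_nonneg[of S x] by simp
  then have "(inner (S x) (S x))\<^sup>2 \<le> 0" using pos_op_cauchy_schwarz[OF assms(1), of x "S x"] by simp
  then show ?thesis by simp
qed

lemma sym_op_add: "sym_op S \<Longrightarrow> sym_op T \<Longrightarrow> sym_op (\<lambda>x. S x + T x)"
  by (auto simp: sym_op_def bounded_linear_add inner_add_left inner_add_right)

lemma sym_op_diff: "sym_op S \<Longrightarrow> sym_op T \<Longrightarrow> sym_op (\<lambda>x. S x - T x)"
  by (auto simp: sym_op_def bounded_linear_sub inner_diff_left inner_diff_right)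

lemma sym_op_scaleR: "sym_op S \<Longrightarrow> sym_op (\<lambda>x. r *\<^sub>R S x)"
  by (auto simp: sym_op_def bounded_linear_const_scaleR)

lemma sym_op_id: "sym_op (\<lambda>x. x)"
  by (simp add: sym_op_def)

lemma sym_op_square: "sym_op S \<Longrightarrow> sym_op (\<lambda>x. S (S x))"
  by (auto simp: sym_op_def intro: bounded_linear_compose)

lemma pos_op_square: "sym_op S \<Longrightarrow> pos_op (\<lambda>x. S (S x))"
  by (simp add: pos_op_def sym_op_square sym_op_inner[of S "S x" for x])

text \<open>Cauchy-Schwarz for the form of \<open>A\<close> with \<open>y = A x\<close>, after which
  the square of \<open>norm (A x)\<close> cancels.\<close>

lemma pos_op_norm_le:
  assumes "pos_op A" "\<And>x. inner (A x) x \<le> (norm x)\<^sup>2"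
  shows "norm (A x) \<le> norm x"
proof -
  have "(inner (A x) (A x))\<^sup>2 \<le> inner (A x) x * inner (A (A x)) (A x)"
    by (rule pos_op_cauchy_schwarz[OF assms(1)])
  also have "\<dots> \<le> (norm x)\<^sup>2 * (norm (A x))\<^sup>2"
    using assms by (intro mult_mono) (auto simp: pos_op_nonneg)
  finally have "(norm (A x))\<^sup>2 * (norm (A x))\<^sup>2 \<le> (norm x)\<^sup>2 * (norm (A x))\<^sup>2"
    by (simp only: power2_norm_eq_inner) (simp add: power2_eq_square)
  then have "A x = 0 \<or> (norm (A x))\<^sup>2 \<le> (norm x)\<^sup>2"
    using mult_right_le_imp_le[of "(norm (A x))^2" "(norm (A x))^2" "(norm x)^2"] by (cases "A x = 0") simp_all
  then show ?thesis by (auto simp: power2_le_iff_abs_le)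
qed

subsection \<open>Orthogonal projections, Riesz representation and adjoints\<close>

lemma norm_add_scaleR_square:
  "(norm (u + t *\<^sub>R v))\<^sup>2 = (norm u)\<^sup>2 + 2 * t * inner u v + t\<^sup>2 * inner v v"
  unfolding power2_norm_eq_inner inner_add_left inner_add_right inner_scaleR_left inner_scaleR_right
  by (simp add: inner_commute[of v u] power2_eq_square distrib_left)

text \<open>A minimizing sequence is Cauchy by the parallelogram law, and the first variation at its
  limit vanishes.\<close>

lemma closed_subspace_nearest:
  fixes M :: "'a::{real_inner,complete_space} set"
  assumes M: "closed M" "subspace M"
  shows "\<exists>y\<in>M. \<forall>z\<in>M. inner (x - y) z = 0"
proof -
  define d where "d = infdist x M"
  have ne: "M \<noteq> {}" using subspace_0[OF M(2)] by auto
  have d: "d \<le> norm (x - y)" if "y \<in> M" for y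
    using infdist_le[OF that, of x] by (simp add: d_def dist_norm)
  have d0: "0 \<le> d" by (simp add: d_def infdist_nonneg)
  have "\<exists>y\<in>M. norm (x - y) < d + e" if "e > 0" for e
    using ne that cInf_lessD[of "dist x ` M" "d + e"] by (auto simp: d_def infdist_def dist_norm)
  then have "\<exists>y. y \<in> M \<and> norm (x - y) < d + inverse (Suc n)" for n
    by (metis inverse_positive_iff_positive of_nat_0_less_iff zero_less_Suc)
  then obtain y where y: "\<And>n. y n \<in> M" "\<And>n. norm (x - y n) < d + inverse (Suc n)" by metis
  have lim: "(\<lambda>n. norm (x - y n)) \<longlonglongrightarrow> d"
  proof (rule tendsto_sandwich[OF _ _ tendsto_const])
    show "(\<lambda>n. d + inverse (Suc n)) \<longlonglongrightarrow> d"
      using tendsto_add[OF tendsto_const LIMSEQ_inverse_real_of_nat, of d] by simp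
    show "\<forall>\<^sub>F n in sequentially. d \<le> norm (x - y n)" using d[OF y(1)] by (intro always_eventually allI)
    show "\<forall>\<^sub>F n in sequentially. norm (x - y n) \<le> d + inverse (Suc n)"
      by (intro always_eventually allI less_imp_le y(2))
  qed
  \<comment> \<open>The midpoint of \<open>u\<close> and \<open>v\<close> lies in \<open>M\<close>,
    so its distance to \<open>x\<close> is at least \<open>d\<close>; this is the term
    \<open>4 * d\<^sup>2\<close> in the parallelogram law.\<close>
  have par: "(norm (u - v))\<^sup>2 \<le> 2 * (norm (x - u))\<^sup>2 + 2 * (norm (x - v))\<^sup>2 - 4 * d\<^sup>2"
    if "u \<in> M" "v \<in> M" for u v
  proof -
    have "(1/2) *\<^sub>R (u + v) \<in> M" using that M by (simp add: subspace_add subspace_scale)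
    then have "d\<^sup>2 \<le> (norm (x - (1/2) *\<^sub>R (u + v)))\<^sup>2" using d d0 by (intro power_mono) auto
    moreover have "x - (1/2) *\<^sub>R (u + v) = (1/2) *\<^sub>R ((x - u) + (x - v))"
      by (simp add: algebra_simps scaleR_2[symmetric])
    moreover have "u - v = (x - v) - (x - u)" by simp
    ultimately show ?thesis
      by (simp only: power2_norm_eq_inner inner_add_left inner_add_right inner_diff_left inner_diff_right
          inner_scaleR_left inner_scaleR_right) (simp add: inner_commute algebra_simps)
  qed
  have "Cauchy y"
  proof (rule CauchyI)
    fix e :: real assume e: "0 < e"
    have "(\<lambda>n. (norm (x - y n))\<^sup>2) \<longlonglongrightarrow> d\<^sup>2" by (intro tendsto_intros lim)
    then have "\<forall>\<^sub>F n in sequentially. (norm (x - y n))\<^sup>2 < d\<^sup>2 + e\<^sup>2 / 4"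
      using e by (intro order_tendstoD) auto
    then obtain N where N: "\<And>n. n \<ge> N \<Longrightarrow> (norm (x - y n))\<^sup>2 < d\<^sup>2 + e\<^sup>2 / 4"
      by (auto simp: eventually_sequentially)
    have "norm (y m - y n) < e" if "m \<ge> N" "n \<ge> N" for m n
    proof -
      have "(norm (y m - y n))\<^sup>2 < e\<^sup>2" using par[OF y(1)[of m] y(1)[of n]] N[OF that(1)] N[OF that(2)] by simp
      then show ?thesis using e by (simp add: power2_less_imp_less)
    qed
    then show "\<exists>N. \<forall>m\<ge>N. \<forall>n\<ge>N. norm (y m - y n) < e" by blast
  qed
  then obtain p where p: "y \<longlonglongrightarrow> p" using Cauchy_convergent convergent_def by blast
  have pM: "p \<in> M" using closed_sequentially[OF M(1)] y p by blast
  have "(\<lambda>n. norm (x - y n)) \<longlonglongrightarrow> norm (x - p)" by (intro tendsto_intros p)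
  then have np: "norm (x - p) = d" using lim LIMSEQ_unique by blast
  show ?thesis
  proof (intro bexI[OF _ pM] ballI)
    fix z assume z: "z \<in> M"
    \<comment> \<open>The quadratic in \<open>t\<close> has constant term zero because
      \<open>p\<close> attains the distance, so the discriminant bound is zero.\<close>
    have "(inner (x - p) z)\<^sup>2 \<le> 0 * inner z z"
    proof (rule linear_quadratic_nonneg)
      fix t :: real
      have "p - t *\<^sub>R z \<in> M" using z pM M by (simp add: subspace_diff subspace_scale)
      then have "d\<^sup>2 \<le> (norm (x - p + t *\<^sub>R z))\<^sup>2" using d[of "p - t *\<^sub>R z"] d0
        by (intro power_mono) (auto simp: algebra_simps)
      then show "0 \<le> 0 + 2 * t * inner (x - p) z + t\<^sup>2 * inner z z"
        unfolding np[symmetric] by (simp add: norm_add_scaleR_square)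
    qed
    then show "inner (x - p) z = 0" by simp
  qed
qed

definition proj :: "'a::real_inner set \<Rightarrow> 'a \<Rightarrow> 'a" where
  "proj M x = (SOME y. y \<in> M \<and> (\<forall>z\<in>M. inner (x - y) z = 0))"

context
  fixes M :: "'a::{real_inner,complete_space} set"
  assumes M: "closed M" "subspace M"
begin

lemma proj_in: "proj M x \<in> M" and proj_orth: "z \<in> M \<Longrightarrow> inner (x - proj M x) z = 0"
  using someI_ex[of "\<lambda>y. y \<in> M \<and> (\<forall>z\<in>M. inner (x - y) z = 0)"] closed_subspace_nearest[OF M, of x]
  unfolding proj_def by blast+

lemma proj_unique:
  assumes "y \<in> M" "\<And>z. z \<in> M \<Longrightarrow> inner (x - y) z = 0"
  shows "proj M x = y"
proof -
  have m: "proj M x - y \<in> M" using proj_in assms M by (simp add: subspace_diff)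
  have "inner (proj M x - y) (proj M x - y) = inner (x - y) (proj M x - y) - inner (x - proj M x) (proj M x - y)"
    by (simp add: inner_diff_left)
  then show ?thesis using assms(2)[OF m] proj_orth[OF m] by simp
qed

lemma proj_id: "x \<in> M \<Longrightarrow> proj M x = x"
  by (rule proj_unique) auto

lemma proj_zero: "(\<And>z. z \<in> M \<Longrightarrow> inner x z = 0) \<Longrightarrow> proj M x = 0"
  by (rule proj_unique) (use M in \<open>auto simp: subspace_0\<close>)

lemma proj_inner: "inner (proj M x) y = inner (proj M x) (proj M y)"
  using proj_orth[OF proj_in, of y x] by (metis inner_commute inner_diff_left right_minus_eq)

lemma proj_norm_le: "norm (proj M x) \<le> norm x"
proof -
  have "(norm (proj M x))\<^sup>2 = inner (proj M x) x"
    using proj_inner[of x x] by (simp add: power2_norm_eq_inner)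
  also have "\<dots> \<le> norm (proj M x) * norm x" by (rule norm_cauchy_schwarz)
  finally show ?thesis by (cases "proj M x = 0") (auto simp: power2_eq_square mult_le_cancel_left_pos)
qed

lemma proj_sym: "sym_op (proj M)"
proof (rule sym_opI)
  show "bounded_linear (proj M)"
  proof (rule bounded_linear_intro[where K=1])
    show "proj M (x + y) = proj M x + proj M y" for x y
    proof (rule proj_unique)
      show "inner (x + y - (proj M x + proj M y)) z = 0" if "z \<in> M" for z
        using proj_orth[OF that, of x] proj_orth[OF that, of y] by (simp add: inner_diff_left inner_add_left)
    qed (use M proj_in in \<open>simp add: subspace_add\<close>)
    show "proj M (r *\<^sub>R x) = r *\<^sub>R proj M x" for x r
    proof (rule proj_unique)
      show "inner (r *\<^sub>R x - r *\<^sub>R proj M x) z = 0" if "z \<in> M" for z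
        using proj_orth[OF that, of x] by (simp add: inner_diff_left)
    qed (use M proj_in in \<open>simp add: subspace_scale\<close>)
    show "norm (proj M x) \<le> norm x * 1" for x using proj_norm_le[of x] by simp
  qed
  show "inner (proj M x) y = inner x (proj M y)" for x y
    using proj_inner[of x y] proj_inner[of y x] by (simp add: inner_commute)
qed

text \<open>Invariance of \<open>M\<close> under \<open>T\<close> places \<open>T (proj M x)\<close>
  in \<open>M\<close>; invariance under the adjoint makes \<open>T\<close> send the residual to a
  vector orthogonal to \<open>M\<close>.\<close>

lemma proj_commutes:
  assumes T: "bounded_linear T" "\<And>x. x \<in> M \<Longrightarrow> T x \<in> M"
    and adj: "\<And>x y. inner (T x) y = inner x (T' y)" "\<And>x. x \<in> M \<Longrightarrow> T' x \<in> M"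
  shows "T (proj M x) = proj M (T x)"
proof (rule proj_unique[symmetric])
  interpret T: bounded_linear T by fact
  show "inner (T x - T (proj M x)) z = 0" if "z \<in> M" for z
    using proj_orth[OF adj(2)[OF that], of x] by (simp add: T.diff[symmetric] adj)
qed (use T proj_in in auto)

end

lemma riesz_representation:
  fixes f :: "'a::{real_inner,complete_space} \<Rightarrow> real"
  assumes "bounded_linear f"
  obtains h where "\<And>x. f x = inner x h"
proof -
  interpret f: bounded_linear f by fact
  define M where "M = {x. f x = 0}"
  have M: "closed M" "subspace M"
    by (auto simp: M_def subspace_def f.add f.scaleR f.zero
        intro!: closed_Collect_eq linear_continuous_on assms continuous_on_const)
  show thesis
  proof (cases "M = UNIV")
    case True
    then show thesis using that[of 0] by (auto simp: M_def)
  next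
    case False
    then obtain a where a: "f a \<noteq> 0" by (auto simp: M_def)
    \<comment> \<open>A nonzero vector orthogonal to the kernel; subtracting a multiple of it moves
      any \<open>x\<close> into the kernel.\<close>
    define u where "u = a - proj M a"
    have fu: "f u \<noteq> 0" using a proj_in[OF M, of a] by (simp add: u_def f.diff M_def)
    then have u0: "u \<noteq> 0" using f.zero by auto
    have "f x = inner x ((f u / inner u u) *\<^sub>R u)" for x
    proof -
      have "x - (f x / f u) *\<^sub>R u \<in> M" using fu by (simp add: M_def f.diff f.scaleR)
      then have "inner u (x - (f x / f u) *\<^sub>R u) = 0" unfolding u_def by (rule proj_orth[OF M])
      then have "inner x u = f x / f u * inner u u" by (simp add: inner_diff_right inner_commute)
      then show ?thesis using fu u0 by simp
    qed
    then show thesis by (rule that)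
  qed
qed

lemma adjoint_exists:
  fixes T :: "'a::{real_inner,complete_space} \<Rightarrow> 'b::real_inner"
  assumes "bounded_linear T"
  obtains T' where "\<And>x y. inner (T x) y = inner x (T' y)"
proof -
  have "\<exists>h. \<forall>x. inner (T x) y = inner x h" for y
    using riesz_representation[OF bounded_linear_inner_left_comp[OF assms, of y]] by metis
  then show thesis using that by metis
qed

lemma adjoint_bounded_linear:
  assumes T: "bounded_linear T" and adj: "\<And>x y. inner (T x) y = inner x (T' y)"
  shows "bounded_linear T'"
proof -
  obtain K where K: "K > 0" "\<And>x. norm (T x) \<le> norm x * K"
    using bounded_linear.pos_bounded[OF T] by blast
  show ?thesis
  proof (rule bounded_linear_intro[where K=K])
    show "T' (x + y) = T' x + T' y" for x y
      by (rule vector_eq_ldot[THEN iffD1]) (simp add: inner_add_right flip: adj)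
    show "T' (r *\<^sub>R x) = r *\<^sub>R T' x" for x r
      by (rule vector_eq_ldot[THEN iffD1]) (simp flip: adj)
    show "norm (T' y) \<le> norm y * K" for y
    proof -
      have "norm (T' y) * norm (T' y) = inner (T (T' y)) y" by (simp add: adj dot_square_norm power2_eq_square)
      also have "\<dots> \<le> norm (T (T' y)) * norm y" by (rule norm_cauchy_schwarz)
      also have "\<dots> \<le> norm (T' y) * K * norm y" using K by (intro mult_right_mono) auto
      finally have "norm (T' y) * norm (T' y) \<le> norm (T' y) * (norm y * K)" by (simp add: mult_ac)
      then show ?thesis using K by (cases "T' y = 0") (auto simp: mult_le_cancel_left_pos)
    qed
  qed
qed

lemma adjoint_commutes:
  assumes A: "sym_op A" and T: "commutes T A" and adj: "\<And>x y. inner (T x) y = inner x (T' y)"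
  shows "commutes T' A"
  unfolding commutes_def
proof
  fix x
  show "T' (A x) = A (T' x)"
    by (rule vector_eq_ldot[THEN iffD1])
      (use T in \<open>simp add: commutes_def sym_op_inner[OF A, symmetric] flip: adj\<close>)
qed

subsection \<open>Square roots\<close>

text \<open>With \<open>A = I - R\<close>, a fixed point \<open>Y = (R + Y\<^sup>2)/2\<close> satisfies \<open>(I - Y)\<^sup>2 = A\<close>. The iteration
  is dominated in norm by the same scalar iteration with \<open>R = 1\<close>.\<close>

primrec sqrt_iter :: "('a::real_vector \<Rightarrow> 'a) \<Rightarrow> nat \<Rightarrow> 'a \<Rightarrow> 'a" where
  "sqrt_iter R 0 x = 0"
| "sqrt_iter R (Suc n) x = (1/2) *\<^sub>R (R x + sqrt_iter R n (sqrt_iter R n x))"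

primrec sqrt_iter_bound :: "nat \<Rightarrow> real" where
  "sqrt_iter_bound 0 = 0"
| "sqrt_iter_bound (Suc n) = (1 + (sqrt_iter_bound n)\<^sup>2) / 2"

lemma sqrt_iter_bound_range: "0 \<le> sqrt_iter_bound n \<and> sqrt_iter_bound n \<le> 1"
proof (induction n)
  case (Suc n)
  then have "(sqrt_iter_bound n)\<^sup>2 \<le> 1" by (simp add: power_le_one)
  then show ?case by simp
qed simp

lemma sqrt_iter_bound_mono: "sqrt_iter_bound n \<le> sqrt_iter_bound (Suc n)"
proof -
  have "0 \<le> (1 - sqrt_iter_bound n)\<^sup>2" by simp
  then show ?thesis by (simp add: power2_diff)
qed

context
  fixes R :: "'a::{real_inner,complete_space} \<Rightarrow> 'a"
  assumes R: "sym_op R" and R1: "\<And>x. norm (R x) \<le> norm x"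
begin

lemma sqrt_iter_sym: "sym_op (sqrt_iter R n)"
proof (induction n)
  case 0
  have "sqrt_iter R 0 = (\<lambda>x. 0)" by auto
  then show ?case by (simp add: sym_op_def)
next
  case (Suc n)
  have "sqrt_iter R (Suc n) = (\<lambda>x. (1/2) *\<^sub>R (R x + sqrt_iter R n (sqrt_iter R n x)))" by auto
  then show ?case using sym_op_scaleR[OF sym_op_add[OF R sym_op_square[OF Suc]], of "1/2"] by simp
qed

lemma sqrt_iter_commute:
  assumes "bounded_linear T" "commutes T R"
  shows "T (sqrt_iter R n x) = sqrt_iter R n (T x)"
proof (induction n arbitrary: x)
  case 0
  then show ?case using assms by (simp add: linear_0 bounded_linear.linear)
next
  case (Suc n)
  interpret T: bounded_linear T by fact
  show ?case using assms Suc by (simp add: T.scaleR T.add commutes_def)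
qed

lemma sqrt_iter_norm: "norm (sqrt_iter R n x) \<le> sqrt_iter_bound n * norm x"
proof (induction n arbitrary: x)
  case (Suc n)
  have "norm (sqrt_iter R n (sqrt_iter R n x)) \<le> sqrt_iter_bound n * norm (sqrt_iter R n x)"
    by (rule Suc)
  also have "\<dots> \<le> sqrt_iter_bound n * (sqrt_iter_bound n * norm x)"
    using Suc sqrt_iter_bound_range by (intro mult_left_mono) auto
  finally have "norm (R x + sqrt_iter R n (sqrt_iter R n x)) \<le> norm x + (sqrt_iter_bound n)\<^sup>2 * norm x"
    using R1[of x] norm_triangle_ineq[of "R x" "sqrt_iter R n (sqrt_iter R n x)"]
    by (simp add: power2_eq_square)
  then show ?case by (simp add: algebra_simps del: scaleR_add_right)
qed simp

lemma sqrt_iter_self_commute: "sqrt_iter R m (sqrt_iter R n x) = sqrt_iter R n (sqrt_iter R m x)"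
  by (rule sqrt_iter_commute)
    (simp_all add: sqrt_iter_sym sym_op_bl commutes_def sqrt_iter_commute[OF sym_op_bl[OF R]])

text \<open>The iterates commute, so the difference of two squares factors. The scalar iteration
  satisfies the same identity, and the induction compares the two factor by factor.\<close>

lemma sqrt_iter_step:
  "norm (sqrt_iter R (Suc n) x - sqrt_iter R n x) \<le> (sqrt_iter_bound (Suc n) - sqrt_iter_bound n) * norm x"
proof (induction n arbitrary: x)
  case 0
  then show ?case using R1[of x] by simp
next
  case (Suc n)
  let ?Y = "sqrt_iter R" and ?y = sqrt_iter_bound
  interpret Y: bounded_linear "?Y k" for k by (simp add: sqrt_iter_sym sym_op_bl)
  let ?z = "?Y (Suc n) x + ?Y n x"
  have "?Y (Suc (Suc n)) x - ?Y (Suc n) x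
      = (1/2) *\<^sub>R (?Y (Suc n) (?Y (Suc n) x) - ?Y n (?Y n x))"
    unfolding sqrt_iter.simps(2)[of R "Suc n" x] 
    by (subst (3) sqrt_iter.simps(2)) (simp only: scaleR_right_diff_distrib[symmetric] add_diff_cancel_left)
  also have "\<dots> = (1/2) *\<^sub>R (?Y (Suc n) ?z - ?Y n ?z)"
    using sqrt_iter_self_commute[of "Suc n" n x] by (simp add: Y.add del: sqrt_iter.simps)
  finally have "norm (?Y (Suc (Suc n)) x - ?Y (Suc n) x) = norm (?Y (Suc n) ?z - ?Y n ?z) / 2"
    by (simp del: sqrt_iter.simps)
  also have "\<dots> \<le> (?y (Suc n) - ?y n) * norm ?z / 2"
    using Suc[of ?z] by (simp del: sqrt_iter.simps sqrt_iter_bound.simps)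
  also have "\<dots> \<le> (?y (Suc n) - ?y n) * ((?y (Suc n) + ?y n) * norm x) / 2"
  proof -
    have "norm ?z \<le> (?y (Suc n) + ?y n) * norm x"
      using norm_triangle_ineq[of "?Y (Suc n) x" "?Y n x"] sqrt_iter_norm[of "Suc n" x] sqrt_iter_norm[of n x]
      by (simp add: distrib_right del: sqrt_iter.simps sqrt_iter_bound.simps)
    then show ?thesis using sqrt_iter_bound_mono[of n] by (intro divide_right_mono mult_left_mono) auto
  qed
  also have "\<dots> = (?y (Suc (Suc n)) - ?y (Suc n)) * norm x"
  proof -
    have eq: "?y (Suc (Suc n)) - ?y (Suc n) = ((?y (Suc n))\<^sup>2 - (?y n)\<^sup>2) / 2"
      by (simp add: diff_divide_distrib add_divide_distrib)
    show ?thesis unfolding eq by (simp add: power2_eq_square algebra_simps del: sqrt_iter_bound.simps)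
  qed
  finally show ?case .
qed

lemma sqrt_iter_convergent: "convergent (\<lambda>n. sqrt_iter R n x)"
proof -
  let ?Y = "\<lambda>n. sqrt_iter R n x" and ?y = "\<lambda>n. sqrt_iter_bound n * norm x"
  have *: "norm (?Y (n + k) - ?Y n) \<le> ?y (n + k) - ?y n" for n k
  proof (induction k)
    case (Suc k)
    have "norm (?Y (n + Suc k) - ?Y n) \<le> norm (?Y (Suc (n + k)) - ?Y (n+k)) + norm (?Y (n + k) - ?Y n)"
      using norm_triangle_ineq[of "?Y (Suc (n + k)) - ?Y (n+k)" "?Y (n + k) - ?Y n"]
      by (simp del: sqrt_iter.simps)
    then show ?case using Suc sqrt_iter_step[of "n+k" x]
      by (simp add: left_diff_distrib del: sqrt_iter.simps sqrt_iter_bound.simps)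
  qed simp
  have "incseq ?y" using sqrt_iter_bound_mono
    by (intro incseq_SucI mult_right_mono) (auto simp del: sqrt_iter_bound.simps)
  moreover have "?y n \<le> norm x" for n using sqrt_iter_bound_range[of n]
    by (simp add: mult_left_le_one_le)
  ultimately have "convergent ?y"
    by (metis incseq_convergent convergentI)
  then have "Cauchy ?y" by (rule convergent_Cauchy)
  then have "Cauchy ?Y"
  proof (rule_tac CauchyI)
    fix e :: real assume "Cauchy ?y" "0 < e"
    then obtain N where N: "\<And>m n. m \<ge> N \<Longrightarrow> n \<ge> N \<Longrightarrow> norm (?y m - ?y n) < e"
      by (metis Cauchy_iff)
    have "norm (?Y m - ?Y n) < e" if "m \<ge> N" "n \<ge> N" "n \<le> m" for m n
      using *[of n "m - n"] N[of m n] that by simp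
    then show "\<exists>M. \<forall>m\<ge>M. \<forall>n\<ge>M. norm (?Y m - ?Y n) < e"
      by (metis linorder_linear norm_minus_commute)
  qed
  then show ?thesis by (rule Cauchy_convergent)
qed

lemma sqrt_fixed_point:
  "\<exists>Y. sym_op Y \<and> (\<forall>x. norm (Y x) \<le> norm x) \<and> (\<forall>x. 2 *\<^sub>R Y x = R x + Y (Y x))
     \<and> (\<forall>T. bounded_linear T \<longrightarrow> commutes T R \<longrightarrow> commutes T Y)"
proof -
  define Y where "Y x = lim (\<lambda>n. sqrt_iter R n x)" for x
  have lim: "(\<lambda>n. sqrt_iter R n x) \<longlonglongrightarrow> Y x" for x
    unfolding Y_def using sqrt_iter_convergent by (simp add: convergent_LIMSEQ_iff)
  interpret Yn: bounded_linear "sqrt_iter R n" for n by (simp add: sqrt_iter_sym sym_op_bl)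
  have b1: "norm (sqrt_iter R n x) \<le> norm x" for n x
    using sqrt_iter_norm[of n x] sqrt_iter_bound_range[of n]
    by (meson mult_left_le_one_le norm_ge_zero order_trans)
  have bd: "norm (Y x) \<le> norm x" for x
    by (rule Lim_norm_ubound[OF _ lim]) (auto simp: b1)
  have bl: "bounded_linear Y"
  proof (rule bounded_linear_intro[where K=1])
    show "Y (x + y) = Y x + Y y" for x y
      using LIMSEQ_unique[OF lim[of "x+y"]] tendsto_add[OF lim[of x] lim[of y]] by (simp add: Yn.add)
    show "Y (r *\<^sub>R x) = r *\<^sub>R Y x" for x r
      using LIMSEQ_unique[OF lim[of "r *\<^sub>R x"]] tendsto_scaleR[OF tendsto_const lim[of x], of r]
      by (simp add: Yn.scaleR)
  qed (use bd in simp)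
  interpret Y: bounded_linear Y by fact
  have sym: "inner (Y x) y = inner x (Y y)" for x y
  proof (rule LIMSEQ_unique)
    show "(\<lambda>n. inner (sqrt_iter R n x) y) \<longlonglongrightarrow> inner (Y x) y" by (intro tendsto_intros lim)
    have "inner (sqrt_iter R n x) y = inner x (sqrt_iter R n y)" for n
      by (simp add: sqrt_iter_sym sym_op_inner)
    then show "(\<lambda>n. inner (sqrt_iter R n x) y) \<longlonglongrightarrow> inner x (Y y)"
      by (simp, intro tendsto_intros lim)
  qed
  have fp: "2 *\<^sub>R Y x = R x + Y (Y x)" for x
  proof (rule LIMSEQ_unique)
    \<comment> \<open>The outer iterate also varies with \<open>n\<close>; the uniform bound
      \<open>b1\<close> makes this harmless.\<close>
    have "(\<lambda>n. sqrt_iter R n (sqrt_iter R n x) - sqrt_iter R n (Y x)) \<longlonglongrightarrow> 0"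
    proof (rule tendsto_norm_zero_cancel, rule tendsto_sandwich[OF _ _ tendsto_const])
      have "(\<lambda>n. sqrt_iter R n x - Y x) \<longlonglongrightarrow> 0" using lim[of x] by (simp add: LIM_zero)
      then show "(\<lambda>n. norm (sqrt_iter R n x - Y x)) \<longlonglongrightarrow> 0" by (rule tendsto_norm_zero)
      show "\<forall>\<^sub>F n in sequentially. norm (sqrt_iter R n (sqrt_iter R n x) - sqrt_iter R n (Y x))
          \<le> norm (sqrt_iter R n x - Y x)"
        by (auto intro!: always_eventually simp: Yn.diff[symmetric] b1)
    qed auto
    from tendsto_add[OF this lim[of "Y x"]]
    have "(\<lambda>n. sqrt_iter R n (sqrt_iter R n x)) \<longlonglongrightarrow> Y (Y x)" by simp
    from tendsto_add[OF tendsto_const this, of "R x"]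
    show "(\<lambda>n. 2 *\<^sub>R sqrt_iter R (Suc n) x) \<longlonglongrightarrow> R x + Y (Y x)" by simp
    show "(\<lambda>n. 2 *\<^sub>R sqrt_iter R (Suc n) x) \<longlonglongrightarrow> 2 *\<^sub>R Y x"
      by (intro tendsto_intros LIMSEQ_Suc[OF lim])
  qed
  have "commutes T Y" if T: "bounded_linear T" "commutes T R" for T
    unfolding commutes_def
  proof (intro allI LIMSEQ_unique)
    fix x
    show "(\<lambda>n. T (sqrt_iter R n x)) \<longlonglongrightarrow> T (Y x)"
      by (rule bounded_linear.tendsto[OF T(1) lim])
    show "(\<lambda>n. T (sqrt_iter R n x)) \<longlonglongrightarrow> Y (T x)"
      using lim[of "T x"] sqrt_iter_commute[OF T] by simp
  qed
  then show ?thesis using bl sym bd fp by (intro exI[of _ Y]) (auto intro: sym_opI)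
qed

end

lemma pos_op_sqrt_exists:
  fixes A :: "'a::{real_inner,complete_space} \<Rightarrow> 'a"
  assumes A: "pos_op A"
  obtains S where "pos_op S" "\<And>x. S (S x) = A x"
    "\<And>T. bounded_linear T \<Longrightarrow> commutes T A \<Longrightarrow> commutes T S"
proof -
  interpret A: bounded_linear A using A by (simp add: pos_op_sym sym_op_bl)
  obtain K where K: "K > 0" "\<And>x. norm (A x) \<le> norm x * K" using A.pos_bounded by blast
  \<comment> \<open>Division by a norm bound brings \<open>A\<close> between \<open>0\<close> and
    \<open>I\<close>, so that \<open>R = I - A1\<close> is a contraction; the factor
    \<open>sqrt K\<close> in \<open>S\<close> undoes the scaling.\<close>
  define A1 where "A1 x = (1/K) *\<^sub>R A x" for x
  define R where "R x = x - A1 x" for x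
  have A1sym: "sym_op A1" unfolding A1_def using sym_op_scaleR[OF pos_op_sym[OF A], of "1/K"] by simp
  have A1: "0 \<le> inner (A1 x) x" "inner (A1 x) x \<le> (norm x)\<^sup>2" for x
  proof -
    show "0 \<le> inner (A1 x) x" using K pos_op_nonneg[OF A, of x] by (simp add: A1_def)
    have "inner (A x) x \<le> norm (A x) * norm x" by (rule norm_cauchy_schwarz)
    also have "\<dots> \<le> norm x * K * norm x" using K by (intro mult_right_mono) auto
    finally show "inner (A1 x) x \<le> (norm x)\<^sup>2" using K by (simp add: A1_def field_simps power2_eq_square)
  qed
  have Rsym: "sym_op R" unfolding R_def by (intro sym_op_diff sym_op_id A1sym)
  have "pos_op R" using Rsym A1 by (simp add: pos_op_def R_def inner_diff_left power2_norm_eq_inner)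
  then have R1: "norm (R x) \<le> norm x" for x
    by (rule pos_op_norm_le)
      (use A1 in \<open>simp add: R_def inner_diff_left power2_norm_eq_inner\<close>)
  obtain Y where Y: "sym_op Y" "\<And>x. norm (Y x) \<le> norm x" "\<And>x. 2 *\<^sub>R Y x = R x + Y (Y x)"
    "\<And>T. bounded_linear T \<Longrightarrow> commutes T R \<Longrightarrow> commutes T Y"
    using sqrt_fixed_point[OF Rsym R1] by blast
  interpret Y: bounded_linear Y using Y by (simp add: sym_op_bl)
  define S where "S x = sqrt K *\<^sub>R (x - Y x)" for x
  show thesis
  proof
    have "sym_op S" unfolding S_def by (intro sym_op_scaleR sym_op_diff sym_op_id Y)
    moreover have "0 \<le> inner (S x) x" for x
    proof -
      have "inner (Y x) x \<le> norm (Y x) * norm x" by (rule norm_cauchy_schwarz)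
      also have "\<dots> \<le> norm x * norm x" using Y by (intro mult_right_mono) auto
      finally show ?thesis using K
        by (simp add: S_def inner_diff_left dot_square_norm power2_eq_square)
    qed
    ultimately show "pos_op S" by (simp add: pos_op_def)
    show "S (S x) = A x" for x
    proof -
      have "S (S x) = K *\<^sub>R (x - 2 *\<^sub>R Y x + Y (Y x))" using K
        by (simp add: S_def Y.scaleR Y.diff algebra_simps scaleR_2)
      also have "\<dots> = K *\<^sub>R A1 x" by (simp add: Y R_def)
      finally show ?thesis using K by (simp add: A1_def)
    qed
    fix T :: "'a \<Rightarrow> 'a" assume T: "bounded_linear T" "commutes T A"
    interpret T: bounded_linear T by fact
    have "commutes T R" using T by (simp add: commutes_def R_def A1_def T.diff T.scaleR)
    then have "commutes T Y" using Y T by blast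
    then show "commutes T S" by (simp add: commutes_def S_def T.diff T.scaleR)
  qed
qed

text \<open>A positive root \<open>Z\<close> commutes with its own square, hence with the
  constructed root \<open>W\<close> of that square. Then \<open>(Z + W) (Z - W) = 0\<close>, and
  positivity makes both summands vanish separately on the range of \<open>Z - W\<close>.\<close>

lemma pos_op_sqrt_unique:
  fixes S T :: "'a::{real_inner,complete_space} \<Rightarrow> 'a"
  assumes S: "pos_op S" and T: "pos_op T" and eq: "\<And>x. S (S x) = T (T x)"
  shows "S = T"
proof -
  obtain W where W: "pos_op W" "\<And>x. W (W x) = T (T x)"
    "\<And>Z. bounded_linear Z \<Longrightarrow> commutes Z (\<lambda>x. T (T x)) \<Longrightarrow> commutes Z W"
    using pos_op_sqrt_exists[OF pos_op_square[OF pos_op_sym[OF T]]] by blast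
  have *: "Z = W" if Z: "pos_op Z" "\<And>x. Z (Z x) = T (T x)" for Z
  proof
    fix x
    interpret Z: bounded_linear Z using Z by (simp add: pos_op_sym sym_op_bl)
    interpret W: bounded_linear W using W by (simp add: pos_op_sym sym_op_bl)
    have "commutes Z W" using Z by (intro W Z.bounded_linear_axioms) (simp add: commutes_def flip: Z(2))
    define y where "y = Z x - W x"
    have "Z y + W y = 0" using \<open>commutes Z W\<close> Z(2)[of x] W(2)[of x]
      by (simp add: y_def Z.diff W.diff commutes_def)
    then have "inner (Z y) y + inner (W y) y = 0" by (metis inner_add_left inner_zero_left)
    then have "Z y = 0" "W y = 0"
      using pos_op_nonneg[OF Z(1), of y] pos_op_nonneg[OF W(1), of y]
      \<open>Z y \<bullet> y + W y \<bullet> y = 0\<close>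
      by (auto intro: pos_op_kernel[OF Z(1)] pos_op_kernel[OF W(1)])
    have "inner y y = inner x (Z y - W y)"
      using sym_op_inner[OF pos_op_sym[OF Z(1)], of x y] sym_op_inner[OF pos_op_sym[OF W(1)], of x y]
      unfolding y_def by (metis inner_diff_left inner_diff_right)
    then show "Z x = W x" using \<open>Z y = 0\<close> \<open>W y = 0\<close> by (simp add: y_def)
  qed
  show ?thesis using *[OF S] *[OF T] eq by simp
qed

text \<open>The positive part is \<open>(\<bar>B\<bar> + B)/2\<close> with \<open>\<bar>B\<bar> = (B\<^sup>2)\<^sup>1\<^sup>/\<^sup>2\<close>.\<close>

lemma sym_op_parts:
  fixes B :: "'a::{real_inner,complete_space} \<Rightarrow> 'a"
  assumes B: "sym_op B"
  obtains P N where "pos_op P" "pos_op N" "\<And>x. B x = P x - N x" "\<And>x. P (N x) = 0" "\<And>x. N (P x) = 0"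
    "\<And>T. bounded_linear T \<Longrightarrow> commutes T B \<Longrightarrow> commutes T P"
proof -
  interpret B: bounded_linear B using B by (simp add: sym_op_bl)
  obtain S where S: "pos_op S" "\<And>x. S (S x) = B (B x)"
    "\<And>T. bounded_linear T \<Longrightarrow> commutes T (\<lambda>x. B (B x)) \<Longrightarrow> commutes T S"
    using pos_op_sqrt_exists[OF pos_op_square[OF B]] by blast
  interpret S: bounded_linear S using S by (simp add: pos_op_sym sym_op_bl)
  have comm: "commutes T S" if "bounded_linear T" "commutes T B" for T
    using that by (intro S) (auto simp: commutes_def)
  have BS: "B (S x) = S (B x)" for x
    using comm[OF B.bounded_linear_axioms] by (simp add: commutes_def)
  define P where "P x = (1/2) *\<^sub>R (S x + B x)" for x
  define N where "N x = (1/2) *\<^sub>R (S x - B x)" for x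
  have symP: "sym_op P" unfolding P_def by (intro sym_op_scaleR sym_op_add pos_op_sym S B)
  have symN: "sym_op N" unfolding N_def by (intro sym_op_scaleR sym_op_diff pos_op_sym S B)
  have PN: "P (N x) = 0" and NP: "N (P x) = 0" for x
    using S(2)[of x] BS
    by (simp_all add: P_def N_def S.scaleR S.diff S.add B.scaleR B.diff B.add algebra_simps)
  show thesis
  proof
    have decomp: "S x = P x + N x" for x by (simp add: P_def N_def scaleR_add_right[symmetric] scaleR_2[symmetric])
    interpret P: bounded_linear P using symP by (simp add: sym_op_bl)
    interpret N: bounded_linear N using symN by (simp add: sym_op_bl)
    \<comment> \<open>\<open>P\<close> and \<open>N\<close> are the compressions of \<open>S = \<bar>B\<bar>\<close> to \<open>ker N\<close> and its orthogonal complement.\<close>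
    define K where "K = {x. N x = 0}"
    have K: "closed K" "subspace K"
      by (auto simp: K_def subspace_def N.add N.scaleR N.zero
        intro!: closed_Collect_eq linear_continuous_on N.bounded_linear_axioms continuous_on_const)
    have KP: "proj K (P x) = P x" for x by (rule proj_id[OF K]) (simp add: K_def NP)
    have KN: "proj K (N x) = 0" for x
      by (rule proj_zero[OF K]) (simp add: K_def sym_op_inner[OF symN])
    interpret K: bounded_linear "proj K" by (intro sym_op_bl proj_sym K)
    have KS: "P x = proj K (S x)" for x by (simp add: decomp K.add KP KN)
    have Kself: "inner (proj K x) y = inner x (proj K y)" for x y by (rule sym_op_inner[OF proj_sym[OF K]])
    \<comment> \<open>Adjoints are taken in \<open>KS\<close>: all three operators are symmetric, so
      \<open>S\<close> commutes with the projection.\<close>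
    have SK: "P x = S (proj K x)" for x
    proof (rule vector_eq_rdot[THEN iffD1, rule_format])
      fix z
      show "inner (P x) z = inner (S (proj K x)) z"
        using sym_op_inner[OF symP, of x z] by (simp add: KS Kself sym_op_inner[OF pos_op_sym[OF S(1)]])
    qed
    have "inner (P x) x = inner (S (proj K x)) (proj K x)" for x
      using KP[of x] SK[of x] Kself[of "P x" x] by simp
    then show "pos_op P" using symP S(1) by (simp add: pos_op_def)
    have "inner (N x) x = inner (S (x - proj K x)) (x - proj K x)" for x
    proof -
      have "N x = S (x - proj K x)" using decomp[of x] SK[of x] by (simp add: S.diff)
      moreover have "inner (N x) (proj K x) = 0" using KN[of x] Kself[of "N x" x] by simp
      ultimately show ?thesis by (simp add: inner_diff_right)
    qed
    then show "pos_op N" using symN S(1) by (simp add: pos_op_def)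
    show "B x = P x - N x" for x
      by (simp add: P_def N_def scaleR_diff_right[symmetric] scaleR_2[symmetric])
    show "commutes T P" if T: "bounded_linear T" "commutes T B" for T
    proof -
      interpret T: bounded_linear T by fact
      show ?thesis using comm[OF T] T by (simp add: commutes_def P_def T.scaleR T.add)
    qed
  qed (fact PN NP)+
qed

subsection \<open>The spectral family\<close>

text \<open>The commutant description of \<open>ker (A - \<lambda>)\<^sup>+\<close> makes monotonicity, right continuity and
  invariance immediate.\<close>

definition spectral_space :: "('a::real_inner \<Rightarrow> 'a) \<Rightarrow> real \<Rightarrow> 'a set" where
  "spectral_space A l = {x. \<forall>T. bounded_linear T \<longrightarrow> commutes T A \<longrightarrow> inner (A (T x)) (T x) \<le> l * (norm (T x))\<^sup>2}"

lemma spectral_space_mono: "l \<le> m \<Longrightarrow> spectral_space A l \<subseteq> spectral_space A m"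
  unfolding spectral_space_def by (blast intro: order_trans mult_right_mono[OF _ zero_le_power2])

lemma spectral_space_right_continuous: "(\<And>m. m > l \<Longrightarrow> x \<in> spectral_space A m) \<Longrightarrow> x \<in> spectral_space A l"
  unfolding spectral_space_def
proof (intro CollectI allI impI)
  fix T assume *: "\<And>m. m > l \<Longrightarrow> x \<in> {x. \<forall>T. bounded_linear T \<longrightarrow> commutes T A \<longrightarrow> inner (A (T x)) (T x) \<le> m * (norm (T x))\<^sup>2}"
    "bounded_linear T" "commutes T A"
  have lim: "((\<lambda>m. m * (norm (T x))\<^sup>2) \<longlongrightarrow> l * (norm (T x))\<^sup>2) (at_right l)" by (intro tendsto_intros)
  show "inner (A (T x)) (T x) \<le> l * (norm (T x))\<^sup>2"
    by (rule tendsto_lowerbound[OF lim]) (use * in \<open>auto simp: eventually_at_filter\<close>)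
qed

lemma spectral_space_invariant:
  assumes "x \<in> spectral_space A l" "bounded_linear T" "commutes T A"
  shows "T x \<in> spectral_space A l"
  unfolding spectral_space_def
proof (intro CollectI allI impI)
  fix R assume R: "bounded_linear R" "commutes R A"
  have "bounded_linear (\<lambda>x. R (T x))" "commutes (\<lambda>x. R (T x)) A"
    using assms R by (auto simp: commutes_def intro: bounded_linear_compose)
  then show "inner (A (R (T x))) (R (T x)) \<le> l * (norm (R (T x)))\<^sup>2"
    using assms(1) by (auto simp: spectral_space_def)
qed

lemma spectral_space_le: "x \<in> spectral_space A l \<Longrightarrow> inner (A x) x \<le> l * (norm x)\<^sup>2"
  using bounded_linear_ident[where 'a='a] by (auto simp: spectral_space_def commutes_def dest: spec[of _ "\<lambda>x. x"])

context
  fixes A :: "'a::{real_inner,complete_space} \<Rightarrow> 'a"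
  assumes A: "sym_op A"
begin

text \<open>One inclusion tests the commutant condition with \<open>T = P\<close> itself, which
  gives \<open>inner (P (P x)) (P x) \<le> 0\<close>. The other uses that every admissible
  \<open>T\<close> preserves the kernel of \<open>P\<close>, where \<open>A - l\<close> acts as
  \<open>- N\<close>.\<close>

lemma spectral_space_positive_part:
  obtains P N where "pos_op P" "pos_op N" "\<And>x. A x - l *\<^sub>R x = P x - N x" "\<And>x. P (N x) = 0"
    "spectral_space A l = {x. P x = 0}"
proof -
  interpret A: bounded_linear A using A by (simp add: sym_op_bl)
  define B where "B x = A x - l *\<^sub>R x" for x
  have "sym_op B" unfolding B_def by (intro sym_op_diff A sym_op_scaleR sym_op_id)
  then obtain P N where P: "pos_op P" and N: "pos_op N" and B: "\<And>x. B x = P x - N x"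
    and PN: "\<And>x. P (N x) = 0" and NP: "\<And>x. N (P x) = 0"
    and comm: "\<And>T. bounded_linear T \<Longrightarrow> commutes T B \<Longrightarrow> commutes T P"
    using sym_op_parts by blast
  interpret P: bounded_linear P using P by (simp add: pos_op_sym sym_op_bl)
  have commB: "commutes T A \<longleftrightarrow> commutes T B" if "bounded_linear T" for T
    using that by (simp add: commutes_def B_def bounded_linear.linear linear_diff linear_scale)
  have Bform: "inner (A x) x \<le> l * (norm x)\<^sup>2 \<longleftrightarrow> inner (B x) x \<le> 0" for x
    by (simp add: B_def inner_diff_left power2_norm_eq_inner)
  have "x \<in> spectral_space A l \<longleftrightarrow> P x = 0" for x
  proof
    assume x: "x \<in> spectral_space A l"
    have "commutes P B" using NP PN by (simp add: commutes_def B P.diff)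
    then have "inner (B (P x)) (P x) \<le> 0"
      using x P.bounded_linear_axioms by (auto simp: spectral_space_def commB Bform)
    then have "inner (P (P x)) (P x) \<le> 0" by (simp add: B NP)
    then have "P (P x) = 0" by (rule pos_op_kernel[OF P])
    then have "inner (P x) (P x) = 0" by (simp add: sym_op_inner[OF pos_op_sym[OF P]])
    then show "P x = 0" by simp
  next
    assume x: "P x = 0"
    show "x \<in> spectral_space A l" unfolding spectral_space_def
    proof (intro CollectI allI impI)
      fix T assume T: "bounded_linear T" "commutes T A"
      then have "commutes T P" by (simp add: comm commB)
      then have "P (T x) = 0" using x T by (metis commutes_def bounded_linear.linear linear_0)
      then show "inner (A (T x)) (T x) \<le> l * (norm (T x))\<^sup>2"
        using pos_op_nonneg[OF N, of "T x"] by (simp add: Bform B)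
    qed
  qed
  then show thesis using that[OF P N _ PN] B by (auto simp: B_def)
qed

lemma spectral_space_closed_subspace: "closed (spectral_space A l)" "subspace (spectral_space A l)"
proof -
  obtain P where P: "pos_op P" "spectral_space A l = {x. P x = 0}"
    using spectral_space_positive_part[of l] by metis
  interpret P: bounded_linear P using P by (simp add: pos_op_sym sym_op_bl)
  show "closed (spectral_space A l)" "subspace (spectral_space A l)" unfolding P
    by (auto simp: subspace_def P.add P.scaleR P.zero
        intro!: closed_Collect_eq linear_continuous_on P.bounded_linear_axioms continuous_on_const)
qed

text \<open>The vector \<open>N (N x)\<close> lies in the kernel of \<open>P\<close>, which is the
  spectral space. Orthogonality therefore forces \<open>N x = 0\<close>, and only the positive part
  of \<open>A - l\<close> contributes to the form at \<open>x\<close>.\<close>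

lemma spectral_space_ge:
  assumes "\<And>y. y \<in> spectral_space A l \<Longrightarrow> inner x y = 0"
  shows "l * (norm x)\<^sup>2 \<le> inner (A x) x"
proof -
  obtain P N where P: "pos_op P" and N: "pos_op N" and AB: "\<And>x. A x - l *\<^sub>R x = P x - N x"
    and PN: "\<And>x. P (N x) = 0" and S: "spectral_space A l = {x. P x = 0}"
    using spectral_space_positive_part[of l] by metis
  have "inner x (N (N x)) = 0" by (rule assms) (simp add: S PN)
  then have "inner (N x) (N x) = 0" by (simp add: sym_op_inner[OF pos_op_sym[OF N]])
  then have "inner (A x - l *\<^sub>R x) x = inner (P x) x" by (simp add: AB)
  then show ?thesis using pos_op_nonneg[OF P, of x] by (simp add: inner_diff_left power2_norm_eq_inner)
qed

lemma spectral_space_bounds: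
  obtains r where "r > 0" "\<And>l. l \<ge> r \<Longrightarrow> spectral_space A l = UNIV" "\<And>l. l < -r \<Longrightarrow> spectral_space A l = {0}"
proof -
  obtain K where K: "K > 0" "\<And>x. norm (A x) \<le> norm x * K"
    using bounded_linear.pos_bounded[OF sym_op_bl[OF A]] by blast
  have *: "\<bar>inner (A x) x\<bar> \<le> K * (norm x)\<^sup>2" for x
  proof -
    have "\<bar>inner (A x) x\<bar> \<le> norm (A x) * norm x" by (rule Cauchy_Schwarz_ineq2)
    also have "\<dots> \<le> norm x * K * norm x" using K by (intro mult_right_mono) auto
    finally show ?thesis by (simp add: power2_eq_square mult_ac)
  qed
  have "spectral_space A l = UNIV" if "l \<ge> K" for l
  proof -
    have "inner (A x) x \<le> l * (norm x)\<^sup>2" for x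
      using *[of x] mult_right_mono[OF that, of "(norm x)\<^sup>2"] by simp
    then show ?thesis by (auto simp: spectral_space_def)
  qed
  \<comment> \<open>The inequality is strict because \<open>-K\<close> itself may be an
    eigenvalue.\<close>
  moreover have "spectral_space A l = {0}" if "l < -K" for l
  proof -
    have "x = 0" if "x \<in> spectral_space A l" for x
    proof (rule ccontr)
      assume "x \<noteq> 0"
      then have "l * (norm x)\<^sup>2 < -K * (norm x)\<^sup>2" using \<open>l < -K\<close> by (intro mult_strict_right_mono) auto
      then show False using spectral_space_le[OF that] *[of x] by simp
    qed
    then show ?thesis using subspace_0[OF spectral_space_closed_subspace(2)] by blast
  qed
  ultimately show thesis using that[of K] K by blast
qed

end

section \<open>The spectral theorem\<close>

subsection \<open>The scalar spectral measures\<close>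

text \<open>Serves strong limits of monotone families of projections, where the squared distance of
  two members is the increment of a bounded monotone function.\<close>

lemma convergent_of_orthogonal_increments:
  fixes p :: "nat \<Rightarrow> 'a::{real_inner,complete_space}"
  assumes "convergent f" and eq: "\<And>m n. (norm (p m - p n))\<^sup>2 = \<bar>f m - f n :: real\<bar>"
  shows "convergent p"
proof -
  have "Cauchy f" using assms(1) by (rule convergent_Cauchy)
  have "Cauchy p"
  proof (rule CauchyI)
    fix e :: real assume e: "0 < e"
    then obtain N where N: "\<And>m n. m \<ge> N \<Longrightarrow> n \<ge> N \<Longrightarrow> norm (f m - f n) < e\<^sup>2"
      using \<open>Cauchy f\<close> by (metis Cauchy_iff zero_less_power)
    have "norm (p m - p n) < e" if "m \<ge> N" "n \<ge> N" for m n
      using N[OF that] e by (intro power2_less_imp_less[of _ e]) (simp_all add: eq)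
    then show "\<exists>N. \<forall>m\<ge>N. \<forall>n\<ge>N. norm (p m - p n) < e" by blast
  qed
  then show ?thesis by (rule Cauchy_convergent)
qed

text \<open>The difference is a positive operator with vanishing form, so every vector lies in its
  kernel.\<close>

lemma sym_op_form_unique:
  assumes P: "sym_op P" and Q: "sym_op Q" and eq: "\<And>x. inner (P x) x = inner (Q x) x"
  shows "P = Q"
proof
  fix x
  have "pos_op (\<lambda>x. P x - Q x)"
    unfolding pos_op_def using sym_op_diff[OF P Q] by (simp add: inner_diff_left eq)
  from pos_op_kernel[OF this, of x] show "P x = Q x" by (simp add: inner_diff_left eq)
qed

text \<open>Cutting the interval into \<open>n\<close> equal pieces and telescoping bounds the total
  change by \<open>(d - c) * (F d - F c) / n\<close>. This takes the place of convergence of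
  Riemann-Stieltjes sums in \<open>smeasure_integral\<close>.\<close>

lemma eq_of_small_increments:
  fixes g F :: "real \<Rightarrow> real"
  assumes "c \<le> d" and step: "\<And>a b. c \<le> a \<Longrightarrow> a \<le> b \<Longrightarrow> b \<le> d \<Longrightarrow> \<bar>g b - g a\<bar> \<le> (b - a) * (F b - F a)"
  shows "g d = g c"
proof -
  define C where "C = (d - c) * (F d - F c)"
  have *: "real n * \<bar>g d - g c\<bar> \<le> C" if n: "n > 0" for n :: nat
  proof -
    define h where "h = (d - c) / n"
    define p where "p k = c + real k * h" for k
    have h: "h \<ge> 0" using assms(1) by (simp add: h_def)
    have "\<bar>g (p k) - g c\<bar> \<le> h * (F (p k) - F c)" if "k \<le> n" for k
      using that
    proof (induction k)
      case (Suc k)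
      have "real (Suc k) * h \<le> real n * h" using Suc.prems h by (intro mult_right_mono) auto
      then have pd: "p (Suc k) \<le> d" using n by (simp add: p_def h_def)
      have ps: "p (Suc k) = p k + h" by (simp add: p_def algebra_simps)
      have "\<bar>g (p (Suc k)) - g (p k)\<bar> \<le> h * (F (p (Suc k)) - F (p k))"
        using step[of "p k" "p (Suc k)"] pd ps h by (simp add: p_def)
      then show ?case using Suc by (simp add: right_diff_distrib)
    qed (simp add: p_def)
    from this[of n] have "\<bar>g d - g c\<bar> \<le> h * (F d - F c)" using n by (simp add: p_def h_def)
    then have "real n * \<bar>g d - g c\<bar> \<le> real n * (h * (F d - F c))" by (intro mult_left_mono) auto
    also have "\<dots> = C" using n by (simp add: h_def C_def)
    finally show ?thesis .
  qed
  show ?thesis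
  proof (rule ccontr)
    assume "g d \<noteq> g c"
    then have pos: "\<bar>g d - g c\<bar> > 0" by simp
    obtain n where "C / \<bar>g d - g c\<bar> < real n" using reals_Archimedean2 by blast
    then have "C < real (Suc n) * \<bar>g d - g c\<bar>" using pos by (simp add: field_simps)
    then show False using *[of "Suc n"] by simp
  qed
qed

text \<open>The last clause says that \<open>P\<close> belongs to the bicommutant of
  \<open>A\<close>. Applied to multiplication by \<open>\<i>\<close> and to the projection onto a
  closed subspace, it later yields complex linearity and invariance of the subspace.\<close>

definition is_proj :: "('a::real_inner \<Rightarrow> 'a) \<Rightarrow> ('a \<Rightarrow> 'a) \<Rightarrow> bool" where
  "is_proj A P \<longleftrightarrow> sym_op P \<and> (\<forall>x. P (P x) = P x) \<and> (\<forall>T. bounded_linear T \<longrightarrow> commutes T A \<longrightarrow> commutes T P)"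

lemma is_proj_sym: "is_proj A P \<Longrightarrow> sym_op P"
  and is_proj_idem: "is_proj A P \<Longrightarrow> P (P x) = P x"
  and is_proj_commutes: "is_proj A P \<Longrightarrow> bounded_linear T \<Longrightarrow> commutes T A \<Longrightarrow> T (P x) = P (T x)"
  by (auto simp: is_proj_def commutes_def)

lemma is_proj_bl: "is_proj A P \<Longrightarrow> bounded_linear P"
  by (simp add: is_proj_sym sym_op_bl)

lemma is_proj_form: "is_proj A P \<Longrightarrow> inner (P x) x = (norm (P x))\<^sup>2"
  by (metis is_proj_idem is_proj_sym power2_norm_eq_inner sym_op_inner)

lemma is_proj_norm: "is_proj A P \<Longrightarrow> norm (P x) \<le> norm x"
proof -
  assume P: "is_proj A P"
  have "norm (P x) * norm (P x) \<le> norm (P x) * norm x"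
    using norm_cauchy_schwarz[of "P x" x] by (simp add: is_proj_form[OF P] power2_eq_square)
  then show ?thesis by (cases "P x = 0") (auto simp: mult_le_cancel_left_pos)
qed

lemma is_proj_id: "is_proj A (\<lambda>x. x)"
  by (simp add: is_proj_def commutes_def sym_op_id)

lemma is_proj_diff:
  assumes P: "is_proj A P" and Q: "is_proj A Q" and le: "\<And>x. P (Q x) = P x" "\<And>x. Q (P x) = P x"
  shows "is_proj A (\<lambda>x. Q x - P x)"
proof -
  interpret P: bounded_linear P using P by (simp add: is_proj_sym sym_op_bl)
  interpret Q: bounded_linear Q using Q by (simp add: is_proj_sym sym_op_bl)
  show ?thesis unfolding is_proj_def
    by (auto simp: sym_op_diff is_proj_sym[OF P] is_proj_sym[OF Q] P.diff Q.diff is_proj_idem[OF P] is_proj_idem[OF Q] le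
        commutes_def is_proj_commutes[OF P] is_proj_commutes[OF Q] linear_diff bounded_linear.linear)
qed

section \<open>Spectral projections and the projection-valued measure\<close>

context
  fixes A :: "'a::{real_inner,complete_space} \<Rightarrow> 'a"
  assumes A: "sym_op A"
begin

definition sproj :: "real \<Rightarrow> 'a \<Rightarrow> 'a" where "sproj l = proj (spectral_space A l)"

lemma sproj_in: "sproj l x \<in> spectral_space A l"
  unfolding sproj_def by (intro proj_in spectral_space_closed_subspace A)

lemma sproj_id: "x \<in> spectral_space A l \<Longrightarrow> sproj l x = x"
  unfolding sproj_def by (intro proj_id spectral_space_closed_subspace A)

text \<open>The commutant of the symmetric \<open>A\<close> contains with \<open>T\<close> also its
  adjoint, so both leave the spectral space invariant.\<close>

lemma sproj_is_proj: "is_proj A (sproj l)"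
  unfolding is_proj_def
proof (intro conjI allI impI)
  show "sym_op (sproj l)" unfolding sproj_def by (intro proj_sym spectral_space_closed_subspace A)
  show "sproj l (sproj l x) = sproj l x" for x by (intro sproj_id sproj_in)
  fix T :: "'a \<Rightarrow> 'a" assume T: "bounded_linear T" "commutes T A"
  obtain T' where T': "\<And>x y. inner (T x) y = inner x (T' y)" using adjoint_exists[OF T(1)] by blast
  have "bounded_linear T'" "commutes T' A"
    using adjoint_bounded_linear[OF T(1) T'] adjoint_commutes[OF A T(2) T'] by blast+
  then show "commutes T (sproj l)"
    unfolding commutes_def sproj_def using T
    by (intro allI proj_commutes[where T'=T'] spectral_space_closed_subspace A)
      (simp_all add: T' spectral_space_invariant commutes_def)
qed

lemma sproj_linear: "bounded_linear (sproj l)"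
  using sproj_is_proj by (rule is_proj_bl)

lemma sproj_nested: "l \<le> m \<Longrightarrow> sproj m (sproj l x) = sproj l x"
  using spectral_space_mono[of l m A] by (intro sproj_id) (use sproj_in in blast)

lemma sproj_nested': "l \<le> m \<Longrightarrow> sproj l (sproj m x) = sproj l x"
  by (rule vector_eq_rdot[THEN iffD1, rule_format])
    (metis is_proj_sym sproj_is_proj sproj_nested sym_op_inner)

lemma sproj_diff_is_proj: "l \<le> m \<Longrightarrow> is_proj A (\<lambda>x. sproj m x - sproj l x)"
  by (intro is_proj_diff sproj_is_proj sproj_nested sproj_nested')

text \<open>The distribution function of the scalar spectral measure of \<open>A\<close> at
  \<open>x\<close>.\<close>

definition sdist :: "'a \<Rightarrow> real \<Rightarrow> real" where "sdist x l = inner (sproj l x) x"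

lemma sdist_diff: "l \<le> m \<Longrightarrow> (norm (sproj m x - sproj l x))\<^sup>2 = sdist x m - sdist x l"
  using is_proj_form[OF sproj_diff_is_proj, of l m x] by (simp add: sdist_def inner_diff_left)

lemma sdist_mono: "l \<le> m \<Longrightarrow> sdist x l \<le> sdist x m"
  using sdist_diff[of l m x] by (metis diff_ge_0_iff_ge zero_le_power2)

lemma sdist_nonneg: "0 \<le> sdist x l"
  using is_proj_form[OF sproj_is_proj, of l x] by (simp add: sdist_def)

text \<open>Along \<open>a + 1/(n+1)\<close> the projections of \<open>x\<close> converge. The limit
  lies in all spectral spaces above \<open>a\<close>, hence in the one at \<open>a\<close>, and
  applying \<open>sproj a\<close> identifies it. Monotonicity passes from the sequence to the
  one-sided limit.\<close>

lemma sdist_right_continuous: "continuous (at_right a) (sdist x)"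
proof -
  let ?l = "\<lambda>n. a + inverse (Suc n)"
  have "decseq (\<lambda>n. sdist x (?l n))"
    by (auto simp: decseq_def intro!: sdist_mono le_imp_inverse_le)
  moreover have "0 \<le> sdist x (?l n)" for n by (rule sdist_nonneg)
  ultimately have "convergent (\<lambda>n. sdist x (?l n))"
    using decseq_convergent[of "\<lambda>n. sdist x (?l n)" 0] by (meson convergentI)
  moreover have "(norm (sproj (?l m) x - sproj (?l n) x))\<^sup>2 = \<bar>sdist x (?l m) - sdist x (?l n)\<bar>" for m n
  proof (cases "?l m \<le> ?l n")
    case True
    then show ?thesis using sdist_diff[OF True, of x] sdist_mono[OF True, of x] by (simp add: norm_minus_commute)
  next
    case False
    then have *: "?l n \<le> ?l m" by simp
    show ?thesis using sdist_diff[OF *, of x] sdist_mono[OF *, of x] by simp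
  qed
  ultimately have "convergent (\<lambda>n. sproj (?l n) x)" by (rule convergent_of_orthogonal_increments)
  then obtain y where y: "(\<lambda>n. sproj (?l n) x) \<longlonglongrightarrow> y" by (auto simp: convergent_def)
  have "y \<in> spectral_space A a"
  proof (rule spectral_space_right_continuous)
    fix m assume "m > a"
    have "?l \<longlonglongrightarrow> a"
      using tendsto_add[OF tendsto_const LIMSEQ_inverse_real_of_nat, of a] by simp
    then have ev: "\<forall>\<^sub>F n in sequentially. ?l n < m" using \<open>m > a\<close> by (rule order_tendstoD)
    show "y \<in> spectral_space A m"
    proof (rule Lim_in_closed_set[OF spectral_space_closed_subspace(1)[OF A] _ _ y])
      show "\<forall>\<^sub>F n in sequentially. sproj (?l n) x \<in> spectral_space A m"
        using ev by eventually_elim (meson less_imp_le sproj_in spectral_space_mono subsetD)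
    qed simp
  qed
  then have "sproj a y = y" by (rule sproj_id)
  moreover have "(\<lambda>n. sproj a (sproj (?l n) x)) \<longlonglongrightarrow> sproj a y"
    by (rule bounded_linear.tendsto[OF sproj_linear y])
  then have "sproj a y = sproj a x" by (simp add: sproj_nested' LIMSEQ_const_iff)
  ultimately have "y = sproj a x" by simp
  then have lim: "(\<lambda>n. sdist x (?l n)) \<longlonglongrightarrow> sdist x a"
    unfolding sdist_def by (intro tendsto_intros) (use y in simp)
  have "(sdist x \<longlongrightarrow> sdist x a) (at_right a)"
  proof (rule order_tendstoI)
    fix u assume "u < sdist x a"
    then show "\<forall>\<^sub>F b in at_right a. u < sdist x b"
      by (auto simp: eventually_at_filter intro!: always_eventually elim!: less_le_trans intro: sdist_mono)
  next
    fix u assume "sdist x a < u"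
    then obtain n where n: "sdist x (?l n) < u"
      using order_tendstoD(2)[OF lim] by (auto simp: eventually_sequentially)
    have "\<forall>\<^sub>F b in at_right a. b < ?l n" by (rule eventually_at_right_real[THEN eventually_mono]) auto
    then show "\<forall>\<^sub>F b in at_right a. sdist x b < u"
      by (rule eventually_mono) (rule le_less_trans[OF sdist_mono[OF less_imp_le] n])
  qed
  then show ?thesis by (simp add: continuous_within)
qed

definition smeasure :: "'a \<Rightarrow> real measure" where "smeasure x = interval_measure (sdist x)"

lemma sets_smeasure [simp, measurable_cong]: "sets (smeasure x) = sets borel"
  and space_smeasure [simp]: "space (smeasure x) = UNIV"
  by (simp_all add: smeasure_def)

lemma smeasure_Ioc: "a \<le> b \<Longrightarrow> emeasure (smeasure x) {a<..b} = ennreal (sdist x b - sdist x a)"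
  unfolding smeasure_def using sdist_right_continuous sdist_mono by (intro emeasure_interval_measure_Ioc) auto

lemma smeasure_UNIV:
  obtains r where "r > 0" "sproj r = (\<lambda>x. x)" "sproj (-r) = (\<lambda>x. 0)"
    "\<And>x. emeasure (smeasure x) (- {-r<..r}) = 0"
    "\<And>x. emeasure (smeasure x) UNIV = ennreal ((norm x)\<^sup>2)"
proof -
  obtain r0 where r0: "r0 > 0" "\<And>l. l \<ge> r0 \<Longrightarrow> spectral_space A l = UNIV" "\<And>l. l < -r0 \<Longrightarrow> spectral_space A l = {0}"
    using spectral_space_bounds[OF A] by blast
  \<comment> \<open>The shift by one puts \<open>-r\<close> strictly below \<open>-r0\<close>, where
    the spectral space is trivial.\<close>
  define r where "r = r0 + 1"
  have hi: "sproj l x = x" if "l \<ge> r" for l x using r0(2)[of l] that by (intro sproj_id) (simp add: r_def)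
  have lo: "sproj l x = 0" if "l \<le> -r" for l x using r0(3)[of l] that sproj_in[of l x] by (simp add: r_def)
  have Fhi: "sdist x l = (norm x)\<^sup>2" if "l \<ge> r" for l x using hi[OF that] by (simp add: sdist_def power2_norm_eq_inner)
  have Flo: "sdist x l = 0" if "l \<le> -r" for l x using lo[OF that] by (simp add: sdist_def)
  have rpos: "r > 0" using r0 by (simp add: r_def)
  have null: "emeasure (smeasure x) (- {-r<..r}) = 0" for x
  proof -
    have "{r<..r + real n} \<in> null_sets (smeasure x)" for n
      by (intro null_setsI) (simp_all add: smeasure_Ioc Fhi)
    moreover have "{-r - real n<..-r} \<in> null_sets (smeasure x)" for n
      by (intro null_setsI) (simp_all add: smeasure_Ioc Flo)
    ultimately have "(\<Union>n. {r<..r + real n} \<union> {-r - real n<..-r}) \<in> null_sets (smeasure x)"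
      by (intro null_sets_UN null_sets.Un)
    moreover have "(\<Union>n. {r<..r + real n} \<union> {-r - real n<..-r}) = - {-r<..r}"
    proof -
      have "\<exists>n. t \<in> {r<..r + real n} \<union> {-r - real n<..-r}" if "t \<notin> {-r<..r}" for t
      proof -
        obtain n where "\<bar>t\<bar> < real n" using reals_Archimedean2 by blast
        then show ?thesis using that rpos by (intro exI[of _ n]) auto
      qed
      then show ?thesis using rpos by auto
    qed
    ultimately show ?thesis by auto
  qed
  moreover have "emeasure (smeasure x) UNIV = ennreal ((norm x)\<^sup>2)" for x
  proof -
    have "emeasure (smeasure x) UNIV = emeasure (smeasure x) {-r<..r} + emeasure (smeasure x) (- {-r<..r})"
      by (subst plus_emeasure) auto
    then show ?thesis using rpos by (simp add: null smeasure_Ioc Fhi Flo)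
  qed
  moreover have "sproj r = (\<lambda>x. x)" "sproj (-r) = (\<lambda>x. 0)" using hi lo by auto
  ultimately show thesis using rpos by (rule_tac that[of r])
qed

text \<open>Disjoint sets have orthogonal projections because
  \<open>\<parallel>P x\<parallel>\<^sup>2 + \<parallel>Q x\<parallel>\<^sup>2 \<le> \<parallel>x\<parallel>\<^sup>2\<close> for all \<open>x\<close>; put \<open>x = P y\<close>.\<close>

lemma projection_disjoint_union:
  fixes F :: "nat \<Rightarrow> real set"
  assumes F: "range F \<subseteq> sets borel" "disjoint_family F"
    and P: "\<And>n. is_proj A (P n)" "\<And>n x. emeasure (smeasure x) (F n) = ennreal (inner (P n x) x)"
  obtains Q where "is_proj A Q" "\<And>x. (\<lambda>n. P n x) sums Q x"
    "\<And>x. emeasure (smeasure x) (\<Union>n. F n) = ennreal (inner (Q x) x)"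
proof -
  obtain tot: "\<And>x. emeasure (smeasure x) UNIV = ennreal ((norm x)\<^sup>2)" using smeasure_UNIV by blast
  interpret P: bounded_linear "P n" for n using P(1) by (rule is_proj_bl)
  note sym = sym_op_inner[OF is_proj_sym[OF P(1)]]
  note idem = is_proj_idem[OF P(1)]
  note form = is_proj_form[OF P(1)]
  have orth: "P m (P n x) = 0" if "m \<noteq> n" for m n x
  proof -
    let ?y = "P n x"
    have "ennreal (inner (P m ?y) ?y + inner (P n ?y) ?y) = emeasure (smeasure ?y) (F m) + emeasure (smeasure ?y) (F n)"
      by (simp add: P form)
    also have "\<dots> = emeasure (smeasure ?y) (F m \<union> F n)"
      using F that by (intro plus_emeasure) (auto simp: disjoint_family_on_def)
    also have "\<dots> \<le> emeasure (smeasure ?y) UNIV" by (intro emeasure_mono) auto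
    finally have "inner (P m ?y) ?y + inner (P n ?y) ?y \<le> (norm ?y)\<^sup>2" by (simp only: tot ennreal_le_iff zero_le_power2)
    then have "(norm (P m ?y))\<^sup>2 \<le> 0" by (simp add: form idem dot_square_norm)
    then show ?thesis by simp
  qed
  define S where "S N x = (\<Sum>n<N. P n x)" for N x
  have Sform: "inner (S N x) x = (\<Sum>n<N. inner (P n x) x)" for N x by (simp add: S_def inner_sum_left)
  have PS: "P n (S N x) = (if n < N then P n x else 0)" for n N x
  proof -
    have "P n (S N x) = (\<Sum>k<N. if k = n then P n x else 0)"
      unfolding S_def P.sum by (intro sum.cong) (auto simp: idem orth)
    then show ?thesis by (simp add: sum.delta)
  qed
  have SS: "S m (S n x) = S (min m n) x" for m n x
  proof -
    have "S m (S n x) = (\<Sum>k<m. if k < n then P k x else 0)" unfolding S_def[of m] by (simp add: PS)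
    also have "\<dots> = (\<Sum>k\<in>{..<m} \<inter> {k. k < n}. P k x)" by (simp add: sum.inter_restrict)
    also have "{..<m} \<inter> {k. k < n} = {..<min m n}" by auto
    finally show ?thesis by (simp add: S_def)
  qed
  have Ssym: "inner (S N x) y = inner x (S N y)" for N x y
    by (simp add: S_def inner_sum_left inner_sum_right sym)
  have Sbl: "bounded_linear (S N)" for N
    unfolding S_def by (intro bounded_linear_sum P.bounded_linear_axioms)
  have Sproj: "is_proj A (S N)" for N
    unfolding is_proj_def using is_proj_commutes[OF P(1)]
    by (simp add: SS Ssym Sbl sym_op_def commutes_def) (simp add: S_def linear_sum bounded_linear.linear)
  define f where "f x N = inner (S N x) x" for x N
  have f_le: "f x N \<le> (norm x)\<^sup>2" for x N
  proof -
    have "inner (S N x) x \<le> norm (S N x) * norm x" by (rule norm_cauchy_schwarz)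
    also have "\<dots> \<le> norm x * norm x" using is_proj_norm[OF Sproj, of N x] by (intro mult_right_mono) auto
    finally show ?thesis by (simp add: f_def power2_eq_square)
  qed
  have f_mono: "incseq (f x)" for x
    by (intro incseq_SucI) (simp add: f_def Sform form)
  have conv: "convergent (\<lambda>N. S N x)" for x
  proof (rule convergent_of_orthogonal_increments)
    show "convergent (f x)" using incseq_convergent[OF f_mono] f_le by (metis convergentI)
    \<comment> \<open>Two partial sums overlap in the shorter one; this makes their squared distance
      collapse to an increment of \<open>f x\<close>.\<close>
    have key: "inner (S m x) (S n x) = f x (min m n)" for m n
      using Ssym[of n "S m x" x] by (simp add: SS f_def min.commute)
    fix m n
    have "(norm (S m x - S n x))\<^sup>2 = f x m + f x n - 2 * f x (min m n)"
      by (simp add: power2_norm_eq_inner inner_diff_left inner_diff_right key min.commute)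
    also have "\<dots> = \<bar>f x m - f x n\<bar>"
      using incseqD[OF f_mono, of m n x] incseqD[OF f_mono, of n m x] by (cases "m \<le> n") (auto simp: min_def)
    finally show "(norm (S m x - S n x))\<^sup>2 = \<bar>f x m - f x n\<bar>" .
  qed
  define Q where "Q x = lim (\<lambda>N. S N x)" for x
  have lim: "(\<lambda>N. S N x) \<longlonglongrightarrow> Q x" for x using conv by (simp add: Q_def convergent_LIMSEQ_iff)
  interpret S: bounded_linear "S N" for N by (rule Sbl)
  have Qbl: "bounded_linear Q"
  proof (rule bounded_linear_intro[where K=1])
    show "Q (x + y) = Q x + Q y" for x y
      using LIMSEQ_unique[OF lim[of "x+y"]] tendsto_add[OF lim[of x] lim[of y]] by (simp add: S.add)
    show "Q (r *\<^sub>R x) = r *\<^sub>R Q x" for x r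
      using LIMSEQ_unique[OF lim[of "r *\<^sub>R x"]] tendsto_scaleR[OF tendsto_const lim[of x], of r]
      by (simp add: S.scaleR)
    show "norm (Q x) \<le> norm x * 1" for x
      by (rule Lim_norm_ubound[OF _ lim]) (auto simp: is_proj_norm[OF Sproj])
  qed
  have Qsym: "inner (Q x) y = inner x (Q y)" for x y
  proof (rule LIMSEQ_unique)
    show "(\<lambda>N. inner (S N x) y) \<longlonglongrightarrow> inner (Q x) y" by (intro tendsto_intros lim)
    show "(\<lambda>N. inner (S N x) y) \<longlonglongrightarrow> inner x (Q y)" unfolding Ssym by (intro tendsto_intros lim)
  qed
  have SQ: "S N (Q x) = S N x" for N x
  proof (rule LIMSEQ_unique)
    show "(\<lambda>m. S N (S m x)) \<longlonglongrightarrow> S N (Q x)" by (rule S.tendsto[OF lim])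
    show "(\<lambda>m. S N (S m x)) \<longlonglongrightarrow> S N x"
      by (rule tendsto_eventually) (auto simp: SS eventually_sequentially intro!: exI[of _ N])
  qed
  have Qcomm: "commutes T Q" if T: "bounded_linear T" "commutes T A" for T
    unfolding commutes_def
  proof (intro allI LIMSEQ_unique)
    fix x
    show "(\<lambda>N. T (S N x)) \<longlonglongrightarrow> T (Q x)" by (rule bounded_linear.tendsto[OF T(1) lim])
    show "(\<lambda>N. T (S N x)) \<longlonglongrightarrow> Q (T x)" using lim[of "T x"] is_proj_commutes[OF Sproj T] by simp
  qed
  show thesis
  proof (rule that)
    show "is_proj A Q"
      unfolding is_proj_def
    proof (intro conjI allI impI Qcomm)
      show "sym_op Q" using Qbl Qsym by (rule sym_opI)
      show "Q (Q x) = Q x" for x using LIMSEQ_unique[OF lim[of "Q x"]] lim[of x] by (simp add: SQ)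
    qed
    show "(\<lambda>n. P n x) sums Q x" for x using lim[of x] by (simp add: sums_def S_def)
    fix x
    have "emeasure (smeasure x) (\<Union>n. F n) = (\<Sum>n. emeasure (smeasure x) (F n))"
      using F by (intro suminf_emeasure[symmetric]) auto
    also have "\<dots> = (\<Sum>n. ennreal (inner (P n x) x))" by (simp add: P)
    also have "\<dots> = ennreal (inner (Q x) x)"
    proof (rule suminf_ennreal_eq)
      show "(\<lambda>n. inner (P n x) x) sums inner (Q x) x"
        unfolding sums_def Sform[symmetric] by (intro tendsto_intros lim)
    qed (simp add: form)
    finally show "emeasure (smeasure x) (\<Union>n. F n) = ennreal (inner (Q x) x)" .
  qed
qed

text \<open>Dynkin induction from half-open intervals: the sets that have a projection are closed
  under complements and countable disjoint unions, so no products of projections have to be formed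
  for intersections.\<close>

lemma borel_projection_exists:
  assumes "B \<in> sets borel"
  shows "\<exists>P. is_proj A P \<and> (\<forall>x. emeasure (smeasure x) B = ennreal (inner (P x) x))"
proof -
  obtain tot: "\<And>x. emeasure (smeasure x) UNIV = ennreal ((norm x)\<^sup>2)" using smeasure_UNIV by blast
  let ?G = "range (\<lambda>(a, b). {a<..b::real})"
  have G: "sigma_sets UNIV ?G = sets borel"
    by (simp add: borel_sigma_sets_Ioc)
  have zero: "is_proj A (\<lambda>x. 0)" by (auto simp: is_proj_def sym_op_def commutes_def linear_0 bounded_linear.linear)
  have int: "Int_stable ?G"
  proof (rule Int_stableI)
    fix X Y assume "X \<in> ?G" "Y \<in> ?G"
    then obtain a b c d where "X = {a<..b}" "Y = {c<..d}" by auto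
    then have "X \<inter> Y = (\<lambda>(a, b). {a<..b}) (max a c, min b d)" by auto
    then show "X \<inter> Y \<in> ?G" by blast
  qed
  have sub: "?G \<subseteq> Pow UNIV" by auto
  have mem: "B \<in> sigma_sets UNIV ?G" using assms by (simp add: G)
  from int sub mem show ?thesis
  proof (induction rule: sigma_sets_induct_disjoint)
    case (basic X)
    then obtain a b where X: "X = {a<..b}" by auto
    show ?case
    proof (cases "a \<le> b")
      case True
      then show ?thesis using sproj_diff_is_proj[OF True]
        by (intro exI[of _ "\<lambda>x. sproj b x - sproj a x"]) (auto simp: X smeasure_Ioc sdist_def inner_diff_left)
    next
      case False
      then show ?thesis using zero by (intro exI[of _ "\<lambda>x. 0"]) (simp add: X)
    qed
  next
    case empty
    show ?case using zero by (intro exI[of _ "\<lambda>x. 0"]) simp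
  next
    case (compl X)
    then obtain P where P: "is_proj A P" "\<And>x. emeasure (smeasure x) X = ennreal (inner (P x) x)" by blast
    have X: "X \<in> sets borel" using compl G by simp
    have "emeasure (smeasure x) (UNIV - X) = ennreal (inner (x - P x) x)" for x
    proof -
      have "emeasure (smeasure x) (UNIV - X) = emeasure (smeasure x) UNIV - emeasure (smeasure x) X"
        using emeasure_compl[of X "smeasure x"] X by (simp add: P)
      also have "\<dots> = ennreal ((norm x)\<^sup>2 - inner (P x) x)"
        by (simp add: tot P(2) is_proj_form[OF P(1)] ennreal_minus)
      finally show ?thesis by (simp add: inner_diff_left power2_norm_eq_inner)
    qed
    moreover have "is_proj A (\<lambda>x. x - P x)" using P by (intro is_proj_diff is_proj_id) auto
    ultimately show ?case by blast
  next
    case (union F)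
    then obtain P where P: "\<And>n. is_proj A (P n)" "\<And>n x. emeasure (smeasure x) (F n) = ennreal (inner (P n x) x)"
      by metis
    have "range F \<subseteq> sets borel" using union G by simp
    from projection_disjoint_union[OF this union(1) P] show ?case by metis
  qed
qed

text \<open>Over an interval \<open>{a<..b}\<close> of mass \<open>D\<close> the integral and the
  form of \<open>A\<close> both lie between \<open>a * D\<close> and \<open>b * D\<close>, so they
  differ by at most \<open>(b - a) * D\<close>.\<close>

lemma smeasure_integral: "(\<integral>t. t \<partial>smeasure x) = inner (A x) x"
proof -
  obtain r where r: "r > 0" "sproj r = (\<lambda>x. x)" "sproj (-r) = (\<lambda>x. 0)"
    "emeasure (smeasure x) (- {-r<..r}) = 0" "emeasure (smeasure x) UNIV = ennreal ((norm x)\<^sup>2)"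
    using smeasure_UNIV by metis
  interpret A: bounded_linear A using A by (simp add: sym_op_bl)
  interpret finite_measure "smeasure x" by (rule finite_measureI) (simp add: r)
  have int: "integrable (smeasure x) (\<lambda>t. indicator {a<..b} t * t)" for a b
  proof (rule integrable_const_bound[where B="\<bar>a\<bar> + \<bar>b\<bar>"])
    show "AE t in smeasure x. norm (indicator {a<..b} t * t) \<le> \<bar>a\<bar> + \<bar>b\<bar>" by (auto simp: indicator_def)
  qed simp
  have int1: "integrable (smeasure x) (\<lambda>t. indicator {a<..b} t * c)" for a b c :: real
    by (rule integrable_const_bound[where B="\<bar>c\<bar>"]) (auto simp: indicator_def)
  \<comment> \<open>The error accumulated up to \<open>l\<close>: it vanishes at \<open>-r\<close>,
    and at \<open>r\<close> it is the difference of the two sides of the claim.\<close>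
  define g where "g l = (\<integral>t. indicator {-r<..l} t * t \<partial>smeasure x) - inner (A (sproj l x)) x" for l
  have "g r = g (-r)"
  proof (rule eq_of_small_increments[where F="sdist x" and g=g and c="-r" and d=r])
    show "-r \<le> r" using r by simp
    fix a b assume ab: "-r \<le> a" "a \<le> b" "b \<le> r"
    define y where "y = sproj b x - sproj a x"
    define D where "D = sdist x b - sdist x a"
    have y: "(norm y)\<^sup>2 = D" using sdist_diff[OF ab(2), of x] by (simp add: y_def D_def)
    have D: "measure (smeasure x) {a<..b} = D"
      using smeasure_Ioc[OF ab(2), of x] sdist_mono[OF ab(2), of x] by (simp add: measure_def D_def)
    have int2: "(\<integral>t. indicator {a<..b} t * c \<partial>smeasure x) = c * D" for c
      using D by simp
    have "(\<integral>t. indicator {-r<..b} t * t \<partial>smeasure x) = (\<integral>t. indicator {-r<..a} t * t + indicator {a<..b} t * t \<partial>smeasure x)"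
      using ab by (intro Bochner_Integration.integral_cong) (auto simp: indicator_def)
    then have I: "(\<integral>t. indicator {-r<..b} t * t \<partial>smeasure x) - (\<integral>t. indicator {-r<..a} t * t \<partial>smeasure x)
        = (\<integral>t. indicator {a<..b} t * t \<partial>smeasure x)" (is "_ = ?I")
      using int by (simp add: Bochner_Integration.integral_add)
    have I1: "a * D \<le> ?I" unfolding int2[symmetric]
      by (intro integral_mono int int1) (auto simp: indicator_def)
    have I2: "?I \<le> b * D" unfolding int2[symmetric]
      by (intro integral_mono int int1) (auto simp: indicator_def)
    note R = sproj_diff_is_proj[OF ab(2)]
    \<comment> \<open>The projection fixes \<open>y\<close> and commutes with \<open>A\<close>, so
      it fixes \<open>A y\<close> and can be moved onto \<open>x\<close>.\<close>
    have "A y = sproj b (A y) - sproj a (A y)"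
      using is_proj_commutes[OF R A.bounded_linear_axioms, of x] is_proj_idem[OF R, of x]
        is_proj_commutes[OF R A.bounded_linear_axioms, of y]
      by (simp add: y_def commutes_def)
    then have Ay: "inner (A y) x = inner (A y) y"
      using sym_op_inner[OF is_proj_sym[OF R], of "A y" x] by (simp add: y_def)
    have "y \<in> spectral_space A b"
      unfolding y_def using sproj_in[of b x] sproj_in[of a x] spectral_space_mono[OF ab(2), of A]
      by (intro subspace_diff spectral_space_closed_subspace A) auto
    from spectral_space_le[OF this] have y2: "inner (A y) y \<le> b * D" by (simp add: y)
    \<comment> \<open>The increment of the spectral family kills the spectral space at
      \<open>a\<close>, so \<open>y\<close> is orthogonal to it.\<close>
    have y1: "a * D \<le> inner (A y) y" unfolding y[symmetric]
    proof (rule spectral_space_ge[OF A])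
      fix z assume z: "z \<in> spectral_space A a"
      then have "z \<in> spectral_space A b" using spectral_space_mono[OF ab(2), of A] by auto
      then have "sproj b z - sproj a z = 0" using z by (simp add: sproj_id)
      then show "inner y z = 0" using sym_op_inner[OF is_proj_sym[OF R], of x z] by (simp add: y_def)
    qed
    have "inner (A y) x = inner (A (sproj b x)) x - inner (A (sproj a x)) x"
      by (simp add: y_def A.diff inner_diff_left)
    then have "g b - g a = ?I - inner (A y) y" using I Ay by (simp add: g_def)
    then show "\<bar>g b - g a\<bar> \<le> (b - a) * (sdist x b - sdist x a)"
      using I1 I2 y1 y2 by (simp add: D_def[symmetric] left_diff_distrib)
  qed
  moreover have "g (-r) = 0" using r by (simp add: g_def A.zero)
  moreover have "(\<integral>t. indicator {-r<..r} t * t \<partial>smeasure x) = (\<integral>t. t \<partial>smeasure x)"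
  proof (rule integral_cong_AE)
    have "AE t in smeasure x. t \<notin> - {-r<..r}" using r(4) by (intro AE_not_in null_setsI) auto
    then show "AE t in smeasure x. indicator {-r<..r} t * t = t" by eventually_elim auto
  qed auto
  ultimately show ?thesis using r by (simp add: g_def)
qed

end

section \<open>Complex structure\<close>

text \<open>The imaginary part is a value of the real inner product too; hence real identities for
  operators commuting with \<open>\<i>\<close> transfer to \<open>cinner\<close>.\<close>

lemma cinner_eq_Complex: "cinner x y = Complex (inner x y) (inner x (\<i> *\<^sub>C y))"
proof -
  have "cinner x (\<i> *\<^sub>C y) = - \<i> * cinner x y"
    by (metis cinner_commute cinner_scaleC_left complex_cnj_i complex_cnj_mult)
  then show ?thesis by (simp add: complex_eq_iff inner_eq_Re_cinner)
qed

lemma inner_scaleC_i: "inner (\<i> *\<^sub>C x) y = - inner x (\<i> *\<^sub>C y)"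
  using arg_cong[OF cinner_eq_Complex[of x y], of Im] by (simp add: inner_eq_Re_cinner cinner_scaleC_left)

lemma scaleC_decomp: "a *\<^sub>C (x::'a::complex_inner) = Re a *\<^sub>R x + Im a *\<^sub>R (\<i> *\<^sub>C x)"
  by (simp add: scaleR_scaleC scaleC_scaleC complex_eq mult.commute flip: scaleC_add_left)

lemma scaleC_i_i: "\<i> *\<^sub>C \<i> *\<^sub>C (x::'a::complex_inner) = - x"
  using scaleR_scaleC[of "-1" x] by (simp add: scaleC_scaleC)

lemma scaleC_scaleR: "a *\<^sub>C r *\<^sub>R (x::'a::complex_inner) = r *\<^sub>R a *\<^sub>C x"
  by (simp add: scaleR_scaleC scaleC_scaleC mult.commute)

lemma norm_scaleC [simp]: "norm (a *\<^sub>C (x::'a::complex_inner)) = norm a * norm x"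
proof -
  have "inner (\<i> *\<^sub>C x) (\<i> *\<^sub>C x) = inner x x" "inner x (\<i> *\<^sub>C x) = 0"
    using inner_scaleC_i[of x "\<i> *\<^sub>C x"] inner_scaleC_i[of x x] by (simp_all add: scaleC_i_i inner_commute)
  then have "(norm (a *\<^sub>C x))\<^sup>2 = (norm a * norm x)\<^sup>2"
    unfolding power2_norm_eq_inner scaleC_decomp[of a x] power_mult_distrib
    by (simp add: inner_add_left inner_add_right inner_commute[of "\<i> *\<^sub>C x" x] inner_complex_def power2_eq_square algebra_simps)
  then show ?thesis by simp
qed

lemma bounded_bilinear_scaleC: "bounded_bilinear (scaleC :: complex \<Rightarrow> 'a \<Rightarrow> 'a::complex_inner)"
  by (rule bounded_bilinear.intro)
    (auto simp: scaleC_add_right scaleC_add_left scaleC_scaleR scaleR_scaleC scaleC_scaleC scaleR_conv_of_real intro!: exI[of _ 1])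

lemmas tendsto_scaleC = bounded_bilinear.tendsto[OF bounded_bilinear_scaleC]
lemmas bounded_linear_scaleC = bounded_bilinear.bounded_linear_right[OF bounded_bilinear_scaleC]

lemma csubspace_subspace: "complex_vector.subspace M \<Longrightarrow> subspace M"
  by (simp add: complex_vector.subspace_def subspace_def scaleR_scaleC)

lemma bounded_op_linear:
  assumes "bounded_op UNIV UNIV X"
  shows "bounded_linear X"
proof -
  obtain c where "\<And>x. norm (X x) \<le> c * norm x" using assms by (auto simp: bounded_op_def)
  then show ?thesis using assms
    by (intro bounded_linear_intro[where K=c]) (auto simp: bounded_op_def scaleR_scaleC mult.commute)
qed

lemma bounded_op_scaleC: "bounded_op M N X \<Longrightarrow> x \<in> M \<Longrightarrow> X (a *\<^sub>C x) = a *\<^sub>C X x"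
  by (simp add: bounded_op_def)

lemma bounded_op_scaleR: "bounded_op M N X \<Longrightarrow> x \<in> M \<Longrightarrow> X (r *\<^sub>R x) = r *\<^sub>R X x"
  by (simp add: bounded_op_def scaleR_scaleC)

lemma bounded_op_add: "bounded_op M N X \<Longrightarrow> x \<in> M \<Longrightarrow> y \<in> M \<Longrightarrow> X (x + y) = X x + X y"
  by (simp add: bounded_op_def)

lemma bounded_op_in: "bounded_op M N X \<Longrightarrow> x \<in> M \<Longrightarrow> X x \<in> N"
  by (simp add: bounded_op_def)

lemma bounded_op_bound: "bounded_op M N X \<Longrightarrow> \<exists>c\<ge>0. \<forall>x\<in>M. norm (X x) \<le> c * norm x"
  unfolding bounded_op_def
  by (metis abs_ge_self abs_ge_zero mult_right_mono norm_ge_zero order_trans)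

lemma bounded_op_UNIV_iff:
  "bounded_op UNIV UNIV X \<longleftrightarrow> bounded_linear X \<and> (\<forall>x. X (\<i> *\<^sub>C x) = \<i> *\<^sub>C X x)"
proof (intro iffI conjI)
  assume X: "bounded_linear X \<and> (\<forall>x. X (\<i> *\<^sub>C x) = \<i> *\<^sub>C X x)"
  then interpret X: bounded_linear X by blast
  have i: "X (\<i> *\<^sub>C x) = \<i> *\<^sub>C X x" for x using X by blast
  have "X (a *\<^sub>C x) = a *\<^sub>C X x" for a x
    unfolding scaleC_decomp[of a] by (simp add: X.add X.scaleR i)
  moreover obtain K where "\<And>x. norm (X x) \<le> norm x * K" using X.bounded by blast
  ultimately show "bounded_op UNIV UNIV X"
    by (auto simp: bounded_op_def X.add mult.commute intro!: exI[of _ K])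
qed (auto simp: bounded_op_linear bounded_op_scaleC)

lemma bounded_op_sum:
  assumes X: "bounded_op M N X" and M: "complex_vector.subspace M" and g: "\<And>b. b \<in> C \<Longrightarrow> g b \<in> M"
  shows "X (\<Sum>b\<in>C. c b *\<^sub>C g b) = (\<Sum>b\<in>C. c b *\<^sub>C X (g b))"
  using g
proof (induction C rule: infinite_finite_induct)
  case (insert b C)
  have "(\<Sum>b\<in>C. c b *\<^sub>C g b) \<in> M"
    using insert M by (intro complex_vector.subspace_sum complex_vector.subspace_scale) auto
  then show ?case using insert X M
    by (simp add: bounded_op_add bounded_op_scaleC complex_vector.subspace_scale)
next
  case empty
  show ?case using bounded_op_scaleC[OF X, of 0 0] complex_vector.subspace_0[OF M] by simp
next
  case (infinite C)
  then show ?case using bounded_op_scaleC[OF X, of 0 0] complex_vector.subspace_0[OF M] by simp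
qed

lemma cinner_symI:
  assumes "sym_op S" "\<And>x. S (\<i> *\<^sub>C x) = \<i> *\<^sub>C S x"
  shows "cinner (S x) y = cinner x (S y)"
  using sym_op_inner[OF assms(1)] by (simp add: cinner_eq_Complex flip: assms(2))

lemma cinner_adjointI:
  assumes "\<And>x y. inner (X x) y = inner x (X' y)" "\<And>x. X (\<i> *\<^sub>C x) = \<i> *\<^sub>C X x"
  shows "cinner (X x) y = cinner x (X' y)"
  using assms(1)[of x y] assms(1)[of "\<i> *\<^sub>C x" y]
  by (simp add: cinner_eq_Complex assms(2) inner_scaleC_i)

text \<open>Multiplication by \<open>\<i>\<close> has multiplication by \<open>-\<i>\<close> as its
  real adjoint, and a complex subspace is invariant under both.\<close>

lemma proj_scaleC_i:
  fixes M :: "'a::{complex_inner,complete_space} set"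
  assumes "closed M" "complex_vector.subspace M"
  shows "\<i> *\<^sub>C proj M x = proj M (\<i> *\<^sub>C x)"
proof (rule proj_commutes[where T'="\<lambda>x. - (\<i> *\<^sub>C x)"])
  show "- (\<i> *\<^sub>C x) \<in> M" if "x \<in> M" for x
    using assms that by (simp add: complex_vector.subspace_neg complex_vector.subspace_scale)
qed (use assms in \<open>auto simp: csubspace_subspace bounded_linear_scaleC inner_scaleC_i complex_vector.subspace_scale\<close>)

subsection \<open>Spectral measures and negative subspaces\<close>

text \<open>The real theory asks for an operator on the whole space, so \<open>A\<close> is extended
  by zero on the orthogonal complement of \<open>M\<close>. The extension commutes with
  \<open>proj M\<close> and with \<open>\<i>\<close>, and so do the projections obtained from
  it.\<close>

lemma is_spectral_measure_exists:
  fixes A :: "'a::{complex_inner,complete_space} \<Rightarrow> 'a"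
  assumes M: "closed M" "complex_vector.subspace M" and A: "bounded_op M M A"
    and sym: "\<And>x y. x \<in> M \<Longrightarrow> y \<in> M \<Longrightarrow> cinner (A x) y = cinner x (A y)"
  shows "\<exists>E. is_spectral_measure M A E"
proof -
  note M' = M(1) csubspace_subspace[OF M(2)]
  let ?p = "proj M"
  note pin = proj_in[OF M'] and pid = proj_id[OF M'] and psym = proj_sym[OF M']
  have pbl: "bounded_linear ?p" using psym by (rule sym_op_bl)
  note pnorm = proj_norm_le[OF M']
  define B where "B x = A (?p x)" for x
  have symB: "sym_op B"
  proof (rule sym_opI)
    obtain c where c: "c \<ge> 0" "\<And>x. x \<in> M \<Longrightarrow> norm (A x) \<le> c * norm x" using bounded_op_bound[OF A] by blast
    show "bounded_linear B"
    proof (rule bounded_linear_intro[where K=c])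
      show "norm (B x) \<le> norm x * c" for x
        using c(2)[OF pin[of x]] mult_left_mono[OF pnorm[of x] c(1)] by (simp add: B_def mult.commute)
    qed (simp_all add: B_def linear_add[OF bounded_linear.linear[OF pbl]] linear_scale[OF bounded_linear.linear[OF pbl]]
        bounded_op_add[OF A] bounded_op_scaleR[OF A] pin)
    show "inner (B x) y = inner x (B y)" for x y
    proof -
      have "inner (B x) y = inner (B x) (?p y)"
        using sym_op_inner[OF psym, of "B x" y] pid[of "B x"] bounded_op_in[OF A pin] by (simp add: B_def)
      also have "\<dots> = inner (?p x) (B y)"
        using sym[OF pin pin, of x y] by (simp add: B_def inner_eq_Re_cinner)
      also have "\<dots> = inner x (B y)"
        using sym_op_inner[OF psym, of x "B y"] pid[of "B y"] bounded_op_in[OF A pin] by (simp add: B_def)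
      finally show ?thesis .
    qed
  qed
  have pB: "commutes ?p B"
    using pid bounded_op_in[OF A pin] pin by (simp add: commutes_def B_def)
  have iB: "commutes (scaleC \<i>) B"
    by (simp add: commutes_def B_def bounded_op_scaleC[OF A pin] flip: proj_scaleC_i[OF M])
  define E where "E S = (SOME P. is_proj B P \<and> (\<forall>x. emeasure (smeasure B x) S = ennreal (inner (P x) x)))" for S
  have E: "is_proj B (E S)" "\<And>x. emeasure (smeasure B x) S = ennreal (inner (E S x) x)" if "S \<in> sets borel" for S
    using someI_ex[OF borel_projection_exists[OF symB that]] unfolding E_def by blast+
  \<comment> \<open>Equal masses give equal forms, because the forms are nonnegative and
    \<open>ennreal\<close> is injective there.\<close>
  have Euniq: "E S = Q" if S: "S \<in> sets borel" and Q: "is_proj B Q" "\<And>x. emeasure (smeasure B x) S = ennreal (inner (Q x) x)" for S Q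
  proof (rule sym_op_form_unique)
    show "inner (E S x) x = inner (Q x) x" for x
      using E(2)[OF S, of x] Q(2)[of x] by (simp add: is_proj_form[OF Q(1)] is_proj_form[OF E(1)[OF S]])
  qed (use E[OF S] Q in \<open>auto simp: is_proj_sym\<close>)
  obtain r where r: "r > 0" "\<And>x. emeasure (smeasure B x) (- {-r<..r}) = 0"
    "\<And>x. emeasure (smeasure B x) UNIV = ennreal ((norm x)\<^sup>2)"
    using smeasure_UNIV[OF symB] by metis
  have full: "E S = (\<lambda>x. x)" if S: "S \<in> sets borel" "{-r<..r} \<subseteq> S" for S
  proof (rule Euniq[OF S(1) is_proj_id])
    fix x
    have "emeasure (smeasure B x) (-S) \<le> emeasure (smeasure B x) (- {-r<..r})"
      using S by (intro emeasure_mono) (auto simp: symB)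
    then have "emeasure (smeasure B x) (-S) = 0" using r by simp
    moreover have "emeasure (smeasure B x) S + emeasure (smeasure B x) (-S) = emeasure (smeasure B x) UNIV"
      using S by (subst plus_emeasure) (auto simp: symB)
    ultimately show "emeasure (smeasure B x) S = ennreal (inner x x)"
      using r by (simp add: power2_norm_eq_inner)
  qed
  have EM: "E S x \<in> M" if "S \<in> sets borel" "x \<in> M" for S x
    using is_proj_commutes[OF E(1)[OF that(1)] pbl pB, of x] pin[of "E S x"] pid[OF that(2)] by simp
  have Ei: "E S (\<i> *\<^sub>C x) = \<i> *\<^sub>C E S x" if "S \<in> sets borel" for S x
    using is_proj_commutes[OF E(1)[OF that] bounded_linear_scaleC iB, of x] by simp
  \<comment> \<open>\<open>scalar_measure\<close> is rebuilt from the forms of \<open>E\<close>,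
    which are already the values of the measure \<open>smeasure B x\<close>.\<close>
  have meas: "scalar_measure E x = smeasure B x" for x
  proof -
    have "scalar_measure E x = measure_of UNIV (sets borel) (emeasure (smeasure B x))"
      unfolding scalar_measure_def
      by (rule measure_of_eq) (use E in \<open>auto simp: inner_eq_Re_cinner sets.sigma_sets_eq[of borel, simplified]\<close>)
    also have "\<dots> = smeasure B x"
      using measure_of_of_measure[of "smeasure B x"] by (simp add: symB)
    finally show ?thesis .
  qed
  have "is_spectral_measure M A E"
    unfolding is_spectral_measure_def
  proof (intro conjI ballI allI impI)
    fix S :: "real set" assume S: "S \<in> sets borel"
    note P = E(1)[OF S]
    have "bounded_op UNIV UNIV (E S)" using is_proj_bl[OF P] Ei[OF S] by (simp add: bounded_op_UNIV_iff)
    then have "bounded_op M M (E S)" using EM[OF S] by (simp add: bounded_op_def) blast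
    then show "orth_projection M (E S)"
      unfolding orth_projection_def using is_proj_idem[OF P] cinner_symI[OF is_proj_sym[OF P] Ei[OF S]] by auto
  next
    show "E UNIV x = x" for x by (simp add: full)
    show "\<exists>r. \<forall>x\<in>M. E {- r..r} x = x" 
      using full[of "{-r..r}"] greaterThanAtMost_subseteq_atLeastAtMost_iff[of "-r" r "-r" r]
      by (intro exI[of _ r]) auto
  next
    fix F :: "nat \<Rightarrow> real set" and x assume F: "range F \<subseteq> sets borel" "disjoint_family F"
    then have "F n \<in> sets borel" for n by auto
    from projection_disjoint_union[OF symB F E[OF this]]
    obtain Q where Q: "is_proj B Q" "\<And>x. (\<lambda>n. E (F n) x) sums Q x"
      "\<And>x. emeasure (smeasure B x) (\<Union>n. F n) = ennreal (inner (Q x) x)" by metis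
    have "E (\<Union>n. F n) = Q" using F Q by (intro Euniq) auto
    then show "(\<lambda>n. E (F n) x) sums E (\<Union>n. F n) x" using Q by simp
  next
    fix x assume x: "x \<in> M"
    have "Im (cinner (A x) x) = 0"
      using arg_cong[OF cinner_commute[of x "A x"], of Im] by (simp add: sym[OF x x])
    moreover have "Re (cinner (A x) x) = (\<integral>t. t \<partial>scalar_measure E x)"
      using smeasure_integral[OF symB, of x] by (simp add: meas B_def pid[OF x] inner_eq_Re_cinner)
    ultimately show "cinner (A x) x = complex_of_real (\<integral>t. t \<partial>scalar_measure E x)"
      by (simp add: complex_eq_iff)
  qed
  then show ?thesis by blast
qed

text \<open>What the count of negative squares uses of a spectral projection: \<open>P\<close> maps
  any subspace of \<open>M\<close> on which \<open>q\<close> is negative off zero injectively into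
  \<open>N\<close>, so \<open>N\<close> has the largest dimension among such subspaces.\<close>

definition negative_splitting :: "'a::complex_inner set \<Rightarrow> ('a \<Rightarrow> real) \<Rightarrow> 'a set \<Rightarrow> ('a \<Rightarrow> 'a) \<Rightarrow> bool" where
  "negative_splitting M q N P \<longleftrightarrow> complex_vector.subspace M \<and> complex_vector.subspace N \<and> N \<subseteq> M \<and> bounded_op M N P \<and>
    (\<forall>x\<in>N. x \<noteq> 0 \<longrightarrow> q x < 0) \<and> (\<forall>x\<in>M. P x = 0 \<longrightarrow> 0 \<le> q x)"

text \<open>Holds for every spectral measure of \<open>A\<close>, so the choice made by
  \<open>SOME\<close> has no influence. For a vector in the range of the projection the scalar
  measure lives on the negative numbers, for one in its kernel on the nonnegative ones.\<close>

lemma spectral_negative_splitting: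
  fixes A :: "'a::complex_inner \<Rightarrow> 'a"
  assumes M: "complex_vector.subspace M" and E: "is_spectral_measure M A E"
  shows "negative_splitting M (\<lambda>x. Re (cinner (A x) x)) (E {..<0} ` M) (E {..<0})"
proof -
  have proj: "orth_projection M (E S)" if "S \<in> sets borel" for S
    using E that by (simp add: is_spectral_measure_def)
  have UN: "E UNIV x = x" if "x \<in> M" for x using E that by (simp add: is_spectral_measure_def)
  have add: "(\<lambda>n. E (F n) x) sums E (\<Union>n. F n) x"
    if "range F \<subseteq> sets borel" "disjoint_family F" "x \<in> M" for F :: "nat \<Rightarrow> real set" and x
    using E that by (simp add: is_spectral_measure_def)
  obtain r where r: "\<And>x. x \<in> M \<Longrightarrow> E {-r..r} x = x" using E unfolding is_spectral_measure_def by blast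
  have int: "Re (cinner (A x) x) = (\<integral>t. t \<partial>scalar_measure E x)" if "x \<in> M" for x
    using E that by (simp add: is_spectral_measure_def)
  have form: "Re (cinner (E S x) x) = (norm (E S x))\<^sup>2" if "S \<in> sets borel" "x \<in> M" for S x
  proof -
    have "cinner (E S x) x = cinner (E S x) (E S x)"
      using proj[OF that(1)] that(2) by (simp add: orth_projection_def bounded_op_def)
    then show ?thesis by (simp add: power2_norm_eq_inner inner_eq_Re_cinner)
  qed
  \<comment> \<open>Additivity over empty sets gives a convergent constant series, whose term must
    be zero.\<close>
  have E0: "E {} x = 0" if "x \<in> M" for x
  proof -
    have "(\<lambda>n::nat. E {} x) sums E {} x" using add[of "\<lambda>_. {}" x] that by (simp add: disjoint_family_on_def)
    then have "summable (\<lambda>n::nat. E {} x)" by (rule sums_summable)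
    then show ?thesis by (simp add: summable_const_iff)
  qed
  have split: "E S x + E (- S) x = x" if S: "S \<in> sets borel" and x: "x \<in> M" for S x
  proof -
    have "(\<lambda>n. E (binaryset S (-S) n) x) sums E (\<Union>n. binaryset S (-S) n) x"
    proof (rule add)
      show "range (binaryset S (- S)) \<subseteq> sets borel" using S by (auto simp: binaryset_def)
      show "disjoint_family (binaryset S (- S))" by (auto simp: disjoint_family_on_def binaryset_def)
    qed fact
    then have "(\<lambda>n. E (binaryset S (-S) n) x) sums x" by (simp add: UN_binaryset_eq UN x)
    moreover have "(\<lambda>n. E (binaryset S (-S) n) x) sums (\<Sum>n\<in>{0,1}. E (binaryset S (-S) n) x)"
      by (rule sums_finite) (auto simp: binaryset_def E0 x)
    ultimately have "x = (\<Sum>n\<in>{0,1}. E (binaryset S (-S) n) x)" by (rule sums_unique2)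
    then show ?thesis by (simp add: binaryset_def)
  qed
  have sets: "sets (scalar_measure E x) = sets borel" "space (scalar_measure E x) = UNIV" for x
    unfolding scalar_measure_def by (simp_all add: sets.sigma_sets_eq[of borel, simplified])
  \<comment> \<open>\<open>measure_of\<close> takes the intended values only for a countably
    additive function, which is checked here through the forms.\<close>
  have em: "emeasure (scalar_measure E x) S = ennreal ((norm (E S x))\<^sup>2)" if S: "S \<in> sets borel" and x: "x \<in> M" for S x
  proof -
    have "emeasure (scalar_measure E x) S = ennreal (Re (cinner (E S x) x))"
    proof (rule emeasure_measure_of[OF scalar_measure_def])
      show "positive (sets (scalar_measure E x)) (\<lambda>B. ennreal (Re (cinner (E B x) x)))"
        by (simp add: positive_def E0[OF x]) (simp add: cinner_eq_Complex)
      show "countably_additive (sets (scalar_measure E x)) (\<lambda>B. ennreal (Re (cinner (E B x) x)))"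
      proof (rule countably_additiveI)
        fix F :: "nat \<Rightarrow> real set"
        assume F: "range F \<subseteq> sets (scalar_measure E x)" "disjoint_family F"
        then have Fb: "F n \<in> sets borel" for n by (auto simp: sets)
        have "(\<lambda>n. inner (E (F n) x) x) sums inner (E (\<Union>n. F n) x) x"
          using F by (intro bounded_linear.sums[OF bounded_linear_inner_left] add x) (auto simp: sets)
        then show "(\<Sum>n. ennreal (Re (cinner (E (F n) x) x))) = ennreal (Re (cinner (E (\<Union>n. F n) x) x))"
          by (intro suminf_ennreal_eq) (simp_all add: inner_eq_Re_cinner form[OF Fb x])
      qed
    qed (use S in \<open>auto simp: sets\<close>)
    then show ?thesis by (simp add: form S x)
  qed
  have bnd: "AE t in scalar_measure E x. \<bar>t\<bar> \<le> r" if x: "x \<in> M" for x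
  proof -
    have "E (- {-r..r}) x = 0" using split[of "{-r..r}" x] r x by simp
    then have "- {-r..r} \<in> null_sets (scalar_measure E x)" by (intro null_setsI) (simp_all add: em x sets)
    then have "AE t in scalar_measure E x. t \<notin> - {-r..r}" by (rule AE_not_in)
    then show ?thesis by eventually_elim auto
  qed
  have fin: "finite_measure (scalar_measure E x)" if x: "x \<in> M" for x
    by (rule finite_measureI) (simp add: sets em x)
  have meas[measurable]: "(\<lambda>t. t) \<in> borel_measurable (scalar_measure E x)" for x
    by (simp add: sets cong: measurable_cong_sets)
  have integ: "integrable (scalar_measure E x) (\<lambda>t. t)" if x: "x \<in> M" for x
    using bnd[OF x] by (intro finite_measure.integrable_const_bound[OF fin[OF x], where B=r]) auto
  let ?P = "E {..<0}"
  have P: "orth_projection M ?P" by (rule proj) simp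
  then have Pb: "bounded_op M M ?P" and PP: "\<And>x. x \<in> M \<Longrightarrow> ?P (?P x) = ?P x" by (auto simp: orth_projection_def)
  have pos: "0 \<le> Re (cinner (A x) x)" if x: "x \<in> M" "?P x = 0" for x
  proof -
    have "{..<0} \<in> null_sets (scalar_measure E x)" using x by (intro null_setsI) (simp_all add: em sets)
    then have "AE t in scalar_measure E x. t \<notin> {..<0}" by (rule AE_not_in)
    then have "AE t in scalar_measure E x. 0 \<le> t" by eventually_elim auto
    then show ?thesis by (simp add: int x integral_nonneg_AE)
  qed
  have neg: "Re (cinner (A x) x) < 0" if x: "x \<in> ?P ` M" "x \<noteq> 0" for x
  proof -
    have xM: "x \<in> M" and Px: "?P x = x" using x Pb PP by (auto simp: bounded_op_def)
    have "E (- {..<0}) x = 0" using split[of "{..<0}" x] xM Px by simp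
    then have "- {..<0} \<in> null_sets (scalar_measure E x)" by (intro null_setsI) (simp_all add: em xM sets)
    then have "AE t in scalar_measure E x. t \<notin> - {..<0}" by (rule AE_not_in)
    then have lt: "AE t in scalar_measure E x. t < 0" by eventually_elim auto
    have "0 \<le> (\<integral>t. - t \<partial>scalar_measure E x)"
      using lt by (intro integral_nonneg_AE) (auto elim: eventually_mono)
    then have "(\<integral>t. t \<partial>scalar_measure E x) \<le> 0" by simp
    \<comment> \<open>A strictly negative integrand with zero integral would make the total mass
      zero, but this mass is the square of \<open>norm x\<close>.\<close>
    moreover have "(\<integral>t. t \<partial>scalar_measure E x) \<noteq> 0"
    proof
      assume "(\<integral>t. t \<partial>scalar_measure E x) = 0"
      then have "(\<integral>t. - t \<partial>scalar_measure E x) = 0" by simp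
      then have "AE t in scalar_measure E x. - t = 0"
        using lt integ[OF xM] by (subst (asm) integral_nonneg_eq_0_iff_AE) (auto elim: eventually_mono)
      with lt have "AE t in scalar_measure E x. False" by eventually_elim auto
      then have "emeasure (scalar_measure E x) UNIV = 0"
        using AE_iff_measurable[of UNIV "scalar_measure E x" "\<lambda>_. False"] by (simp add: sets)
      then show False using x(2) by (simp add: em xM UN)
    qed
    ultimately show ?thesis by (simp add: int xM)
  qed
  have "complex_vector.subspace (?P ` M)"
    unfolding complex_vector.subspace_def
  proof (intro conjI ballI allI)
    show "0 \<in> ?P ` M"
      using bounded_op_scaleC[OF Pb, of 0 0] complex_vector.subspace_0[OF M] by (metis image_eqI complex_vector.scale_zero_left)
    show "x + y \<in> ?P ` M" if "x \<in> ?P ` M" "y \<in> ?P ` M" for x y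
      using that complex_vector.subspace_add[OF M] bounded_op_add[OF Pb] by (auto simp: image_iff) metis
    show "c *\<^sub>C x \<in> ?P ` M" if "x \<in> ?P ` M" for x c
      using that complex_vector.subspace_scale[OF M] bounded_op_scaleC[OF Pb] by (auto simp: image_iff) metis
  qed
  then show ?thesis unfolding negative_splitting_def
    using M Pb pos neg by (auto simp: bounded_op_def)
qed

section \<open>Adjoints of operators on closed subspaces\<close>

lemma adj_eqI:
  assumes M: "complex_vector.subspace M" and h: "h \<in> M" "\<And>f. f \<in> M \<Longrightarrow> cinner (X f) g = cinner f h"
  shows "adj M X g = h"
  unfolding adj_def
proof (rule the_equality)
  show "h \<in> M \<and> (\<forall>f\<in>M. cinner (X f) g = cinner f h)" using h by blast
  fix h' assume h': "h' \<in> M \<and> (\<forall>f\<in>M. cinner (X f) g = cinner f h')"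
  have d: "h' - h \<in> M" using h h' M by (simp add: complex_vector.subspace_diff)
  have "inner (h' - h) h' = inner (h' - h) h" using h(2)[OF d] h' d by (simp add: inner_eq_Re_cinner)
  then have "inner (h' - h) (h' - h) = 0" by (simp add: inner_diff_right)
  then show "h' = h" by simp
qed

text \<open>Riesz representation for \<open>X\<close> after \<open>proj M\<close> gives a candidate
  in the whole space; projecting it to \<open>M\<close> does not change its pairing with vectors of
  \<open>M\<close>.\<close>

lemma adj_exists:
  fixes X :: "'a::{complex_inner,complete_space} \<Rightarrow> 'b::complex_inner"
  assumes M: "closed M" "complex_vector.subspace M" and X: "bounded_op M N X"
  shows "adj M X g \<in> M \<and> (\<forall>f\<in>M. cinner (X f) g = cinner f (adj M X g))"
proof -
  note M' = M(1) csubspace_subspace[OF M(2)]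
  note pin = proj_in[OF M'] and pid = proj_id[OF M'] and psym = proj_sym[OF M']
  have pbl: "bounded_linear (proj M)" using psym by (rule sym_op_bl)
  obtain c where c: "c \<ge> 0" "\<And>x. x \<in> M \<Longrightarrow> norm (X x) \<le> c * norm x" using bounded_op_bound[OF X] by blast
  obtain d where d: "\<And>x. norm (proj M x) \<le> norm x * d" using bounded_linear.bounded[OF pbl] by blast
  have bl: "bounded_linear (\<lambda>f. X (proj M f))"
  proof (rule bounded_linear_intro[where K="d * c"])
    show "norm (X (proj M x)) \<le> norm x * (d * c)" for x
      using c(2)[OF pin[of x]] mult_left_mono[OF d[of x] c(1)] by (simp add: mult_ac)
  qed (simp_all add: linear_add[OF bounded_linear.linear[OF pbl]] linear_scale[OF bounded_linear.linear[OF pbl]]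
        bounded_op_add[OF X] bounded_op_scaleR[OF X] pin)
  obtain Y where Y: "\<And>x y. inner (X (proj M x)) y = inner x (Y y)" using adjoint_exists[OF bl] by blast
  have Yc: "cinner (X (proj M x)) y = cinner x (Y y)" for x y
    using Y by (rule cinner_adjointI) (simp add: bounded_op_scaleC[OF X pin] flip: proj_scaleC_i[OF M])
  have psymc: "cinner (proj M x) y = cinner x (proj M y)" for x y
    by (rule cinner_symI[OF psym]) (simp add: proj_scaleC_i[OF M])
  have *: "proj M (Y g) \<in> M \<and> (\<forall>f\<in>M. cinner (X f) g = cinner f (proj M (Y g)))"
    using pin Yc pid by (auto simp flip: psymc) (metis psymc pid Yc)
  then have "adj M X g = proj M (Y g)" using M by (intro adj_eqI) auto
  with * show ?thesis by simp
qed

lemma adj_UNIV: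
  fixes X :: "'a::{complex_inner,complete_space} \<Rightarrow> 'b::complex_inner"
  assumes X: "bounded_op UNIV UNIV X"
  shows "cinner (X f) g = cinner f (adj UNIV X g)" "inner (X f) g = inner f (adj UNIV X g)"
    "bounded_op UNIV UNIV (adj UNIV X)"
proof -
  show 1: "cinner (X f) g = cinner f (adj UNIV X g)" for f g
    using adj_exists[OF closed_UNIV complex_vector.subspace_UNIV X] by blast
  then show 2: "inner (X f) g = inner f (adj UNIV X g)" for f g by (simp add: inner_eq_Re_cinner)
  have "adj UNIV X (\<i> *\<^sub>C g) = \<i> *\<^sub>C adj UNIV X g" for g
  proof (rule vector_eq_ldot[THEN iffD1, rule_format])
    fix f
    have "inner f (adj UNIV X (\<i> *\<^sub>C g)) = - inner (\<i> *\<^sub>C X f) g" by (simp add: inner_scaleC_i flip: 2)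
    also have "\<dots> = inner f (\<i> *\<^sub>C adj UNIV X g)"
      by (simp add: 2 inner_scaleC_i flip: bounded_op_scaleC[OF X])
    finally show "inner f (adj UNIV X (\<i> *\<^sub>C g)) = inner f (\<i> *\<^sub>C adj UNIV X g)" .
  qed
  then show "bounded_op UNIV UNIV (adj UNIV X)"
    using adjoint_bounded_linear[OF bounded_op_linear[OF X] 2] by (simp add: bounded_op_UNIV_iff)
qed

text \<open>Here spectral measures are left behind: the form of \<open>f - adj M X (X f)\<close> is
  a difference of squared norms, and \<open>kappa_minus\<close> becomes the dimension of the
  negative part in a splitting of it.\<close>

lemma kappa_minus_splitting:
  fixes X :: "'a::{complex_inner,complete_space} \<Rightarrow> 'b::complex_inner"
  assumes M: "closed M" "complex_vector.subspace M" and X: "bounded_op M N X"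
  obtains L P where "negative_splitting M (\<lambda>x. (norm x)\<^sup>2 - (norm (X x))\<^sup>2) L P"
    "kappa_minus M (\<lambda>f. f - adj M X (X f)) = ecdim L"
proof -
  define A where "A f = f - adj M X (X f)" for f
  have adjM: "adj M X g \<in> M" and adj: "f \<in> M \<Longrightarrow> cinner (X f) g = cinner f (adj M X g)" for f g
    using adj_exists[OF M X] by blast+
  have Aform: "cinner (A f) g = cinner f g - cinner (X f) (X g)" if "g \<in> M" for f g
  proof -
    have "cinner (A f) g = cinner f g - cinner (adj M X (X f)) g"
      unfolding A_def by (metis add_diff_cancel_right' cinner_add_left diff_add_cancel)
    also have "cinner (adj M X (X f)) g = cinner (X f) (X g)"
      by (metis adj cinner_commute that)
    finally show ?thesis .
  qed
  have sym: "cinner (A f) g = cinner f (A g)" if "f \<in> M" "g \<in> M" for f g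
    using that Aform cinner_commute by (metis complex_cnj_diff)
  have AM: "A f \<in> M" if "f \<in> M" for f
    using that M adjM by (simp add: A_def complex_vector.subspace_diff)
  \<comment> \<open>Vectors of \<open>M\<close> are determined by their pairings with
    \<open>M\<close>, so linearity of \<open>A\<close> can be read off from
    \<open>Aform\<close>.\<close>
  have ext: "u = v" if "u \<in> M" "v \<in> M" "\<And>g. g \<in> M \<Longrightarrow> cinner u g = cinner v g" for u v
  proof -
    have d: "u - v \<in> M" using that M by (simp add: complex_vector.subspace_diff)
    have "inner u (u - v) = inner v (u - v)" using that(3)[OF d] by (simp add: inner_eq_Re_cinner)
    then have "inner (u - v) (u - v) = 0" by (simp add: inner_diff_left)
    then show ?thesis by simp
  qed
  obtain c where c: "c \<ge> 0" "\<And>x. x \<in> M \<Longrightarrow> norm (X x) \<le> c * norm x" using bounded_op_bound[OF X] by blast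
  have "bounded_op M M A"
    unfolding bounded_op_def
  proof (intro conjI ballI allI)
    show "A (x + y) = A x + A y" if "x \<in> M" "y \<in> M" for x y
      using that M AM by (intro ext) (auto simp: Aform bounded_op_add[OF X] cinner_add_left complex_vector.subspace_add)
    show "A (a *\<^sub>C x) = a *\<^sub>C A x" if "x \<in> M" for a x
      using that M AM by (intro ext) (auto simp: Aform bounded_op_scaleC[OF X] cinner_scaleC_left
          complex_vector.subspace_scale right_diff_distrib)
    show "\<exists>C. \<forall>x\<in>M. norm (A x) \<le> C * norm x"
    proof (intro exI ballI)
      fix x assume x: "x \<in> M"
      let ?h = "adj M X (X x)"
      have "norm ?h * norm ?h = inner (X ?h) (X x)"
        using adj[OF adjM, of "X x" "X x"] by (simp add: inner_eq_Re_cinner flip: power2_eq_square) (simp add: power2_norm_eq_inner inner_eq_Re_cinner)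
      also have "\<dots> \<le> norm (X ?h) * norm (X x)" by (rule norm_cauchy_schwarz)
      also have "\<dots> \<le> (c * norm ?h) * (c * norm x)" using c x adjM by (intro mult_mono) auto
      finally have "norm ?h * norm ?h \<le> norm ?h * (c * c * norm x)" by (simp add: mult_ac)
      then have "norm ?h \<le> c * c * norm x" using c by (cases "?h = 0") (auto simp: mult_le_cancel_left_pos)
      then show "norm (A x) \<le> (1 + c * c) * norm x"
        unfolding A_def using norm_triangle_ineq4[of x ?h] by (simp add: distrib_right)
    qed
  qed (rule AM)
  then have "\<exists>E. is_spectral_measure M A E" using M sym by (intro is_spectral_measure_exists)
  then have E: "is_spectral_measure M A (spectral_measure M A)" unfolding spectral_measure_def by (rule someI_ex)
  have "negative_splitting M (\<lambda>x. Re (cinner (A x) x)) (spectral_measure M A {..<0} ` M) (spectral_measure M A {..<0})"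
    by (rule spectral_negative_splitting[OF M(2) E])
  moreover have "Re (cinner (A x) x) = (norm x)\<^sup>2 - (norm (X x))\<^sup>2" if "x \<in> M" for x
    by (simp add: Aform[OF that] power2_norm_eq_inner inner_eq_Re_cinner)
  moreover have "N \<subseteq> M \<Longrightarrow> x \<in> N \<Longrightarrow> Re (cinner (A x) x) = (norm x)\<^sup>2 - (norm (X x))\<^sup>2" for N x
    using calculation(2) by blast
  ultimately have "negative_splitting M (\<lambda>x. (norm x)\<^sup>2 - (norm (X x))\<^sup>2)
      (spectral_measure M A {..<0} ` M) (spectral_measure M A {..<0})"
    unfolding negative_splitting_def by metis
  then show thesis using that by (simp add: kappa_minus_def A_def[symmetric] eta_contract_eq)
qed

subsection \<open>Comparison of negative subspaces\<close>

text \<open>Finite independent sets are enough: an infinite basis would contain independent sets of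
  every finite size, which a finite bound forbids.\<close>

lemma ecdim_leI:
  assumes le: "\<And>C. finite C \<Longrightarrow> C \<subseteq> N \<Longrightarrow> complex_vector.independent C \<Longrightarrow> enat (card C) \<le> ecdim N'"
  shows "ecdim N \<le> ecdim N'"
proof (cases "ecdim N'")
  case (enat n)
  obtain B where B: "B \<subseteq> N" "complex_vector.independent B" "N \<subseteq> complex_vector.span B" "card B = complex_vector.dim N"
    using complex_vector.basis_exists by blast
  have "finite B"
  proof (rule ccontr)
    assume "infinite B"
    then obtain C where C: "C \<subseteq> B" "finite C" "card C = Suc n" using infinite_arbitrarily_large by blast
    then have "enat (Suc n) \<le> enat n"
      using le[of C] B complex_vector.independent_mono enat by (metis subset_trans)
    then show False by simp
  qed
  then have "ecdim N = enat (card B)" using B by (auto simp: ecdim_def)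
  then show ?thesis using le[of B] \<open>finite B\<close> B by simp
qed simp

text \<open>More vectors than the dimension are dependent. A family is considered because
  \<open>g\<close> may repeat a value; then the coefficients \<open>1\<close> and \<open>-1\<close>
  do.\<close>

lemma dependent_family:
  fixes g :: "'a \<Rightarrow> 'b::complex_inner"
  assumes C: "finite C" and g: "\<And>b. b \<in> C \<Longrightarrow> g b \<in> N" and lt: "\<not> enat (card C) \<le> ecdim N"
  obtains c where "\<exists>b\<in>C. c b \<noteq> 0" "(\<Sum>b\<in>C. c b *\<^sub>C g b) = 0"
proof (cases "inj_on g C")
  case True
  have "ecdim N \<noteq> \<infinity>" using lt by (cases "ecdim N") auto
  then obtain B where B: "finite B" "N \<subseteq> complex_vector.span B"
    by (auto simp: ecdim_def split: if_splits)
  then have dim: "ecdim N = enat (complex_vector.dim N)" by (auto simp: ecdim_def)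
  obtain D where D: "D \<subseteq> N" "complex_vector.independent D" "N \<subseteq> complex_vector.span D" "card D = complex_vector.dim N"
    using complex_vector.basis_exists by blast
  have "finite D" using complex_vector.independent_span_bound[OF B(1) D(2)] D(1) B(2) by blast
  have "complex_vector.dependent (g ` C)"
  proof (rule ccontr)
    assume "\<not> complex_vector.dependent (g ` C)"
    then have "card (g ` C) \<le> card D"
      using complex_vector.independent_span_bound[OF \<open>finite D\<close>] g D(3) by blast
    then show False using lt dim D(4) by (simp add: card_image[OF True])
  qed
  then obtain u v where u: "v \<in> g ` C" "u v \<noteq> 0" "(\<Sum>v\<in>g ` C. u v *\<^sub>C v) = 0"
    using complex_vector.dependent_finite[of "g ` C"] C by auto
  then show thesis using that[of "u \<circ> g"] by (auto simp: sum.reindex[OF True])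
next
  case False
  then obtain a b where ab: "a \<in> C" "b \<in> C" "a \<noteq> b" "g a = g b" by (auto simp: inj_on_def)
  define c :: "'a \<Rightarrow> complex" where "c x = (if x = a then 1 else if x = b then -1 else 0)" for x
  have "(\<Sum>x\<in>C. c x *\<^sub>C g x) = (\<Sum>x\<in>{a, b}. c x *\<^sub>C g x)"
    using C ab by (intro sum.mono_neutral_right) (auto simp: c_def)
  also have "\<dots> = 0" using ab by (simp add: c_def complex_vector.scale_minus_left scaleC_one)
  finally have "(\<Sum>x\<in>C. c x *\<^sub>C g x) = 0" .
  moreover have "c a \<noteq> 0" by (simp add: c_def)
  ultimately show thesis using that[of c] ab(1) by blast
qed

text \<open>Bolzano-Weierstrass, one coordinate at a time.\<close>

lemma bounded_coefficients_subsequence: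
  fixes c :: "nat \<Rightarrow> 'a \<Rightarrow> complex"
  assumes "finite C" "\<And>k b. b \<in> C \<Longrightarrow> norm (c k b) \<le> 1"
  shows "\<exists>r c0. strict_mono (r :: nat \<Rightarrow> nat) \<and> (\<forall>b\<in>C. (\<lambda>k. c (r k) b) \<longlonglongrightarrow> c0 b)"
  using assms
proof (induction C)
  case empty
  show ?case by (auto intro: exI[of _ id] strict_mono_id)
next
  case (insert a C)
  then obtain r c0 where r: "strict_mono r" "\<forall>b\<in>C. (\<lambda>k. c (r k) b) \<longlonglongrightarrow> c0 b" by auto
  have "bounded (range (\<lambda>k. c (r k) a))" using insert.prems by (auto simp: bounded_iff)
  then obtain l s where s: "strict_mono s" "((\<lambda>k. c (r k) a) \<circ> s) \<longlonglongrightarrow> l"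
    using bounded_imp_convergent_subsequence by blast
  have "(\<lambda>k. c ((r \<circ> s) k) b) \<longlonglongrightarrow> (c0(a := l)) b" if "b \<in> insert a C" for b
    using that r s LIMSEQ_subseq_LIMSEQ[of "\<lambda>k. c (r k) b" "c0 b" s] by (auto simp: o_def)
  then show ?case using strict_mono_o[OF r(1) s(1)] by blast
qed

text \<open>The families \<open>G k\<close> replace a linear map \<open>N2 \<rightarrow> M1\<close>, which in general exists only approximately.
  Compactness of the coefficient vectors turns the approximation into an exact comparison.\<close>

lemma negative_splitting_ecdim_le:
  fixes N1 :: "'a::complex_inner set" and N2 :: "'b::complex_inner set"
  assumes 1: "negative_splitting M1 q1 N1 P1" and 2: "negative_splitting M2 q2 N2 P2"
    and approx: "\<And>C. finite C \<Longrightarrow> C \<subseteq> N2 \<Longrightarrow> \<exists>G :: nat \<Rightarrow> 'b \<Rightarrow> 'a. (\<forall>k. \<forall>b\<in>C. G k b \<in> M1) \<and>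
      (\<forall>r c c0. strict_mono r \<longrightarrow> (\<forall>b\<in>C. (\<lambda>k. c k b) \<longlonglongrightarrow> c0 b) \<longrightarrow>
        (\<exists>l \<le> q2 (\<Sum>b\<in>C. c0 b *\<^sub>C b). (\<lambda>k. q1 (\<Sum>b\<in>C. c k b *\<^sub>C G (r k) b)) \<longlonglongrightarrow> l))"
  shows "ecdim N2 \<le> ecdim N1"
proof (rule ecdim_leI)
  fix C assume C: "finite C" "C \<subseteq> N2" "complex_vector.independent C"
  obtain G :: "nat \<Rightarrow> 'b \<Rightarrow> 'a" where GM: "\<And>k b. b \<in> C \<Longrightarrow> G k b \<in> M1"
    and G: "\<And>r c c0. strict_mono r \<Longrightarrow> (\<And>b. b \<in> C \<Longrightarrow> (\<lambda>k. c k b) \<longlonglongrightarrow> c0 b) \<Longrightarrow>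
        (\<exists>l \<le> q2 (\<Sum>b\<in>C. c0 b *\<^sub>C b). (\<lambda>k. q1 (\<Sum>b\<in>C. c k b *\<^sub>C G (r k) b)) \<longlonglongrightarrow> l)"
    using approx[OF C(1,2)] by blast
  have M1: "complex_vector.subspace M1" and P1: "bounded_op M1 N1 P1"
    and q1: "\<And>x. x \<in> M1 \<Longrightarrow> P1 x = 0 \<Longrightarrow> 0 \<le> q1 x" using 1 by (auto simp: negative_splitting_def)
  have N2: "complex_vector.subspace N2" and q2: "\<And>x. x \<in> N2 \<Longrightarrow> x \<noteq> 0 \<Longrightarrow> q2 x < 0"
    using 2 by (auto simp: negative_splitting_def)
  show "enat (card C) \<le> ecdim N1"
  proof (rule ccontr)
    assume lt: "\<not> enat (card C) \<le> ecdim N1"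
    \<comment> \<open>For each \<open>k\<close> the images under \<open>P1\<close> are too many for
      \<open>N1\<close>. A relation among them puts the same combination of the \<open>G k b\<close>
      into the kernel of \<open>P1\<close>, where \<open>q1\<close> is nonnegative.\<close>
    have "\<exists>c. (\<exists>b\<in>C. norm (c b) = 1) \<and> (\<forall>b\<in>C. norm (c b) \<le> 1) \<and> 0 \<le> q1 (\<Sum>b\<in>C. c b *\<^sub>C G k b)" for k
    proof -
      obtain d where d: "\<exists>b\<in>C. d b \<noteq> 0" "(\<Sum>b\<in>C. d b *\<^sub>C P1 (G k b)) = 0"
        using dependent_family[OF C(1) _ lt, of "\<lambda>b. P1 (G k b)"] bounded_op_in[OF P1 GM] by metis
      \<comment> \<open>Dividing by the largest modulus keeps the coefficient vectors bounded and
        away from zero.\<close>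
      define m where "m = Max ((\<lambda>b. norm (d b)) ` C)"
      have ne: "C \<noteq> {}" using d by auto
      have "m \<in> (\<lambda>b. norm (d b)) ` C" unfolding m_def using C ne by (intro Max_in) auto
      then obtain b0 where b0: "b0 \<in> C" "norm (d b0) = m" by auto
      have dm: "norm (d b) \<le> m" if "b \<in> C" for b unfolding m_def using C that by (intro Max_ge) auto
      have m: "m > 0" using d dm by (meson less_le_trans zero_less_norm_iff)
      define c where "c b = d b / of_real m" for b
      have in_M1: "(\<Sum>b\<in>C. c b *\<^sub>C G k b) \<in> M1"
        by (intro complex_vector.subspace_sum complex_vector.subspace_scale M1 GM)
      have "P1 (\<Sum>b\<in>C. c b *\<^sub>C G k b) = (\<Sum>b\<in>C. c b *\<^sub>C P1 (G k b))"
        by (rule bounded_op_sum[OF P1 M1 GM])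
      also have "\<dots> = (1 / of_real m) *\<^sub>C (\<Sum>b\<in>C. d b *\<^sub>C P1 (G k b))"
        by (simp add: complex_vector.scale_sum_right scaleC_scaleC c_def)
      finally have "0 \<le> q1 (\<Sum>b\<in>C. c b *\<^sub>C G k b)" using d(2) by (intro q1[OF in_M1]) simp
      then show ?thesis using b0 dm m by (intro exI[of _ c]) (auto simp: c_def norm_divide intro!: bexI[of _ b0])
    qed
    then obtain c where c: "\<And>k. \<exists>b\<in>C. norm (c k b) = 1" "\<And>k b. b \<in> C \<Longrightarrow> norm (c k b) \<le> 1"
      "\<And>k. 0 \<le> q1 (\<Sum>b\<in>C. c k b *\<^sub>C G k b)" by metis
    obtain r c0 where r: "strict_mono r" "\<And>b. b \<in> C \<Longrightarrow> (\<lambda>k. c (r k) b) \<longlonglongrightarrow> c0 b"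
      using bounded_coefficients_subsequence[of C c] C(1) c(2) by metis
    define x where "x = (\<Sum>b\<in>C. c0 b *\<^sub>C b)"
    \<comment> \<open>The index whose coefficient has modulus one may change with \<open>k\<close>;
      the sum of the moduli gives a lower bound that survives the limit.\<close>
    have "1 \<le> (\<Sum>b\<in>C. norm (c0 b))"
    proof (rule LIMSEQ_le_const)
      show "(\<lambda>k. \<Sum>b\<in>C. norm (c (r k) b)) \<longlonglongrightarrow> (\<Sum>b\<in>C. norm (c0 b))"
        by (intro tendsto_sum tendsto_norm r(2))
      have "1 \<le> (\<Sum>b\<in>C. norm (c (r k) b))" for k
      proof -
        obtain b where b: "b \<in> C" "norm (c (r k) b) = 1" using c(1) by blast
        have "norm (c (r k) b) \<le> (\<Sum>b\<in>C. norm (c (r k) b))" using C(1) b(1) by (intro member_le_sum) auto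
        then show ?thesis using b by simp
      qed
      then show "\<exists>N. \<forall>n\<ge>N. 1 \<le> (\<Sum>b\<in>C. norm (c (r n) b))" by blast
    qed
    then have "\<exists>b\<in>C. c0 b \<noteq> 0" by (metis norm_zero not_one_le_zero sum.neutral)
    then have "x \<noteq> 0" unfolding x_def using complex_vector.independentD[OF C(3,1) order_refl, of c0] by blast
    moreover have "x \<in> N2" unfolding x_def using C N2
      by (intro complex_vector.subspace_sum complex_vector.subspace_scale) auto
    ultimately have "q2 x < 0" by (rule q2[rotated])
    \<comment> \<open>The limit \<open>l\<close> is nonnegative by the choice of the coefficients,
      yet at most \<open>q2 x < 0\<close>.\<close>
    moreover obtain l where l: "l \<le> q2 x" "(\<lambda>k. q1 (\<Sum>b\<in>C. c (r k) b *\<^sub>C G (r k) b)) \<longlonglongrightarrow> l"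
      using G[of r "\<lambda>k. c (r k)" c0, OF r] unfolding x_def by blast
    moreover have "0 \<le> l" by (rule LIMSEQ_le_const[OF l(2)]) (use c(3) in auto)
    ultimately show False by simp
  qed
qed

section \<open>Defect operators\<close>

text \<open>Over the complex numbers real values of the form already force symmetry: polarize
  \<open>inner (S f) (\<i> *\<^sub>C f) = 0\<close> at \<open>f + \<i> *\<^sub>C g\<close>.\<close>

lemma positive_op_iff:
  "positive_op S \<longleftrightarrow> bounded_op UNIV UNIV S \<and> pos_op S"
proof
  assume S: "positive_op S"
  then have b: "bounded_op UNIV UNIV S" and r: "\<And>f. cinner (S f) f \<in> \<real>" and nn: "\<And>f. 0 \<le> inner (S f) f"
    by (auto simp: positive_op_def inner_eq_Re_cinner)
  interpret S: bounded_linear S using b by (rule bounded_op_linear)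
  have i: "S (\<i> *\<^sub>C f) = \<i> *\<^sub>C S f" for f by (rule bounded_op_scaleC[OF b]) simp
  have z: "inner (S f) (\<i> *\<^sub>C f) = 0" for f
    using r[of f] by (simp add: cinner_eq_Complex complex_is_Real_iff)
  have sym: "inner (S f) g = inner f (S g)" for f g
  proof -
    let ?h = "\<i> *\<^sub>C g"
    have "inner (S (f + ?h)) (\<i> *\<^sub>C (f + ?h)) = inner (S f) (\<i> *\<^sub>C ?h) + inner (S ?h) (\<i> *\<^sub>C f)"
      by (simp only: S.add scaleC_add_right inner_add_left inner_add_right z add_0_left add_0_right)
    then have "inner (S f) (\<i> *\<^sub>C ?h) + inner (S ?h) (\<i> *\<^sub>C f) = 0" by (simp only: z)
    moreover have "inner (S ?h) (\<i> *\<^sub>C f) = inner (S g) f"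
      by (simp add: i inner_scaleC_i scaleC_i_i)
    ultimately show ?thesis by (simp add: scaleC_i_i inner_commute)
  qed
  show "bounded_op UNIV UNIV S \<and> pos_op S"
    using b nn sym S.bounded_linear_axioms by (simp add: pos_op_def sym_op_def)
next
  assume S: "bounded_op UNIV UNIV S \<and> pos_op S"
  then have "cinner (S f) f = cnj (cinner (S f) f)" for f
    by (metis UNIV_I bounded_op_scaleC cinner_commute cinner_symI pos_op_sym)
  then show "positive_op S"
    using S by (auto simp: positive_op_def pos_op_def complex_is_Real_iff inner_eq_Re_cinner dest: arg_cong[of _ _ Im])
      (metis Reals_cnj_iff complex_is_Real_iff)
qed

text \<open>Multiplication by \<open>\<i>\<close> commutes with \<open>A\<close>, so the real square
  root is complex linear and is the operator that \<open>THE\<close> describes.\<close>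

lemma op_sqrt_props:
  fixes A :: "'a::{complex_inner,complete_space} \<Rightarrow> 'a"
  assumes A: "pos_op A" and i: "\<And>x. A (\<i> *\<^sub>C x) = \<i> *\<^sub>C A x"
  shows "bounded_op UNIV UNIV (op_sqrt A)" "pos_op (op_sqrt A)" "op_sqrt A (op_sqrt A x) = A x"
    "bounded_linear T \<Longrightarrow> commutes T A \<Longrightarrow> commutes T (op_sqrt A)"
proof -
  obtain S where S: "pos_op S" "\<And>x. S (S x) = A x" "\<And>T. bounded_linear T \<Longrightarrow> commutes T A \<Longrightarrow> commutes T S"
    using pos_op_sqrt_exists[OF A] by blast
  have "commutes (scaleC \<i>) S" by (rule S) (auto simp: bounded_linear_scaleC commutes_def i)
  then have "bounded_op UNIV UNIV S"
    using S(1) by (simp add: bounded_op_UNIV_iff commutes_def pos_op_sym sym_op_bl)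
  moreover have "op_sqrt A = S"
    unfolding op_sqrt_def
  proof (rule the_equality)
    show "positive_op S \<and> S \<circ> S = A" using S calculation by (auto simp: positive_op_iff)
    fix S' assume "positive_op S' \<and> S' \<circ> S' = A"
    then show "S' = S" using S(1,2) by (intro pos_op_sqrt_unique) (auto simp: positive_op_iff)
  qed
  ultimately show "bounded_op UNIV UNIV (op_sqrt A)" "pos_op (op_sqrt A)" "op_sqrt A (op_sqrt A x) = A x"
    "bounded_linear T \<Longrightarrow> commutes T A \<Longrightarrow> commutes T (op_sqrt A)"
    using S by auto
qed

lemma defect_props:
  fixes X :: "'a::{complex_inner,complete_space} \<Rightarrow> 'b::complex_inner"
  assumes X: "contraction X"
  shows "bounded_op UNIV UNIV (defect X)" "pos_op (defect X)"
    "defect X (defect X x) = x - adj UNIV X (X x)"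
    "bounded_linear T \<Longrightarrow> commutes T (\<lambda>x. adj UNIV X (X x)) \<Longrightarrow> commutes T (defect X)"
proof -
  let ?A = "\<lambda>f. f - adj UNIV X (X f)"
  have b: "bounded_op UNIV UNIV X" and c: "\<And>x. norm (X x) \<le> norm x" using X by (auto simp: contraction_def)
  note adj = adj_UNIV[OF b]
  have "sym_op (\<lambda>f. adj UNIV X (X f))"
  proof (rule sym_opI)
    show "bounded_linear (\<lambda>f. adj UNIV X (X f))"
      by (rule bounded_linear_compose[OF bounded_op_linear[OF adj(3)] bounded_op_linear[OF b]])
    show "inner (adj UNIV X (X f)) g = inner f (adj UNIV X (X g))" for f g
      by (metis adj(2) inner_commute)
  qed
  then have "sym_op ?A" by (intro sym_op_diff sym_op_id)
  moreover have "0 \<le> inner (?A f) f" for f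
  proof -
    have "inner (?A f) f = (norm f)\<^sup>2 - (norm (X f))\<^sup>2"
      by (simp add: inner_diff_left inner_commute[of "adj UNIV X _"] adj(2)[symmetric] power2_norm_eq_inner)
    then show ?thesis using c[of f] by (simp add: power_mono)
  qed
  ultimately have A: "pos_op ?A" by (simp add: pos_op_def)
  have i: "?A (\<i> *\<^sub>C x) = \<i> *\<^sub>C ?A x" for x
    by (simp add: bounded_op_scaleC[OF b] bounded_op_scaleC[OF adj(3)] complex_vector.scale_right_diff_distrib)
  note * = op_sqrt_props[OF A i, folded defect_def]
  show "bounded_op UNIV UNIV (defect X)" "pos_op (defect X)" "defect X (defect X x) = x - adj UNIV X (X x)"
    by (rule *)+
  show "commutes T (defect X)" if T: "bounded_linear T" "commutes T (\<lambda>x. adj UNIV X (X x))"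
    by (rule *(4)[OF T(1)]) (use T in \<open>simp add: commutes_def linear_diff bounded_linear.linear\<close>)
qed

lemma defect_norm:
  fixes X :: "'a::{complex_inner,complete_space} \<Rightarrow> 'b::complex_inner"
  assumes X: "contraction X"
  shows "(norm (defect X x))\<^sup>2 = (norm x)\<^sup>2 - (norm (X x))\<^sup>2"
proof -
  have b: "bounded_op UNIV UNIV X" using X by (simp add: contraction_def)
  have "(norm (defect X x))\<^sup>2 = inner (defect X (defect X x)) x"
    by (simp add: power2_norm_eq_inner sym_op_inner[OF pos_op_sym[OF defect_props(2)[OF X]], of "defect X x"])
  then show ?thesis
    by (simp add: defect_props(3)[OF X] inner_diff_left inner_commute[of "adj UNIV X _"]
        adj_UNIV(2)[OF b, symmetric] power2_norm_eq_inner)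
qed

lemma adj_contraction:
  fixes V :: "'a::{complex_inner,complete_space} \<Rightarrow> 'b::{complex_inner,complete_space}"
  assumes V: "contraction V"
  shows "contraction (adj UNIV V)" "adj UNIV (adj UNIV V) = V"
proof -
  have b: "bounded_op UNIV UNIV V" and c: "\<And>x. norm (V x) \<le> norm x" using V by (auto simp: contraction_def)
  have "norm (adj UNIV V g) \<le> norm g" for g
  proof -
    let ?h = "adj UNIV V g"
    have "norm ?h * norm ?h = inner (V ?h) g" by (simp add: adj_UNIV(2)[OF b] dot_square_norm power2_eq_square)
    also have "\<dots> \<le> norm (V ?h) * norm g" by (rule norm_cauchy_schwarz)
    also have "\<dots> \<le> norm ?h * norm g" using c by (intro mult_right_mono) auto
    finally show ?thesis by (cases "?h = 0") (auto simp: mult_le_cancel_left_pos)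
  qed
  then show "contraction (adj UNIV V)" using adj_UNIV(3)[OF b] by (simp add: contraction_def)
  show "adj UNIV (adj UNIV V) = V"
  proof
    show "adj UNIV (adj UNIV V) x = V x" for x
    proof (rule adj_eqI)
      show "cinner (adj UNIV V f) x = cinner f (V x)" for f
        by (metis adj_UNIV(1)[OF b] cinner_commute)
    qed auto
  qed
qed

section \<open>Defect spaces as closures of ranges\<close>

lemma csubspace_closure:
  fixes S :: "'a::complex_inner set"
  assumes S: "complex_vector.subspace S"
  shows "complex_vector.subspace (closure S)"
  unfolding complex_vector.subspace_def
proof (intro conjI ballI allI)
  show "0 \<in> closure S" using complex_vector.subspace_0[OF S] closure_subset by blast
  fix x assume "x \<in> closure S"
  then obtain u where u: "\<And>n. u n \<in> S" "u \<longlonglongrightarrow> x" unfolding closure_sequential by blast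
  show "c *\<^sub>C x \<in> closure S" for c
    unfolding closure_sequential using u complex_vector.subspace_scale[OF S]
    by (intro exI[of _ "\<lambda>n. c *\<^sub>C u n"]) (auto intro: tendsto_scaleC)
  fix y assume "y \<in> closure S"
  then obtain v where v: "\<And>n. v n \<in> S" "v \<longlonglongrightarrow> y" unfolding closure_sequential by blast
  show "x + y \<in> closure S"
    unfolding closure_sequential using u v complex_vector.subspace_add[OF S]
    by (intro exI[of _ "\<lambda>n. u n + v n"]) (auto intro: tendsto_add)
qed

lemma csubspace_range:
  assumes X: "bounded_op UNIV UNIV X"
  shows "complex_vector.subspace (range X)"
  unfolding complex_vector.subspace_def
proof (intro conjI ballI allI)
  show "0 \<in> range X" using bounded_op_scaleC[OF X UNIV_I, of 0 0] by (metis complex_vector.scale_zero_left rangeI)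
  show "x + y \<in> range X" if "x \<in> range X" "y \<in> range X" for x y
    using that bounded_op_add[OF X UNIV_I UNIV_I, symmetric] by auto
  show "a *\<^sub>C x \<in> range X" if "x \<in> range X" for a x
    using that bounded_op_scaleC[OF X UNIV_I, symmetric] by auto
qed

lemma defect_space_closed_subspace:
  fixes X :: "'a::{complex_inner,complete_space} \<Rightarrow> 'b::complex_inner"
  assumes X: "contraction X"
  shows "closed (defect_space X)" "complex_vector.subspace (defect_space X)" "defect X x \<in> defect_space X"
proof -
  show "complex_vector.subspace (defect_space X)"
    unfolding defect_space_def by (intro csubspace_closure csubspace_range defect_props X)
  show "closed (defect_space X)" by (simp add: defect_space_def)
  show "defect X x \<in> defect_space X" unfolding defect_space_def using subsetD[OF closure_subset rangeI] .
qed

text \<open>The residual of \<open>y\<close> is orthogonal to the range, so the symmetric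
  \<open>D\<close> kills it; the hypothesis then makes it orthogonal to \<open>y\<close> as well,
  hence zero.\<close>

lemma kernel_complement_in_closure_range:
  fixes D :: "'a::{complex_inner,complete_space} \<Rightarrow> 'a"
  assumes b: "bounded_op UNIV UNIV D" and D: "sym_op D" and y: "\<And>z. D z = 0 \<Longrightarrow> inner y z = 0"
  shows "y \<in> closure (range D)"
proof -
  let ?M = "closure (range D)"
  have M: "closed ?M" "subspace ?M"
    by (auto intro: csubspace_subspace csubspace_closure csubspace_range b)
  let ?z = "y - proj ?M y"
  have rng: "D x \<in> ?M" for x using subsetD[OF closure_subset rangeI] .
  have z: "inner ?z (D x) = 0" for x by (rule proj_orth[OF M rng])
  have Dz: "D ?z = 0" using z[of "D ?z"] sym_op_inner[OF D, of ?z "D ?z"] by (metis inner_eq_zero_iff)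
  have "inner (proj ?M y) ?z = 0" using proj_orth[OF M proj_in[OF M], of y y] by (simp add: inner_commute)
  then have "inner ?z ?z = 0" using y[OF Dz] by (simp add: inner_diff_left)
  then show ?thesis using proj_in[OF M, of y] by simp
qed

lemma closure_approx: "x \<in> closure S \<Longrightarrow> e > 0 \<Longrightarrow> \<exists>y\<in>S. norm (y - x) < e"
  for x :: "'a::real_normed_vector"
  by (auto simp: closure_approachable dist_norm)

lemma bounded_op_tendsto:
  assumes X: "bounded_op M N X" and M: "complex_vector.subspace M"
    and u: "\<And>n. u n \<in> M" "u \<longlonglongrightarrow> x" and x: "x \<in> M"
  shows "(\<lambda>n. X (u n)) \<longlonglongrightarrow> X x"
proof -
  obtain c where c: "c \<ge> 0" "\<And>x. x \<in> M \<Longrightarrow> norm (X x) \<le> c * norm x" using bounded_op_bound[OF X] by blast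
  have d: "u n - x \<in> M" for n using u x M by (simp add: complex_vector.subspace_diff)
  have "X (u n) - X x = X (u n - x)" for n using bounded_op_add[OF X d[of n] x] by simp
  then have "norm (X (u n) - X x) \<le> c * norm (u n - x)" for n using c(2)[OF d[of n]] by simp
  moreover have "(\<lambda>n. c * norm (u n - x)) \<longlonglongrightarrow> 0"
    using tendsto_mult_right_zero[OF tendsto_norm_zero[OF LIM_zero[OF u(2)]]] .
  ultimately have "(\<lambda>n. X (u n) - X x) \<longlonglongrightarrow> 0"
    by (rule_tac Lim_null_comparison) auto
  then show ?thesis by (rule LIM_zero_cancel)
qed

lemma norm_add_square: "(norm (u + v :: 'a::real_inner))\<^sup>2 = (norm u)\<^sup>2 + 2 * inner u v + (norm v)\<^sup>2"
  and norm_diff_square: "(norm (u - v :: 'a::real_inner))\<^sup>2 = (norm u)\<^sup>2 - 2 * inner u v + (norm v)\<^sup>2"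
  using norm_add_scaleR_square[of u 1 v] norm_add_scaleR_square[of u "-1" v] by (simp_all add: power2_norm_eq_inner)

lemma bounded_op_cscale:
  assumes X: "bounded_op M N X" and N: "complex_vector.subspace N"
  shows "bounded_op M N (\<lambda>x. a *\<^sub>C X x)"
proof -
  obtain c where c: "\<And>x. x \<in> M \<Longrightarrow> norm (X x) \<le> c * norm x" using bounded_op_bound[OF X] by blast
  have "norm (a *\<^sub>C X x) \<le> (norm a * c) * norm x" if "x \<in> M" for x
    using mult_left_mono[OF c[OF that], of "norm a"] by (simp add: mult.assoc)
  then have "\<exists>c. \<forall>x\<in>M. norm (a *\<^sub>C X x) \<le> c * norm x" by blast
  then show ?thesis
    using X N by (simp add: bounded_op_def complex_vector.subspace_scale scaleC_add_right scaleC_scaleC mult.commute)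
qed

lemma bounded_op_plus:
  assumes X: "bounded_op M N X" and Y: "bounded_op M N Y" and N: "complex_vector.subspace N"
  shows "bounded_op M N (\<lambda>x. X x + Y x)"
proof -
  obtain c where c: "\<And>x. x \<in> M \<Longrightarrow> norm (X x) \<le> c * norm x" using bounded_op_bound[OF X] by blast
  obtain d where d: "\<And>x. x \<in> M \<Longrightarrow> norm (Y x) \<le> d * norm x" using bounded_op_bound[OF Y] by blast
  have "norm (X x + Y x) \<le> (c + d) * norm x" if "x \<in> M" for x
    using norm_triangle_ineq[of "X x" "Y x"] c[OF that] d[OF that] by (simp add: distrib_right)
  then have "\<exists>c. \<forall>x\<in>M. norm (X x + Y x) \<le> c * norm x" by blast
  then show ?thesis
    using X Y N by (simp add: bounded_op_def complex_vector.subspace_add scaleC_add_right)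
qed

section \<open>Block operators\<close>

text \<open>Here \<open>s\<close> and \<open>c\<close> stand for \<open>sin \<phi>\<close> and plus
  or minus \<open>cos \<phi>\<close>. With \<open>B = s A + i c\<close> and its adjoint
  \<open>B' = s A - i c\<close>, the entries of \<open>X\<close> are \<open>B\<close>,
  \<open>s D U\<close>, \<open>s V D\<close> and \<open>- V B' U + Dv K' Du\<close>: the usual
  parametrization of contractive block operators, but with any bounded \<open>K'\<close>.\<close>

context
  fixes A :: "'a::{complex_inner,complete_space} \<Rightarrow> 'a" and V :: "'a \<Rightarrow> 'b::{complex_inner,complete_space}" and U :: "'b \<Rightarrow> 'a"
    and K' :: "'b \<Rightarrow> 'b" and s c :: real and X :: "'a \<times> 'b \<Rightarrow> 'a \<times> 'b"
  assumes A: "contraction A" "adj UNIV A = A"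
    and V: "contraction V" "\<And>f. defect A f = 0 \<Longrightarrow> V f = 0"
    and U: "contraction U" "\<And>f. defect A f = 0 \<Longrightarrow> adj UNIV U f = 0"
    and sc: "s\<^sup>2 + c\<^sup>2 = 1" "s \<noteq> 0"
    and K': "bounded_op (defect_space U) (defect_space (adj UNIV V)) K'"
    and X: "\<And>f h. X (f, h) = (s *\<^sub>R A f + (\<i> * c) *\<^sub>C f + s *\<^sub>R defect A (U h),
      V (s *\<^sub>R defect A f - (s *\<^sub>R A (U h) - (\<i> * c) *\<^sub>C U h)) + defect (adj UNIV V) (K' (defect U h)))"
    and Xb: "bounded_op UNIV UNIV X"
begin

abbreviation (input) "D \<equiv> defect A"
abbreviation (input) "Dv \<equiv> defect (adj UNIV V)"
abbreviation (input) "Du \<equiv> defect U"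

definition row_input :: "'a \<times> 'b \<Rightarrow> 'a" where
  "row_input p = s *\<^sub>R D (fst p) - (s *\<^sub>R A (U (snd p)) - (\<i> * c) *\<^sub>C U (snd p))"

text \<open>The defect form of the row \<open>(V, Dv)\<close>, that is, the squared distance of
  \<open>(a, b)\<close> from the range of the adjoint row, which sends \<open>g\<close> to
  \<open>(adj UNIV V g, Dv g)\<close>.\<close>

definition row_gap :: "'a \<Rightarrow> 'b \<Rightarrow> real" where
  "row_gap a b = (norm a)\<^sup>2 + (norm b)\<^sup>2 - (norm (V a + Dv b))\<^sup>2"

lemma block_bounded_ops: "bounded_op UNIV UNIV A" "bounded_op UNIV UNIV V" "bounded_op UNIV UNIV U"
  "bounded_op UNIV UNIV D" "bounded_op UNIV UNIV Dv" "bounded_op UNIV UNIV Du" "bounded_op UNIV UNIV (adj UNIV V)"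
  using A(1) V(1) U(1) adj_contraction[OF V(1)] by (simp_all add: contraction_def defect_props)

lemma block_sym: "inner (A f) g = inner f (A g)"
  using adj_UNIV(2)[OF block_bounded_ops(1)] A(2) by simp

lemma defect_sym: "inner (D f) g = inner f (D g)"
  by (intro sym_op_inner pos_op_sym defect_props A)

lemma defect_commutes: "D (A f) = A (D f)"
proof -
  have "commutes A D" by (rule defect_props(4)[OF A(1) bounded_op_linear[OF block_bounded_ops(1)]]) (simp add: A commutes_def)
  then show ?thesis by (simp add: commutes_def)
qed

lemma defect_adj_props: "inner (Dv g) k = inner g (Dv k)" "V (adj UNIV V g) + Dv (Dv g) = g"
  using sym_op_inner[OF pos_op_sym[OF defect_props(2)[OF adj_contraction(1)[OF V(1)]]]]
    defect_props(3)[OF adj_contraction(1)[OF V(1)], of g] adj_contraction(2)[OF V(1)] by auto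

lemma inner_adj: "inner (V f) g = inner f (adj UNIV V g)"
  by (rule adj_UNIV(2)[OF block_bounded_ops(2)])

text \<open>The row \<open>(V, D\<^bsub>V*\<^esub>)\<close> is a coisometry.\<close>

lemma row_gap_nonneg: "0 \<le> row_gap a b"
proof -
  let ?y = "V a + Dv b"
  have 1: "inner a (adj UNIV V ?y) + inner b (Dv ?y) = (norm ?y)\<^sup>2"
    by (simp add: inner_adj[symmetric] defect_adj_props(1)[symmetric] power2_norm_eq_inner inner_add_left)
  have 2: "(norm (adj UNIV V ?y))\<^sup>2 + (norm (Dv ?y))\<^sup>2 = (norm ?y)\<^sup>2"
    using arg_cong[OF defect_adj_props(2)[of ?y], of "\<lambda>z. inner z ?y"]
    by (simp add: power2_norm_eq_inner inner_adj defect_adj_props(1) inner_add_left[of "V (adj UNIV V ?y)"])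
  have regroup: "(x1 - 2 * x2 + x3) + (y1 - 2 * y2 + y3) = x1 + y1 - 2 * (x2 + y2) + (x3 + y3)"
    for x1 x2 x3 y1 y2 y3 :: real by simp
  \<comment> \<open>The gap equals the squared distance of \<open>(a, b)\<close> from the value of
    the adjoint row at \<open>?y\<close>.\<close>
  have "0 \<le> (norm (a - adj UNIV V ?y))\<^sup>2 + (norm (b - Dv ?y))\<^sup>2" by simp
  also have "\<dots> = (norm a)\<^sup>2 + (norm b)\<^sup>2 - 2 * (inner a (adj UNIV V ?y) + inner b (Dv ?y))
      + ((norm (adj UNIV V ?y))\<^sup>2 + (norm (Dv ?y))\<^sup>2)"
    unfolding norm_diff_square by (rule regroup)
  also have "\<dots> = row_gap a b" unfolding 1 2 by (simp add: row_gap_def)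
  finally show ?thesis .
qed

text \<open>The adjoint row is isometric, so subtracting its value at \<open>g\<close> from
  \<open>(a, b)\<close> leaves the gap unchanged; the gap of the remainder is at most its squared
  norm.\<close>

lemma row_gap_le: "row_gap a b \<le> (norm (a - adj UNIV V g))\<^sup>2 + (norm (b - Dv g))\<^sup>2"
proof -
  define e1 where "e1 = a - adj UNIV V g"
  define e2 where "e2 = b - Dv g"
  interpret V: bounded_linear V by (intro bounded_op_linear block_bounded_ops)
  interpret Dv: bounded_linear Dv by (intro bounded_op_linear block_bounded_ops)
  let ?Ce = "V e1 + Dv e2"
  have y: "V a + Dv b = g + ?Ce"
    using defect_adj_props(2)[of g] by (simp add: e1_def e2_def V.diff Dv.diff algebra_simps)
  have a: "a = adj UNIV V g + e1" and b: "b = Dv g + e2" by (simp_all add: e1_def e2_def)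
  have g: "(norm (adj UNIV V g))\<^sup>2 + (norm (Dv g))\<^sup>2 = (norm g)\<^sup>2"
    using arg_cong[OF defect_adj_props(2)[of g], of "\<lambda>z. inner z g"]
    by (simp add: power2_norm_eq_inner inner_adj defect_adj_props(1) inner_add_left)
  have x: "inner (adj UNIV V g) e1 + inner (Dv g) e2 = inner g ?Ce"
    using inner_adj[of e1 g] by (simp only: defect_adj_props(1) inner_add_right inner_commute[of g "V e1"] inner_commute[of _ e1])
  have "row_gap a b = ((norm (adj UNIV V g))\<^sup>2 + (norm (Dv g))\<^sup>2) - (norm g)\<^sup>2
     + 2 * (inner (adj UNIV V g) e1 + inner (Dv g) e2) - 2 * inner g ?Ce
     + (norm e1)\<^sup>2 + (norm e2)\<^sup>2 - (norm ?Ce)\<^sup>2"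
    unfolding row_gap_def y norm_add_square[of g] unfolding a b norm_add_square by simp
  also have "\<dots> \<le> (norm e1)\<^sup>2 + (norm e2)\<^sup>2" unfolding g x by simp
  finally show ?thesis by (simp add: e1_def e2_def)
qed

text \<open>The matrix with rows \<open>(B, s D)\<close> and \<open>(s D, - B')\<close> is
  isometric, a Halmos dilation of \<open>B\<close>. Applied to \<open>f\<close> and
  \<open>U h\<close> it produces the first component of \<open>X p\<close> and the vector
  \<open>row_input p\<close>; what remains is the defect of \<open>U\<close> at \<open>h\<close> and
  the gap of the row.\<close>

lemma form_decomposition:
  "(norm p)\<^sup>2 - (norm (X p))\<^sup>2
    = ((norm (Du (snd p)))\<^sup>2 - (norm (K' (Du (snd p))))\<^sup>2) + row_gap (row_input p) (K' (Du (snd p)))"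
proof -
  obtain f h where p: "p = (f, h)" by (cases p)
  define u where "u = U h"
  define k where "k = K' (Du h)"
  define B where "B f = s *\<^sub>R A f + (\<i> * c) *\<^sub>C f" for f
  define B' where "B' f = s *\<^sub>R A f - (\<i> * c) *\<^sub>C f" for f
  have ic: "(\<i> * complex_of_real c) *\<^sub>C f = c *\<^sub>R (\<i> *\<^sub>C f)" for f :: 'a
    by (simp add: scaleR_scaleC scaleC_scaleC mult.commute)
  have BB: "inner (B f) g = inner f (B' g)" for f g
    by (simp add: B_def B'_def ic inner_add_left inner_diff_right block_sym inner_scaleC_i)
  \<comment> \<open>\<open>A\<close> is symmetric and commutes with \<open>\<i>\<close>, so the
    cross term in the norm of \<open>B f\<close> vanishes.\<close>
  have skew: "inner (A f) (\<i> *\<^sub>C f) = 0" for f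
  proof -
    have "inner (A f) (\<i> *\<^sub>C f) = inner f (\<i> *\<^sub>C A f)" by (simp add: block_sym bounded_op_scaleC[OF block_bounded_ops(1)])
    also have "\<dots> = - inner (A f) (\<i> *\<^sub>C f)" by (metis inner_commute inner_scaleC_i minus_minus)
    finally show ?thesis by simp
  qed
  have Af: "(norm (A f))\<^sup>2 = (norm f)\<^sup>2 - (norm (D f))\<^sup>2" for f using defect_norm[OF A(1), of f] by simp
  have nB: "(norm (B f))\<^sup>2 = (norm f)\<^sup>2 - s\<^sup>2 * (norm (D f))\<^sup>2"
    and nB': "(norm (B' f))\<^sup>2 = (norm f)\<^sup>2 - s\<^sup>2 * (norm (D f))\<^sup>2" for f
  proof -
    have "(norm (B f))\<^sup>2 = s\<^sup>2 * (norm (A f))\<^sup>2 + c\<^sup>2 * (norm f)\<^sup>2"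
      "(norm (B' f))\<^sup>2 = s\<^sup>2 * (norm (A f))\<^sup>2 + c\<^sup>2 * (norm f)\<^sup>2"
      by (simp_all add: B_def B'_def ic norm_add_square norm_diff_square skew power_mult_distrib)
    moreover have "s\<^sup>2 * (norm (A f))\<^sup>2 + c\<^sup>2 * (norm f)\<^sup>2 = (s\<^sup>2 + c\<^sup>2) * (norm f)\<^sup>2 - s\<^sup>2 * (norm (D f))\<^sup>2"
      by (simp add: Af algebra_simps)
    ultimately show "(norm (B f))\<^sup>2 = (norm f)\<^sup>2 - s\<^sup>2 * (norm (D f))\<^sup>2"
      "(norm (B' f))\<^sup>2 = (norm f)\<^sup>2 - s\<^sup>2 * (norm (D f))\<^sup>2" by (simp_all add: sc)
  qed
  have DB: "B' (D u) = D (B' u)"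
    using bounded_op_linear[OF block_bounded_ops(4)]
    by (simp add: B'_def defect_commutes linear_diff linear_scale bounded_linear.linear bounded_op_scaleC[OF block_bounded_ops(4)])
  \<comment> \<open>The cross terms cancel because \<open>D\<close> commutes with \<open>A\<close>
    and therefore with \<open>B'\<close>.\<close>
  have rot: "(norm (B f + s *\<^sub>R D u))\<^sup>2 + (norm (s *\<^sub>R D f - B' u))\<^sup>2 = (norm f)\<^sup>2 + (norm u)\<^sup>2"
  proof -
    have "inner (B f) (D u) = inner (D f) (B' u)" by (simp add: BB DB defect_sym)
    then show ?thesis by (simp add: norm_add_square norm_diff_square nB nB' power_mult_distrib)
  qed
  have Xp: "X p = (B f + s *\<^sub>R D u, V (row_input p) + Dv k)"
    by (simp add: p X row_input_def B_def u_def k_def)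
  have wp: "row_input p = s *\<^sub>R D f - B' u" by (simp add: p row_input_def B'_def u_def)
  have np: "(norm (x, y))\<^sup>2 = (norm x)\<^sup>2 + (norm y)\<^sup>2" for x :: 'a and y :: 'b
    by (simp add: norm_Pair)
  have "(norm p)\<^sup>2 - (norm (X p))\<^sup>2 = (norm f)\<^sup>2 + (norm h)\<^sup>2 - (norm (B f + s *\<^sub>R D u))\<^sup>2 - (norm (V (row_input p) + Dv k))\<^sup>2"
    unfolding Xp np by (simp add: p np)
  also have "\<dots> = (norm h)\<^sup>2 - (norm u)\<^sup>2 + (norm (row_input p))\<^sup>2 - (norm (V (row_input p) + Dv k))\<^sup>2"
    using rot by (simp add: wp)
  also have "\<dots> = (norm (Du h))\<^sup>2 - (norm k)\<^sup>2 + row_gap (row_input p) k"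
    by (simp add: row_gap_def defect_norm[OF U(1)] u_def)
  finally show ?thesis by (simp add: p k_def)
qed

text \<open>The order of choices matters: \<open>h\<close> from \<open>x\<close>, then
  \<open>g\<close> from \<open>K' (Du h)\<close>, then \<open>f\<close> from both, since
  \<open>row_input\<close> contains \<open>U h\<close> and has to approach
  \<open>adj UNIV V g\<close>.\<close>

lemma small_row_gap:
  assumes x: "x \<in> defect_space U" and e: "e > 0"
  shows "\<exists>p g. norm (Du (snd p) - x) < e \<and> norm (row_input p - adj UNIV V g) < e \<and> norm (K' (Du (snd p)) - Dv g) < e"
proof -
  obtain h where h: "norm (Du h - x) < e"
    using closure_approx[OF x[unfolded defect_space_def] e] by blast
  have "K' (Du h) \<in> defect_space (adj UNIV V)"
    by (rule bounded_op_in[OF K' defect_space_closed_subspace(3)[OF U(1)]])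
  from closure_approx[OF this[unfolded defect_space_def] e]
  obtain g where g: "norm (Dv g - K' (Du h)) < e" by blast
  \<comment> \<open>The value that \<open>s D f\<close> would need for \<open>row_input\<close> to
    equal \<open>adj UNIV V g\<close>.\<close>
  define y where "y = (s *\<^sub>R A (U h) - (\<i> * c) *\<^sub>C U h) + adj UNIV V g"
  have "y \<in> closure (range D)"
  proof (rule kernel_complement_in_closure_range)
    show "bounded_op UNIV UNIV D" "sym_op D" by (intro pos_op_sym defect_props A)+
    fix z assume z: "D z = 0"
    \<comment> \<open>Stated for every kernel vector because it is also applied to
      \<open>A z\<close> and \<open>\<i> *\<^sub>C z\<close>; the kernel of \<open>D\<close> is
      invariant under both.\<close>
    have Uz: "inner (U h) z = 0" if "D z = 0" for z
      using U(2)[OF that] by (simp add: adj_UNIV(2)[OF block_bounded_ops(3)])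
    have "D (A z) = 0" using defect_commutes[of z] z bounded_linear.linear[OF bounded_op_linear[OF block_bounded_ops(1)]] by (simp add: linear_0)
    moreover have "D (\<i> *\<^sub>C z) = 0" using z by (simp add: bounded_op_scaleC[OF block_bounded_ops(4)])
    moreover have "(\<i> * complex_of_real c) *\<^sub>C f = c *\<^sub>R (\<i> *\<^sub>C f)" for f :: 'a
      by (simp add: scaleR_scaleC scaleC_scaleC mult.commute)
    moreover have "inner (adj UNIV V g) z = 0"
      using inner_adj[of z g] V(2)[OF z] by (simp add: inner_commute)
    ultimately show "inner y z = 0"
      by (simp add: y_def inner_add_left inner_diff_left block_sym inner_scaleC_i Uz)
  qed
  then obtain f where f: "norm (D f - y) < e" using closure_approx[OF _ e] by blast
  have "row_input (inverse s *\<^sub>R f, h) - adj UNIV V g = D f - y"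
    using sc(2) by (simp add: row_input_def y_def bounded_op_scaleR[OF block_bounded_ops(4)])
  then show ?thesis
    using h g f by (intro exI[of _ "(inverse s *\<^sub>R f, h)"] exI[of _ g]) (simp add: norm_minus_commute)
qed

lemma row_input_bounded_op: "bounded_op UNIV UNIV row_input"
proof -
  note comp = bounded_linear_compose[OF bounded_op_linear]
  note 1 = comp[OF block_bounded_ops(4) bounded_linear_fst] and 2 = comp[OF block_bounded_ops(3) bounded_linear_snd]
  have "bounded_linear row_input"
    unfolding row_input_def[abs_def]
    by (rule bounded_linear_sub[OF bounded_linear_const_scaleR[OF 1] bounded_linear_sub[OF
            bounded_linear_const_scaleR[OF comp[OF block_bounded_ops(1) 2]] bounded_linear_compose[OF bounded_linear_scaleC 2]]])
  moreover have "row_input (\<i> *\<^sub>C p) = \<i> *\<^sub>C row_input p" for p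
    by (simp add: row_input_def scaleC_prod_def bounded_op_scaleC[OF block_bounded_ops(4)] bounded_op_scaleC[OF block_bounded_ops(1)]
        bounded_op_scaleC[OF block_bounded_ops(3)] complex_vector.scale_right_diff_distrib scaleC_scaleR[symmetric]
        scaleC_scaleC mult.commute)
  ultimately show ?thesis by (simp add: bounded_op_UNIV_iff)
qed

text \<open>One inequality uses the exact map from \<open>p\<close> to \<open>Du (snd p)\<close>,
  which can only lower the form. The other approximates, on finitely many vectors at a time, a map
  in the opposite direction along which the gap tends to zero.\<close>

lemma kappa_minus_block:
  "kappa_minus UNIV (\<lambda>f. f - adj UNIV X (X f))
    = kappa_minus (defect_space U) (\<lambda>f. f - adj (defect_space U) K' (K' f))"
proof -
  note H1 = defect_space_closed_subspace[OF U(1)]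
  let ?q = "\<lambda>x. (norm x)\<^sup>2 - (norm (X x))\<^sup>2" and ?q' = "\<lambda>x. (norm x)\<^sup>2 - (norm (K' x))\<^sup>2"
  obtain L P where L: "negative_splitting UNIV ?q L P"
    "kappa_minus UNIV (\<lambda>f. f - adj UNIV X (X f)) = ecdim L"
    using kappa_minus_splitting[OF closed_UNIV complex_vector.subspace_UNIV Xb] by blast
  obtain L' P' where L': "negative_splitting (defect_space U) ?q' L' P'"
    "kappa_minus (defect_space U) (\<lambda>f. f - adj (defect_space U) K' (K' f)) = ecdim L'"
    using kappa_minus_splitting[OF H1(1,2) K'] by blast
  have qlim: "(\<lambda>n. ?q' (u n)) \<longlonglongrightarrow> ?q' x"
    if "\<And>n. u n \<in> defect_space U" "u \<longlonglongrightarrow> x" "x \<in> defect_space U" for u x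
    by (intro tendsto_intros that bounded_op_tendsto[OF K' H1(2)])
  have Dusum: "Du (snd (\<Sum>b\<in>C. d b *\<^sub>C g b)) = (\<Sum>b\<in>C. d b *\<^sub>C Du (snd (g b)))" for C :: "'i set" and d and g :: "'i \<Rightarrow> 'a \<times> 'b"
  proof -
    have "snd (\<Sum>b\<in>C. d b *\<^sub>C g b) = (\<Sum>b\<in>C. d b *\<^sub>C snd (g b))"
      by (simp add: snd_sum scaleC_prod_def)
    then show ?thesis using bounded_op_sum[OF block_bounded_ops(6) complex_vector.subspace_UNIV, of C "\<lambda>b. snd (g b)" d] by simp
  qed
  have "ecdim L \<le> ecdim L'"
  proof (rule negative_splitting_ecdim_le[OF L'(1) L(1)])
    fix C :: "('a \<times> 'b) set" assume C: "finite C"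
    show "\<exists>G :: nat \<Rightarrow> 'a \<times> 'b \<Rightarrow> 'b. (\<forall>k. \<forall>b\<in>C. G k b \<in> defect_space U) \<and>
      (\<forall>r d d0. strict_mono r \<longrightarrow> (\<forall>b\<in>C. (\<lambda>k. d k b) \<longlonglongrightarrow> d0 b) \<longrightarrow>
        (\<exists>l \<le> ?q (\<Sum>b\<in>C. d0 b *\<^sub>C b). (\<lambda>k. ?q' (\<Sum>b\<in>C. d k b *\<^sub>C G (r k) b)) \<longlonglongrightarrow> l))"
    \<comment> \<open>In this direction the family is constant in \<open>k\<close>.\<close>
    proof (rule exI[of _ "\<lambda>k b. Du (snd b)"], intro conjI allI impI ballI)
      fix d :: "nat \<Rightarrow> 'a \<times> 'b \<Rightarrow> complex" and d0 assume d: "\<forall>b\<in>C. (\<lambda>k. d k b) \<longlonglongrightarrow> d0 b"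
      let ?p = "\<Sum>b\<in>C. d0 b *\<^sub>C b"
      have "(\<lambda>k. \<Sum>b\<in>C. d k b *\<^sub>C Du (snd b)) \<longlonglongrightarrow> (\<Sum>b\<in>C. d0 b *\<^sub>C Du (snd b))"
        using d by (intro tendsto_sum tendsto_scaleC) auto
      then have "(\<lambda>k. ?q' (\<Sum>b\<in>C. d k b *\<^sub>C Du (snd b))) \<longlonglongrightarrow> ?q' (Du (snd ?p))"
        unfolding Dusum by (intro qlim complex_vector.subspace_sum complex_vector.subspace_scale H1)
      moreover have "?q' (Du (snd ?p)) \<le> ?q ?p"
        using form_decomposition[of ?p] row_gap_nonneg[of "row_input ?p" "K' (Du (snd ?p))"] by simp
      ultimately show "\<exists>l \<le> ?q ?p. (\<lambda>k. ?q' (\<Sum>b\<in>C. d k b *\<^sub>C Du (snd b))) \<longlonglongrightarrow> l" by blast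
    qed (rule H1)
  qed
  moreover have "ecdim L' \<le> ecdim L"
  proof (rule negative_splitting_ecdim_le[OF L(1) L'(1)])
    fix C assume C: "finite C" "C \<subseteq> L'"
    then have CH: "b \<in> defect_space U" if "b \<in> C" for b
      using L'(1) that by (auto simp: negative_splitting_def)
    \<comment> \<open>Each approximating vector is kept together with the \<open>g\<close> that
      certifies its small gap. The gap is not linear, but the two error vectors are, so they stay
      small for combinations with convergent coefficients.\<close>
    define R where "R k b pg \<longleftrightarrow> norm (Du (snd (fst pg)) - b) < inverse (Suc k) \<and>
        norm (row_input (fst pg) - adj UNIV V (snd pg)) < inverse (Suc k) \<and>
        norm (K' (Du (snd (fst pg))) - Dv (snd pg)) < inverse (Suc k)" for k :: nat and b and pg :: "('a \<times> 'b) \<times> 'b"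
    have "\<forall>k b. \<exists>pg. b \<in> C \<longrightarrow> R k b pg"
      using small_row_gap[OF CH, of _ "inverse (Suc _)"] unfolding R_def by fastforce
    then obtain F where F: "\<And>k b. b \<in> C \<Longrightarrow> R k b (F k b)" by metis
    define G g where "G k b = fst (F k b)" and "g k b = snd (F k b)" for k b
    have G: "\<And>k b. b \<in> C \<Longrightarrow> norm (Du (snd (G k b)) - b) < inverse (Suc k)"
        "\<And>k b. b \<in> C \<Longrightarrow> norm (row_input (G k b) - adj UNIV V (g k b)) < inverse (Suc k)"
        "\<And>k b. b \<in> C \<Longrightarrow> norm (K' (Du (snd (G k b))) - Dv (g k b)) < inverse (Suc k)"
      using F unfolding R_def G_def g_def by blast+
    have small: "u \<longlonglongrightarrow> 0" if "\<And>k. norm (u k) < inverse (Suc k)" for u :: "nat \<Rightarrow> 'c::real_normed_vector"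
      by (rule Lim_null_comparison[OF _ LIMSEQ_inverse_real_of_nat]) (intro always_eventually allI less_imp_le that)
    show "\<exists>G :: nat \<Rightarrow> 'b \<Rightarrow> 'a \<times> 'b. (\<forall>k. \<forall>b\<in>C. G k b \<in> UNIV) \<and>
      (\<forall>r d d0. strict_mono r \<longrightarrow> (\<forall>b\<in>C. (\<lambda>k. d k b) \<longlonglongrightarrow> d0 b) \<longrightarrow>
        (\<exists>l \<le> ?q' (\<Sum>b\<in>C. d0 b *\<^sub>C b). (\<lambda>k. ?q (\<Sum>b\<in>C. d k b *\<^sub>C G (r k) b)) \<longlonglongrightarrow> l))"
    proof (rule exI[of _ G], intro conjI allI impI ballI UNIV_I)
      fix r :: "nat \<Rightarrow> nat" and d :: "nat \<Rightarrow> 'b \<Rightarrow> complex" and d0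
      assume r: "strict_mono r" and d: "\<forall>b\<in>C. (\<lambda>k. d k b) \<longlonglongrightarrow> d0 b"
      define p where "p k = (\<Sum>b\<in>C. d k b *\<^sub>C G (r k) b)" for k
      define \<gamma> where "\<gamma> k = (\<Sum>b\<in>C. d k b *\<^sub>C g (r k) b)" for k
      define x where "x = (\<Sum>b\<in>C. d0 b *\<^sub>C b)"
      note sums = bounded_op_sum[OF _ complex_vector.subspace_UNIV UNIV_I]
      have lim: "(\<lambda>k. \<Sum>b\<in>C. d k b *\<^sub>C u (r k) b) \<longlonglongrightarrow> (\<Sum>b\<in>C. d0 b *\<^sub>C v b)"
        if "\<And>b. b \<in> C \<Longrightarrow> (\<lambda>k. u k b) \<longlonglongrightarrow> v b" for u :: "nat \<Rightarrow> 'b \<Rightarrow> 'c::complex_inner" and v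
        using d LIMSEQ_subseq_LIMSEQ[OF that r] by (intro tendsto_sum tendsto_scaleC) (auto simp: o_def)
      have xH: "x \<in> defect_space U"
        unfolding x_def by (intro complex_vector.subspace_sum complex_vector.subspace_scale H1 CH)
      have "(\<lambda>k. Du (snd (G k b))) \<longlonglongrightarrow> b" if "b \<in> C" for b
        using small[OF G(1)[OF that]] by (rule LIM_zero_cancel)
      then have Dlim: "(\<lambda>k. Du (snd (p k))) \<longlonglongrightarrow> x"
        unfolding p_def x_def Dusum by (rule lim)
      have Kp: "K' (Du (snd (p k))) = (\<Sum>b\<in>C. d k b *\<^sub>C K' (Du (snd (G (r k) b))))" for k
        unfolding p_def Dusum by (rule bounded_op_sum[OF K' H1(2) H1(3)])
      have "(\<lambda>k. \<Sum>b\<in>C. d k b *\<^sub>C (row_input (G (r k) b) - adj UNIV V (g (r k) b))) \<longlonglongrightarrow> (\<Sum>b\<in>C. d0 b *\<^sub>C 0)"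
        by (rule lim) (rule small[OF G(2)])
      moreover have "(\<Sum>b\<in>C. d k b *\<^sub>C (row_input (G (r k) b) - adj UNIV V (g (r k) b))) = row_input (p k) - adj UNIV V (\<gamma> k)" for k
        by (simp add: p_def \<gamma>_def sums[OF row_input_bounded_op] sums[OF block_bounded_ops(7)] complex_vector.scale_right_diff_distrib sum_subtractf)
      ultimately have e1: "(\<lambda>k. row_input (p k) - adj UNIV V (\<gamma> k)) \<longlonglongrightarrow> 0" by simp
      have "(\<lambda>k. \<Sum>b\<in>C. d k b *\<^sub>C (K' (Du (snd (G (r k) b))) - Dv (g (r k) b))) \<longlonglongrightarrow> (\<Sum>b\<in>C. d0 b *\<^sub>C 0)"
        by (rule lim) (rule small[OF G(3)])
      moreover have "(\<Sum>b\<in>C. d k b *\<^sub>C (K' (Du (snd (G (r k) b))) - Dv (g (r k) b))) = K' (Du (snd (p k))) - Dv (\<gamma> k)" for k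
        by (simp add: Kp \<gamma>_def sums[OF block_bounded_ops(5)] complex_vector.scale_right_diff_distrib sum_subtractf)
      ultimately have e2: "(\<lambda>k. K' (Du (snd (p k))) - Dv (\<gamma> k)) \<longlonglongrightarrow> 0" by simp
      have "(\<lambda>k. (norm (row_input (p k) - adj UNIV V (\<gamma> k)))\<^sup>2 + (norm (K' (Du (snd (p k))) - Dv (\<gamma> k)))\<^sup>2)
          \<longlonglongrightarrow> (norm (0::'a))\<^sup>2 + (norm (0::'b))\<^sup>2"
        by (intro tendsto_intros e1 e2)
      then have "(\<lambda>k. row_gap (row_input (p k)) (K' (Du (snd (p k))))) \<longlonglongrightarrow> 0"
        by (rule_tac tendsto_sandwich[OF _ _ tendsto_const]) (auto intro!: always_eventually row_gap_nonneg row_gap_le)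
      from tendsto_add[OF qlim[OF H1(3) Dlim xH] this]
      have "(\<lambda>k. ?q (p k)) \<longlonglongrightarrow> ?q' x" unfolding form_decomposition by simp
      then show "\<exists>l \<le> ?q' x. (\<lambda>k. ?q (p k)) \<longlonglongrightarrow> l" by blast
    qed
  qed
  ultimately show ?thesis using L(2) L'(2) by simp
qed

end

section \<open>Reduction to the block operator comparison\<close>

theorem corollary4p5:
  fixes T1 T2 :: "'a :: separable_hilbert \<Rightarrow> 'a \<times> 'b :: separable_hilbert"
    and T11 :: "'a \<Rightarrow> 'a" and T12 :: "'b \<Rightarrow> 'a" and T21 :: "'a \<Rightarrow> 'b"
    and V :: "'a \<Rightarrow> 'b" and U :: "'b \<Rightarrow> 'a" and K :: "'b \<Rightarrow> 'b"
    and \<phi> :: real and \<kappa>p \<kappa>m :: nat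
  assumes "dual_pair T1 T2"
    and "bounded_op UNIV UNIV T11" and "bounded_op UNIV UNIV T12" and "bounded_op UNIV UNIV T21"
    and "T1 = (\<lambda>f. (T11 f, T21 f))" and "T2 = (\<lambda>f. (T11 f, adj UNIV T12 f))"
    and "adj UNIV T11 = T11"
    and "contraction V" and "T21 = V \<circ> defect T11"
    and "{f. defect T11 f = 0} \<subseteq> {f. V f = 0}"
    and "contraction U" and "T12 = defect T11 \<circ> U"
    and "{f. defect T11 f = 0} \<subseteq> {f. adj UNIV U f = 0}"
    and "phi1 V U > 0"
    and "\<phi> \<in> {phi1 V U..pi/2}"
    and "bounded_op (defect_space U) (defect_space (adj UNIV V)) K"
  shows "in_C \<phi> \<kappa>p \<kappa>m (T_ext T11 T12 T21 V U K) \<longleftrightarrow>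
    in_C_half_pi (defect_space U) (defect_space (adj UNIV V))
      (\<lambda>x. sin \<phi> *\<^sub>R K x + (\<i> * cos \<phi>) *\<^sub>C Q_op V U x) \<kappa>p \<and>
    in_C_half_pi (defect_space U) (defect_space (adj UNIV V))
      (\<lambda>x. sin \<phi> *\<^sub>R K x - (\<i> * cos \<phi>) *\<^sub>C Q_op V U x) \<kappa>m"
proof -
  let ?H1 = "defect_space U" and ?H2 = "defect_space (adj UNIV V)" and ?Dv = "defect (adj UNIV V)"
  let ?T = "T_ext T11 T12 T21 V U K" and ?Q = "Q_op V U"
  note V = assms(8) and U = assms(11) and K = assms(16)
  have "norm (T11 f) \<le> norm f" for f
  proof -
    have "norm (T1 f) \<le> norm f" using assms(1) by (simp add: dual_pair_def contraction_def)
    moreover have "norm (T11 f) \<le> norm (T1 f)" using norm_fst_le[of "T11 f" "T21 f"] by (simp add: assms(5))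
    ultimately show ?thesis by simp
  qed
  then have T11: "contraction T11" using assms(2) by (simp add: contraction_def)
  note V' = adj_contraction(1)[OF V]
  note H1 = defect_space_closed_subspace[OF U] and H2 = defect_space_closed_subspace[OF V']
  have bV: "bounded_op UNIV UNIV V" and bU: "bounded_op UNIV UNIV U" using V U by (auto simp: contraction_def)
  note bDv = defect_props(1)[OF V'] and bDu = defect_props(1)[OF U]
  interpret V: bounded_linear V using bV by (rule bounded_op_linear)
  interpret Dv: bounded_linear ?Dv using bDv by (rule bounded_op_linear)
  interpret Du: bounded_linear "defect U" using bDu by (rule bounded_op_linear)
  have \<phi>: "0 < \<phi>" "\<phi> \<le> pi/2" using assms(14,15) by auto
  have s: "sin \<phi> > 0" using \<phi> by (intro sin_gt_zero) auto
  \<comment> \<open>For unbounded \<open>Q0\<close> the angle \<open>phi1 V U\<close> is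
    \<open>arccos 0 = pi/2\<close>, and the range of \<open>\<phi>\<close> shrinks to the point
    where the cosine vanishes.\<close>
  have Q: "is_Q V U ?Q" if "cos \<phi> \<noteq> 0"
  proof -
    have "Q0_bounded V U"
    proof (rule ccontr)
      assume "\<not> Q0_bounded V U"
      then have "phi1 V U = pi/2" by (simp add: phi1_def Q0_norm_inverse_def)
      then have "\<phi> = pi/2" using assms(15) by simp
      then show False using that by (simp only: cos_pi_half)
    qed
    then show ?thesis unfolding Q_op_def Q0_bounded_def by (rule someI_ex)
  qed
  have T_bound: "bounded_op UNIV UNIV ?T"
  proof -
    obtain c where c: "c \<ge> 0" "\<And>x. x \<in> ?H1 \<Longrightarrow> norm (K x) \<le> c * norm x" using bounded_op_bound[OF K] by blast
    obtain d where d: "\<And>x. norm (defect U x) \<le> norm x * d" using Du.bounded by blast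
    have "bounded_linear (\<lambda>h. K (defect U h))"
    proof (rule bounded_linear_intro[where K="d * c"])
      show "norm (K (defect U h)) \<le> norm h * (d * c)" for h
        using c(2)[OF H1(3), of h] mult_left_mono[OF d[of h] c(1)] by (simp add: mult_ac)
    qed (simp_all add: Du.add Du.scaleR bounded_op_add[OF K H1(3) H1(3)] bounded_op_scaleR[OF K H1(3)])
    note K = bounded_linear_compose[OF this bounded_linear_snd]
    have T_eq: "?T = (\<lambda>p. (T11 (fst p) + T12 (snd p),
        T21 (fst p) + (- V (T11 (U (snd p))) + ?Dv (K (defect U (snd p))))))"
      by (auto simp: T_ext_def)
    note comp = bounded_linear_compose[OF bounded_op_linear]
    have "bounded_linear ?T"
      unfolding T_eq
      by (rule bounded_linear_Pair[OF
            bounded_linear_add[OF comp[OF assms(2) bounded_linear_fst] comp[OF assms(3) bounded_linear_snd]]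
            bounded_linear_add[OF comp[OF assms(4) bounded_linear_fst]
              bounded_linear_add[OF bounded_linear_minus[OF comp[OF bV comp[OF assms(2) comp[OF bU bounded_linear_snd]]]]
                comp[OF bDv K]]]])
    moreover have "?T (\<i> *\<^sub>C p) = \<i> *\<^sub>C ?T p" for p
      unfolding T_eq
      by (simp add: scaleC_prod_def scaleC_add_right bounded_op_scaleC[OF assms(2)] bounded_op_scaleC[OF assms(3)]
          bounded_op_scaleC[OF assms(4)] bounded_op_scaleC[OF bU] bounded_op_scaleC[OF bV] bounded_op_scaleC[OF bDu]
          bounded_op_scaleC[OF bDv] bounded_op_scaleC[OF assms(16) H1(3)]
          complex_vector.scale_minus_right complex_vector.scale_right_diff_distrib)
    ultimately show ?thesis by (simp add: bounded_op_UNIV_iff)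
  qed
  \<comment> \<open>With \<open>c\<close> equal to \<open>cos \<phi>\<close> or
    \<open>- cos \<phi>\<close>, both signs are settled at once.\<close>
  have main: "in_C_half_pi UNIV UNIV (\<lambda>f. sin \<phi> *\<^sub>R ?T f + (\<i> * complex_of_real c) *\<^sub>C f) \<kappa>
      \<longleftrightarrow> in_C_half_pi ?H1 ?H2 (\<lambda>x. sin \<phi> *\<^sub>R K x + (\<i> * complex_of_real c) *\<^sub>C ?Q x) \<kappa>"
    if c: "c\<^sup>2 = (cos \<phi>)\<^sup>2" for c \<kappa>
  proof -
    let ?X = "\<lambda>f. sin \<phi> *\<^sub>R ?T f + (\<i> * complex_of_real c) *\<^sub>C f"
    let ?K' = "\<lambda>x. sin \<phi> *\<^sub>R K x + (\<i> * complex_of_real c) *\<^sub>C ?Q x"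
    have Qc: "is_Q V U ?Q" if "c \<noteq> 0" using that c by (intro Q) auto
    have ic: "(\<i> * complex_of_real c) *\<^sub>C z = c *\<^sub>R (\<i> *\<^sub>C z)" for z :: "'z::complex_inner"
      by (simp add: scaleR_scaleC scaleC_scaleC mult.commute)
    have K'b: "bounded_op ?H1 ?H2 ?K'"
    proof (cases "c = 0")
      case True
      then show ?thesis using bounded_op_cscale[OF K H2(2), of "complex_of_real (sin \<phi>)"]
        by (simp add: scaleR_scaleC)
    next
      case False
      then have "bounded_op ?H1 ?H2 ?Q" using Qc by (simp add: is_Q_def)
      then show ?thesis
        unfolding scaleR_scaleC by (intro bounded_op_plus bounded_op_cscale K H2)
    qed
    \<comment> \<open>The defining relation of \<open>Q\<close> converts its term in
      \<open>K'\<close> into a multiple of \<open>h - V (U h)\<close>: the \<open>h\<close> is the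
      scalar term of the second component, and \<open>V (U h)\<close> cancels against the argument
      of \<open>V\<close> in \<open>X_eq\<close>. For \<open>c = 0\<close> the possibly unspecified
      \<open>Q\<close> is multiplied by zero.\<close>
    have DvK': "?Dv (?K' (defect U h)) = sin \<phi> *\<^sub>R ?Dv (K (defect U h)) + (\<i> * complex_of_real c) *\<^sub>C (h - V (U h))" for h
    proof (cases "c = 0")
      case False
      then have "h - V (U h) = ?Dv (?Q (defect U h))" using Qc by (simp add: is_Q_def)
      then show ?thesis by (simp add: Dv.add Dv.scaleR bounded_op_scaleC[OF bDv])
    qed (simp add: Dv.scaleR)
    have X_eq: "?X (f, h) = (sin \<phi> *\<^sub>R T11 f + (\<i> * complex_of_real c) *\<^sub>C f + sin \<phi> *\<^sub>R defect T11 (U h),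
      V (sin \<phi> *\<^sub>R defect T11 f - (sin \<phi> *\<^sub>R T11 (U h) - (\<i> * complex_of_real c) *\<^sub>C U h)) + ?Dv (?K' (defect U h)))" for f h
      unfolding DvK'
      by (simp add: T_ext_def assms(9,12) scaleC_prod_def V.diff V.scaleR bounded_op_scaleC[OF bV]
          complex_vector.scale_right_diff_distrib scaleR_add_right scaleR_diff_right)
    have Xb: "bounded_op UNIV UNIV ?X"
      using bounded_linear_add[OF bounded_linear_compose[OF bounded_linear_scaleR_right bounded_op_linear[OF T_bound]]
          bounded_linear_scaleC]
      by (simp add: bounded_op_UNIV_iff bounded_op_scaleC[OF T_bound] scaleC_add_right scaleC_scaleR scaleC_scaleC mult.commute)
    have "kappa_minus UNIV (\<lambda>f. f - adj UNIV ?X (?X f)) = kappa_minus ?H1 (\<lambda>f. f - adj ?H1 ?K' (?K' f))"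
      by (rule kappa_minus_block[where s="sin \<phi>" and c=c, OF T11 assms(7) V _ U _ _ _ K'b X_eq Xb])
        (use assms(10,13) s c in auto)
    then show ?thesis using K'b Xb by (simp add: in_C_half_pi_def)
  qed
  show ?thesis
    unfolding in_C_def using main[of "cos \<phi>" \<kappa>p] main[of "- cos \<phi>" \<kappa>m] by (simp add: complex_vector.scale_minus_left)
qed

end
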